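(* Let $\Omega$, $s$, $\Sigma_h$, $U_h$, $T_{F1}$, $T_{F1,h}$ and the eigenvalues and eigenfunctions $\lambda_k,u_k,\lambda_{k,h},u_{k,h}$ be as in the context. Let $\lambda_i=\lambda_{i+1}=\dots=\lambda_{i+m-1}$ be an eigenvalue of multiplicity $m$, let $E=\mathrm{span}\{u_i,\dots,u_{i+m-1}\}$ be its eigenspace and $E_h=\mathrm{span}\{u_{i,h},\dots,u_{i+m-1,h}\}$ the space generated by the corresponding discrete eigenfunctions. Then there is a constant $C$ independent of $h$ such that, for $h$ small enough, for all $j=i,\dots,i+m-1$ there exists $u_h\in E_h$ such that $$\|u_j-u_h\|_{H^1(\Omega)}\le C\sup_{\substack{u\in E\\ \|u\|_{L^2(\Omega)}=1}}\ \inf_{\substack{\boldsymbol{\tau}\in\Sigma_h\\ v\in U_h}}\big(\|\nabla u-\boldsymbol{\tau}\|_{\mathbf{H}(\mathrm{div};\Omega)}+\|u-v\|_{H^1(\Omega)}\big).$$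
   Context: $(\cdot,\cdot)$ is the $L^2(\Omega)$ (or $L^2(\Omega)^d$) inner product; $\mathbf{H}(\mathrm{div};\Omega)=\{\boldsymbol{\tau}\in L^2(\Omega)^d:\mathrm{div}\,\boldsymbol{\tau}\in L^2(\Omega)\}$ with the graph norm; $\mathbf{H}^s(\Omega)=H^s(\Omega)^d$. Assumptions: $\Omega\subset\mathbb{R}^d$ ($d=2,3$) is a Lipschitz polygon/polyhedron and $s\in(1/2,1]$ is such that for every $f\in L^2(\Omega)$ the solution $u\in H^1_0(\Omega)$ of $-\Delta u=f$ belongs to $H^{1+s}(\Omega)$. $\Sigma_h\subset\mathbf{H}(\mathrm{div};\Omega)$ and $U_h\subset H^1_0(\Omega)$ are families of finite dimensional (finite element) spaces indexed by $h>0$ such that, with $C$ independent of $h$, $\inf_{\boldsymbol{\tau}\in\Sigma_h}\|\boldsymbol{\chi}-\boldsymbol{\tau}\|_{\mathbf{H}(\mathrm{div};\Omega)}\le Ch^s(\|\boldsymbol{\chi}\|_{\mathbf{H}^s(\Omega)}+\|\mathrm{div}\,\boldsymbol{\chi}\|_{H^{1+s}(\Omega)})$ and $\inf_{v\in U_h}\|p-v\|_{H^1(\Omega)}\le Ch^s\|p\|_{H^{1+s}(\Omega)}$ for all $\boldsymbol{\chi}\in\mathbf{H}^s(\Omega)$ with $\mathrm{div}\,\boldsymbol{\chi}\in H^{1+s}(\Omega)$ and all $p\in H^{1+s}(\Omega)\cap H^1_0(\Omega)$. Operators: $T_{F1}:L^2(\Omega)\to L^2(\Omega)$ maps $f$ to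 the component $u\in H^1_0(\Omega)$ of the solution $(\boldsymbol{\sigma},u)\in\mathbf{H}(\mathrm{div};\Omega)\times H^1_0(\Omega)$ of $$\begin{cases}(\boldsymbol{\sigma},\boldsymbol{\tau})+(\mathrm{div}\,\boldsymbol{\sigma},\mathrm{div}\,\boldsymbol{\tau})-(\nabla u,\boldsymbol{\tau})=-(f,\mathrm{div}\,\boldsymbol{\tau})&\forall\boldsymbol{\tau}\in\mathbf{H}(\mathrm{div};\Omega)\\ -(\boldsymbol{\sigma},\nabla v)+(\nabla u,\nabla v)=0&\forall v\in H^1_0(\Omega).\end{cases}$$ $T_{F1,h}:L^2(\Omega)\to L^2(\Omega)$ maps $f$ to the component $u_h\in U_h$ of the solution $(\boldsymbol{\sigma}_h,u_h)\in\Sigma_h\times U_h$ of the same equations with test functions $\boldsymbol{\tau}\in\Sigma_h$, $v\in U_h$. Eigenvalues: $0<\lambda_1\le\lambda_2\le\dots$ are the reciprocals of the nonzero eigenvalues of $T_{F1}$ (i.e. the Dirichlet Laplace eigenvalues), repeated according to multiplicity, with eigenfunctions $u_k$; $0<\lambda_{1,h}\le\dots\le\lambda_{N(h),h}$ are the reciprocals of the nonzero eigenvalues of $T_{F1,h}$ (all real and positive), repeated according to multiplicity, with linearly independent eigenfunctions $u_{k,h}\in U_h$. Eigenfunctions are normalized in $L^2(\Omega)$. *)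

theory Defs
  imports "HOL-Analysis.Analysis"
begin

text \<open>
  Elements of function spaces over \<open>\<Omega>\<close> are represented by functions on the whole Euclidean space;
  only their values on \<open>\<Omega>\<close> matter, and these only up to Lebesgue null sets.  All norms, weak
  derivatives and spaces below are invariant under changing a function on a null set.
\<close>

text \<open>
  Near each boundary point, in a suitable direction \<open>e\<close>, the set is the strict supergraph of a
  Lipschitz function \<open>g\<close> of the component orthogonal to \<open>e\<close>.
\<close>

definition lipschitz_boundary :: "'a::euclidean_space set \<Rightarrow> bool" where
  "lipschitz_boundary \<Omega> \<longleftrightarrow>
     (\<forall>p\<in>frontier \<Omega>. \<exists>e W g L. norm e = 1 \<and> open W \<and> p \<in> W \<and>
        L-lipschitz_on {y. y \<bullet> e = 0} (g :: 'a \<Rightarrow> real) \<and>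
        \<Omega> \<inter> W = {x \<in> W. g (x - (x \<bullet> e) *\<^sub>R e) < x \<bullet> e})"

definition lipschitz_polytopal_domain :: "'a::euclidean_space set \<Rightarrow> bool" where
  "lipschitz_polytopal_domain \<Omega> \<longleftrightarrow>
     open \<Omega> \<and> connected \<Omega> \<and> \<Omega> \<noteq> {} \<and> lipschitz_boundary \<Omega> \<and>
     (\<exists>F. finite F \<and> (\<forall>P\<in>F. polytope P) \<and> closure \<Omega> = \<Union>F)"

definition L2 :: "'a::euclidean_space set \<Rightarrow> ('a \<Rightarrow> 'b::euclidean_space) set" where
  "L2 \<Omega> = {f. f \<in> borel_measurable (lebesgue_on \<Omega>) \<and>
               integrable (lebesgue_on \<Omega>) (\<lambda>x. (norm (f x))\<^sup>2)}"

definition L2_inner ::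
    "'a::euclidean_space set \<Rightarrow> ('a \<Rightarrow> 'b::euclidean_space) \<Rightarrow> ('a \<Rightarrow> 'b) \<Rightarrow> real" where
  "L2_inner \<Omega> f g = (LINT x|lebesgue_on \<Omega>. f x \<bullet> g x)"

definition L2_norm :: "'a::euclidean_space set \<Rightarrow> ('a \<Rightarrow> 'b::euclidean_space) \<Rightarrow> real" where
  "L2_norm \<Omega> f = sqrt (L2_inner \<Omega> f f)"

definition partial_deriv :: "'n::finite \<Rightarrow> (real^'n \<Rightarrow> real) \<Rightarrow> real^'n \<Rightarrow> real" where
  "partial_deriv i \<phi> x = frechet_derivative \<phi> (at x) (axis i 1)"

primrec C_k :: "nat \<Rightarrow> (real^'n::finite \<Rightarrow> real) \<Rightarrow> bool" where
  "C_k 0 \<phi> \<longleftrightarrow> continuous_on UNIV \<phi>"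
| "C_k (Suc k) \<phi> \<longleftrightarrow> \<phi> differentiable_on UNIV \<and> (\<forall>i. C_k k (partial_deriv i \<phi>))"

definition test_functions :: "(real^'n::finite) set \<Rightarrow> (real^'n \<Rightarrow> real) set" where
  "test_functions \<Omega> =
     {\<phi>. (\<forall>k. C_k k \<phi>) \<and> (\<exists>K. compact K \<and> K \<subseteq> \<Omega> \<and> (\<forall>x. x \<notin> K \<longrightarrow> \<phi> x = 0))}"

definition has_weak_partial ::
    "(real^'n::finite) set \<Rightarrow> 'n \<Rightarrow> (real^'n \<Rightarrow> real) \<Rightarrow> (real^'n \<Rightarrow> real) \<Rightarrow> bool" where
  "has_weak_partial \<Omega> i u g \<longleftrightarrow> g \<in> L2 \<Omega> \<and>
     (\<forall>\<phi>\<in>test_functions \<Omega>. L2_inner \<Omega> u (partial_deriv i \<phi>) = - L2_inner \<Omega> g \<phi>)"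

definition has_weak_div ::
    "(real^'n::finite) set \<Rightarrow> (real^'n \<Rightarrow> real^'n) \<Rightarrow> (real^'n \<Rightarrow> real) \<Rightarrow> bool" where
  "has_weak_div \<Omega> \<tau> g \<longleftrightarrow> g \<in> L2 \<Omega> \<and>
     (\<forall>\<phi>\<in>test_functions \<Omega>.
        L2_inner \<Omega> \<tau> (\<lambda>x. \<chi> i. partial_deriv i \<phi> x) = - L2_inner \<Omega> g \<phi>)"

text \<open>Weak derivatives are unique almost everywhere, so the choice of representative is harmless.\<close>

definition weak_partial ::
    "(real^'n::finite) set \<Rightarrow> 'n \<Rightarrow> (real^'n \<Rightarrow> real) \<Rightarrow> real^'n \<Rightarrow> real" where
  "weak_partial \<Omega> i u = (SOME g. has_weak_partial \<Omega> i u g)"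

definition weak_grad ::
    "(real^'n::finite) set \<Rightarrow> (real^'n \<Rightarrow> real) \<Rightarrow> real^'n \<Rightarrow> real^'n" where
  "weak_grad \<Omega> u = (\<lambda>x. \<chi> i. weak_partial \<Omega> i u x)"

definition weak_div ::
    "(real^'n::finite) set \<Rightarrow> (real^'n \<Rightarrow> real^'n) \<Rightarrow> real^'n \<Rightarrow> real" where
  "weak_div \<Omega> \<tau> = (SOME g. has_weak_div \<Omega> \<tau> g)"

definition H1 :: "(real^'n::finite) set \<Rightarrow> (real^'n \<Rightarrow> real) set" where
  "H1 \<Omega> = {u \<in> L2 \<Omega>. \<forall>i. \<exists>g. has_weak_partial \<Omega> i u g}"

definition H1_norm :: "(real^'n::finite) set \<Rightarrow> (real^'n \<Rightarrow> real) \<Rightarrow> real" where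
  "H1_norm \<Omega> u = sqrt ((L2_norm \<Omega> u)\<^sup>2 + (L2_norm \<Omega> (weak_grad \<Omega> u))\<^sup>2)"

definition H10 :: "(real^'n::finite) set \<Rightarrow> (real^'n \<Rightarrow> real) set" where
  "H10 \<Omega> = {u \<in> H1 \<Omega>. \<forall>\<epsilon>>0. \<exists>\<phi>\<in>test_functions \<Omega>. H1_norm \<Omega> (\<lambda>x. u x - \<phi> x) < \<epsilon>}"

definition Hdiv :: "(real^'n::finite) set \<Rightarrow> (real^'n \<Rightarrow> real^'n) set" where
  "Hdiv \<Omega> = {\<tau> \<in> L2 \<Omega>. \<exists>g. has_weak_div \<Omega> \<tau> g}"

definition Hdiv_norm :: "(real^'n::finite) set \<Rightarrow> (real^'n \<Rightarrow> real^'n) \<Rightarrow> real" where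
  "Hdiv_norm \<Omega> \<tau> = sqrt ((L2_norm \<Omega> \<tau>)\<^sup>2 + (L2_norm \<Omega> (weak_div \<Omega> \<tau>))\<^sup>2)"

text \<open>
  The Sobolev--Slobodeckij scale: \<open>Hs \<Omega> s\<close> is \<open>H^s(\<Omega>)\<close> for \<open>0 < s \<le> 1\<close>, and \<open>H1s \<Omega> s\<close> is
  \<open>H^(1+s)(\<Omega>)\<close>; both carry no intended meaning for other values of \<open>s\<close>.
\<close>

definition slobodeckij :: "(real^'n::finite) set \<Rightarrow> real \<Rightarrow> (real^'n \<Rightarrow> real) \<Rightarrow> ennreal" where
  "slobodeckij \<Omega> s u =
     (\<integral>\<^sup>+x. \<integral>\<^sup>+y. ennreal ((u x - u y)\<^sup>2 / norm (x - y) powr (real CARD('n) + 2 * s))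
        \<partial>lebesgue_on \<Omega> \<partial>lebesgue_on \<Omega>)"

definition Hs :: "(real^'n::finite) set \<Rightarrow> real \<Rightarrow> (real^'n \<Rightarrow> real) set" where
  "Hs \<Omega> s = (if s = 1 then H1 \<Omega> else {u \<in> L2 \<Omega>. slobodeckij \<Omega> s u < \<infinity>})"

definition Hs_norm :: "(real^'n::finite) set \<Rightarrow> real \<Rightarrow> (real^'n \<Rightarrow> real) \<Rightarrow> real" where
  "Hs_norm \<Omega> s u =
     (if s = 1 then H1_norm \<Omega> u else sqrt ((L2_norm \<Omega> u)\<^sup>2 + enn2real (slobodeckij \<Omega> s u)))"

definition Hs_vec :: "(real^'n::finite) set \<Rightarrow> real \<Rightarrow> (real^'n \<Rightarrow> real^'n) set" where
  "Hs_vec \<Omega> s = {\<tau>. \<forall>i. (\<lambda>x. \<tau> x $ i) \<in> Hs \<Omega> s}"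

definition Hs_vec_norm :: "(real^'n::finite) set \<Rightarrow> real \<Rightarrow> (real^'n \<Rightarrow> real^'n) \<Rightarrow> real" where
  "Hs_vec_norm \<Omega> s \<tau> = sqrt (\<Sum>i\<in>UNIV. (Hs_norm \<Omega> s (\<lambda>x. \<tau> x $ i))\<^sup>2)"

definition H1s :: "(real^'n::finite) set \<Rightarrow> real \<Rightarrow> (real^'n \<Rightarrow> real) set" where
  "H1s \<Omega> s = {u \<in> H1 \<Omega>. \<forall>i. weak_partial \<Omega> i u \<in> Hs \<Omega> s}"

definition H1s_norm :: "(real^'n::finite) set \<Rightarrow> real \<Rightarrow> (real^'n \<Rightarrow> real) \<Rightarrow> real" where
  "H1s_norm \<Omega> s u =
     sqrt ((L2_norm \<Omega> u)\<^sup>2 + (\<Sum>i\<in>UNIV. (Hs_norm \<Omega> s (weak_partial \<Omega> i u))\<^sup>2))"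

definition dirichlet_regularity :: "(real^'n::finite) set \<Rightarrow> real \<Rightarrow> bool" where
  "dirichlet_regularity \<Omega> s \<longleftrightarrow>
     (\<forall>f\<in>L2 \<Omega>. \<forall>u\<in>H10 \<Omega>.
        (\<forall>v\<in>H10 \<Omega>. L2_inner \<Omega> (weak_grad \<Omega> u) (weak_grad \<Omega> v) = L2_inner \<Omega> f v)
        \<longrightarrow> u \<in> H1s \<Omega> s)"

text \<open>
  Finite dimensionality is required modulo null sets, so that \<open>V\<close> may consist of selected
  representatives or be closed under almost-everywhere equality.
\<close>

definition finite_dim_space ::
    "'a::euclidean_space set \<Rightarrow> ('a \<Rightarrow> 'b::euclidean_space) set \<Rightarrow> bool" where
  "finite_dim_space \<Omega> V \<longleftrightarrow>
     (\<lambda>x. 0) \<in> V \<and>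
     (\<forall>v\<in>V. \<forall>w\<in>V. (\<lambda>x. v x + w x) \<in> V) \<and>
     (\<forall>v\<in>V. \<forall>c::real. (\<lambda>x. c *\<^sub>R v x) \<in> V) \<and>
     (\<exists>n b. (\<forall>k<n::nat. b k \<in> V) \<and>
        (\<forall>v\<in>V. \<exists>c::nat \<Rightarrow> real. AE x in lebesgue_on \<Omega>. v x = (\<Sum>k<n. c k *\<^sub>R b k x)))"

definition Sigma_approximation ::
    "(real^'n::finite) set \<Rightarrow> real \<Rightarrow> (real \<Rightarrow> (real^'n \<Rightarrow> real^'n) set) \<Rightarrow> bool" where
  "Sigma_approximation \<Omega> s \<Sigma>h \<longleftrightarrow>
     (\<exists>C. \<forall>h>0. \<forall>\<xi>. \<xi> \<in> Hs_vec \<Omega> s \<and> \<xi> \<in> Hdiv \<Omega> \<and> weak_div \<Omega> \<xi> \<in> H1s \<Omega> s \<longrightarrow>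
        (INF \<tau>\<in>\<Sigma>h h. Hdiv_norm \<Omega> (\<lambda>x. \<xi> x - \<tau> x))
          \<le> C * h powr s * (Hs_vec_norm \<Omega> s \<xi> + H1s_norm \<Omega> s (weak_div \<Omega> \<xi>)))"

definition U_approximation ::
    "(real^'n::finite) set \<Rightarrow> real \<Rightarrow> (real \<Rightarrow> (real^'n \<Rightarrow> real) set) \<Rightarrow> bool" where
  "U_approximation \<Omega> s Uh \<longleftrightarrow>
     (\<exists>C. \<forall>h>0. \<forall>p\<in>H1s \<Omega> s \<inter> H10 \<Omega>.
        (INF v\<in>Uh h. H1_norm \<Omega> (\<lambda>x. p x - v x)) \<le> C * h powr s * H1s_norm \<Omega> s p)"

definition F1_solution ::
    "(real^'n::finite) set \<Rightarrow> (real^'n \<Rightarrow> real^'n) set \<Rightarrow> (real^'n \<Rightarrow> real) set \<Rightarrow>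
     (real^'n \<Rightarrow> real) \<Rightarrow> (real^'n \<Rightarrow> real^'n) \<Rightarrow> (real^'n \<Rightarrow> real) \<Rightarrow> bool" where
  "F1_solution \<Omega> S U f \<sigma> u \<longleftrightarrow> \<sigma> \<in> S \<and> u \<in> U \<and>
     (\<forall>\<tau>\<in>S. L2_inner \<Omega> \<sigma> \<tau> + L2_inner \<Omega> (weak_div \<Omega> \<sigma>) (weak_div \<Omega> \<tau>)
              - L2_inner \<Omega> (weak_grad \<Omega> u) \<tau> = - L2_inner \<Omega> f (weak_div \<Omega> \<tau>)) \<and>
     (\<forall>v\<in>U. - L2_inner \<Omega> \<sigma> (weak_grad \<Omega> v)
              + L2_inner \<Omega> (weak_grad \<Omega> u) (weak_grad \<Omega> v) = 0)"

text \<open>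
  The solution is unique almost everywhere (the left-hand side is the coercive least-squares form),
  so the operator is determined up to null sets.
\<close>

definition F1_operator ::
    "(real^'n::finite) set \<Rightarrow> (real^'n \<Rightarrow> real^'n) set \<Rightarrow> (real^'n \<Rightarrow> real) set \<Rightarrow>
     (real^'n \<Rightarrow> real) \<Rightarrow> (real^'n \<Rightarrow> real)" where
  "F1_operator \<Omega> S U f = (SOME u. \<exists>\<sigma>. F1_solution \<Omega> S U f \<sigma> u)"

definition T_F1 :: "(real^'n::finite) set \<Rightarrow> (real^'n \<Rightarrow> real) \<Rightarrow> (real^'n \<Rightarrow> real)" where
  "T_F1 \<Omega> = F1_operator \<Omega> (Hdiv \<Omega>) (H10 \<Omega>)"

definition T_F1h ::
    "(real^'n::finite) set \<Rightarrow> (real \<Rightarrow> (real^'n \<Rightarrow> real^'n) set) \<Rightarrow>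
     (real \<Rightarrow> (real^'n \<Rightarrow> real) set) \<Rightarrow> real \<Rightarrow> (real^'n \<Rightarrow> real) \<Rightarrow> (real^'n \<Rightarrow> real)" where
  "T_F1h \<Omega> \<Sigma>h Uh h = F1_operator \<Omega> (\<Sigma>h h) (Uh h)"

definition lin_span :: "(nat \<Rightarrow> 'a \<Rightarrow> real) \<Rightarrow> nat set \<Rightarrow> ('a \<Rightarrow> real) set" where
  "lin_span u K = {w. \<exists>c F. finite F \<and> F \<subseteq> K \<and> w = (\<lambda>x. \<Sum>k\<in>F. c k * u k x)}"

text \<open>
  \<open>lam\<close> lists in nondecreasing order the reciprocals of all nonzero eigenvalues of \<open>T\<close>, each repeated
  according to its multiplicity: for every \<open>\<mu> \<noteq> 0\<close> the functions \<open>u k\<close> with \<open>lam k = 1 / \<mu>\<close> form a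
  basis, modulo null sets, of the eigenspace of \<open>\<mu>\<close> (which is trivial if \<open>\<mu>\<close> is not an eigenvalue).
\<close>

definition eigen_enumeration ::
    "'a::euclidean_space set \<Rightarrow> (('a \<Rightarrow> real) \<Rightarrow> ('a \<Rightarrow> real)) \<Rightarrow> nat set \<Rightarrow>
     (nat \<Rightarrow> real) \<Rightarrow> (nat \<Rightarrow> 'a \<Rightarrow> real) \<Rightarrow> bool" where
  "eigen_enumeration \<Omega> T I lam u \<longleftrightarrow>
     mono_on I lam \<and>
     (\<forall>k\<in>I. 0 < lam k \<and> u k \<in> L2 \<Omega> \<and> L2_norm \<Omega> (u k) = 1 \<and>
        (AE x in lebesgue_on \<Omega>. T (u k) x = (1 / lam k) * u k x)) \<and>
     (\<forall>F c. finite F \<and> F \<subseteq> I \<and> (AE x in lebesgue_on \<Omega>. (\<Sum>k\<in>F. c k * u k x) = 0)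
        \<longrightarrow> (\<forall>k\<in>F. c k = 0)) \<and>
     (\<forall>\<mu> w. \<mu> \<noteq> 0 \<and> w \<in> L2 \<Omega> \<and> (AE x in lebesgue_on \<Omega>. T w x = \<mu> * w x)
        \<longrightarrow> (\<exists>w'\<in>lin_span u {k\<in>I. lam k = 1 / \<mu>}. AE x in lebesgue_on \<Omega>. w x = w' x))"

definition best_approximation_error ::
    "(real^'n::finite) set \<Rightarrow> (real^'n \<Rightarrow> real^'n) set \<Rightarrow> (real^'n \<Rightarrow> real) set \<Rightarrow>
     (real^'n \<Rightarrow> real) set \<Rightarrow> real" where
  "best_approximation_error \<Omega> S U E =
     (SUP w\<in>{w\<in>E. L2_norm \<Omega> w = 1}. INF (\<tau>, v)\<in>S \<times> U.
        Hdiv_norm \<Omega> (\<lambda>x. weak_grad \<Omega> w x - \<tau> x) + H1_norm \<Omega> (\<lambda>x. w x - v x))"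

end

theory Submission
  imports Defs
begin

text \<open>
  Eliminating \<open>u\<close> makes the eigenvalue problem symmetric: with \<open>Q\<close> the \<open>L2\<close> projection onto the
  gradients of \<open>H10\<close>, the eigenfunctions of \<open>T_F1\<close> for \<open>\<lambda>\<close> correspond to the solutions \<open>\<sigma>\<close> of
  \<open>(\<sigma>, \<tau>) + (div \<sigma>, div \<tau>) = (1 + \<lambda>) (Q \<sigma>, \<tau>)\<close>, where \<open>\<nabla>u = Q \<sigma>\<close>.  Hence they are eigenvectors
  for \<open>1 / (1 + \<lambda>)\<close> of the self-adjoint operator \<open>S = P Q P\<close>, with \<open>P\<close> the projection onto the graph
  of the divergence, and the discrete problem has the same form with smaller projections
  \<open>P\<^sub>h\<close>, \<open>Q\<^sub>h\<close>.  The approximation hypotheses and the regularity of the Dirichlet problem give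
  \<open>S\<^sub>h x \<rightarrow> S x\<close> with a rate for each \<open>x\<close>, hence in norm by uniform boundedness; in particular \<open>S\<close> is
  compact.  By the min-max principle the discrete cluster is then separated from the rest of the
  discrete spectrum, so an eigenvector \<open>\<sigma>\<close> of \<open>S\<close> is at distance at most a constant times
  \<open>\<parallel>(S - S\<^sub>h) \<sigma>\<parallel>\<close> from the span of the discrete cluster, and this consistency error is bounded by
  best approximation errors.  The gradient is recovered from \<open>\<sigma>\<close> by \<open>Q\<close>, and \<open>u\<close> by the
  Poincare inequality.
\<close>

section \<open>Hilbert space preliminaries\<close>

text \<open>The map from \<open>f\<close> to \<open>u_h\<close> is not visibly symmetric in L2, so
  Rayleigh quotients are out of reach for it. Symmetry appears only for eigenpairs: with data
  \<lambda> times \<open>u\<close>, Green's formula moves the right-hand side into the gradient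
  term, and conformity of the discrete spaces makes this exact there too. This is where
  \<open>1 + \<lambda>\<close> comes from. The obstacle is that the discrete projections approach
  the continuous ones only pointwise, with a rate on smooth arguments. They are controlled in norm
  because the error of \<open>P_h\<close> always meets the smoothing operator \<open>S\<close>:
  after it directly, and before it by transposition, since \<open>S\<close> is self-adjoint.
  Gradient and divergence are unbounded in L2. They are therefore represented by their graphs,
  closed subspaces of products of Hilbert spaces, so that all operators in the spectral argument are
  compositions of orthogonal projections.\<close>

lemma riesz_representation_on_subspace:
  fixes V :: "'a::{real_inner,complete_space} set"
  assumes V: "subspace V" "closed V"
    and lin: "linear l" and bd: "\<And>v. v \<in> V \<Longrightarrow> \<bar>l v\<bar> \<le> B * norm v"
  shows "\<exists>w\<in>V. \<forall>v\<in>V. l v = w \<bullet> v"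
proof -
  have B0: "\<bar>l v\<bar> \<le> \<bar>B\<bar> * norm v" if "v \<in> V" for v
    by (rule order_trans[OF bd[OF that]]) (simp add: mult_right_mono)
  \<comment> \<open>If \<open>w\<close> represents \<open>l\<close> on \<open>V\<close>, then
    \<open>J v\<close> is the squared distance from \<open>v\<close> to \<open>w\<close> up to a
    constant; so the representer is sought as a minimizer of \<open>J\<close> on
    \<open>V\<close>.\<close>
  define J where "J v = v \<bullet> v - 2 * l v" for v
  have Jlow: "J v \<ge> - B\<^sup>2" if "v \<in> V" for v
  proof -
    have "J v \<ge> (norm v)\<^sup>2 - 2 * \<bar>B\<bar> * norm v"
      using B0[OF that] unfolding J_def power2_norm_eq_inner by linarith
    moreover have "0 \<le> (norm v - \<bar>B\<bar>)\<^sup>2" by simp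
    ultimately show ?thesis by (simp add: power2_diff algebra_simps)
  qed
  define m where "m = (INF v\<in>V. J v)"
  have bdd: "bdd_below (J ` V)" using Jlow by (auto intro!: bdd_belowI2)
  have V0: "V \<noteq> {}" using subspace_0[OF V(1)] by auto
  have mle: "m \<le> J v" if "v \<in> V" for v
    unfolding m_def by (rule cINF_lower[OF bdd that])
  define q where "q n = inverse (real (Suc n))" for n
  have q0: "q n > 0" for n by (simp add: q_def)
  have "\<exists>v\<in>V. J v < m + q n" for n
  proof -
    have "(INF v\<in>V. J v) < m + q n" unfolding m_def using q0 by simp
    then show ?thesis using cINF_less_iff[OF V0 bdd] by blast
  qed
  then obtain x where xV: "\<And>n. x n \<in> V" and xJ: "\<And>n. J (x n) < m + q n" by metis
  have par: "(norm (x i - x j))\<^sup>2 \<le> 2 * q i + 2 * q j" for i j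
  proof -
    let ?z = "(1/2) *\<^sub>R (x i + x j)"
    have zV: "?z \<in> V" using xV V(1) by (simp add: subspace_add subspace_scale)
    \<comment> \<open>Parallelogram law: the linear parts of \<open>J\<close> cancel because the
      midpoint enters with weight 4. Two near-minimizers are thus close to each other.\<close>
    have "(norm (x i - x j))\<^sup>2 = 2 * J (x i) + 2 * J (x j) - 4 * J ?z"
      unfolding J_def power2_norm_eq_inner linear_add[OF lin] linear_scale[OF lin]
      by (simp add: inner_add inner_diff inner_commute[of "x j" "x i"] algebra_simps)
    then show ?thesis using mle[OF zV] xJ[of i] xJ[of j] by linarith
  qed
  have "Cauchy x"
  proof (rule metric_CauchyI)
    fix e :: real assume e: "e > 0"
    obtain M where M: "q M < e\<^sup>2 / 4"
      using reals_Archimedean[of "e\<^sup>2 / 4"] e unfolding q_def by auto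
    have "dist (x i) (x j) < e" if "i \<ge> M" "j \<ge> M" for i j
    proof -
      have inv: "q k \<le> q M" if "k \<ge> M" for k
        unfolding q_def by (rule le_imp_inverse_le) (use that in simp_all)
      have "(norm (x i - x j))\<^sup>2 < e\<^sup>2"
        using par[of i j] M inv[OF that(1)] inv[OF that(2)] by linarith
      then show ?thesis unfolding dist_norm by (rule power_less_imp_less_base) (use e in simp)
    qed
    then show "\<exists>M. \<forall>m\<ge>M. \<forall>n\<ge>M. dist (x m) (x n) < e" by blast
  qed
  then obtain w where w: "x \<longlonglongrightarrow> w" using Cauchy_convergent convergent_def by blast
  have wV: "w \<in> V" using closed_sequentially[OF V(2)] xV w by blast
  have lw: "(\<lambda>n. l (x n)) \<longlonglongrightarrow> l w"
  proof -
    have "norm (l (x n) - l w) \<le> \<bar>B\<bar> * norm (x n - w)" for n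
      using B0[OF subspace_diff[OF V(1) xV wV], of n] linear_diff[OF lin, of "x n" w] by simp
    moreover have "(\<lambda>n. norm (x n - w)) \<longlonglongrightarrow> 0"
      by (intro tendsto_norm_zero LIM_zero w)
    then have "(\<lambda>n. \<bar>B\<bar> * norm (x n - w)) \<longlonglongrightarrow> 0"
      by (rule tendsto_mult_right_zero)
    ultimately have "(\<lambda>n. l (x n) - l w) \<longlonglongrightarrow> 0"
      by (metis (no_types, lifting) Lim_null_comparison always_eventually)
    then show ?thesis by (rule LIM_zero_cancel)
  qed
  have "(\<lambda>n. J (x n)) \<longlonglongrightarrow> J w" unfolding J_def by (intro tendsto_intros w lw)
  moreover have "(\<lambda>n. m + q n) \<longlonglongrightarrow> m + 0"
    unfolding q_def by (intro tendsto_intros LIMSEQ_inverse_real_of_nat)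
  ultimately have Jw: "J w \<le> m"
    using LIMSEQ_le[of "\<lambda>n. J (x n)" "J w" "\<lambda>n. m + q n" m] xJ less_imp_le by auto
  have "l v = w \<bullet> v" if v: "v \<in> V" for v
  proof (cases "v = 0")
    case True then show ?thesis by (simp add: linear_0[OF lin])
  next
    case False
    let ?d = "l v - w \<bullet> v"
    \<comment> \<open>The minimizer of the quadratic
      \<open>t \<mapsto> J (w + t *\<^sub>R v)\<close>. It lowers \<open>J\<close> by
      \<open>?d\<^sup>2 / (v \<bullet> v)\<close>, which minimality of \<open>w\<close> forbids
      unless \<open>?d = 0\<close>.\<close>
    let ?t = "?d / (v \<bullet> v)"
    have vv: "v \<bullet> v > 0" using False by simp
    have "J (w + t *\<^sub>R v) = J w - 2 * t * ?d + t * t * (v \<bullet> v)" for t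
      unfolding J_def linear_add[OF lin] linear_scale[OF lin]
      by (simp add: inner_add inner_commute[of v w] algebra_simps)
    then have "J (w + ?t *\<^sub>R v) = J w - 2 * ?t * ?d + ?t * ?t * (v \<bullet> v)" .
    also have "\<dots> = J w - ?d\<^sup>2 / (v \<bullet> v)" using vv by (simp add: power2_eq_square)
    finally have "?d\<^sup>2 / (v \<bullet> v) \<le> 0"
      using mle[of "w + ?t *\<^sub>R v"] Jw wV v V(1) by (simp add: subspace_add subspace_scale)
    then have "?d\<^sup>2 \<le> 0" using vv by (simp add: divide_le_0_iff)
    then show ?thesis by simp
  qed
  then show ?thesis using wV by blast
qed

section \<open>Orthogonal projections onto closed subspaces\<close>

definition proj :: "'a::real_inner set \<Rightarrow> 'a \<Rightarrow> 'a" where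
  "proj V x = (SOME p. p \<in> V \<and> (\<forall>v\<in>V. (x - p) \<bullet> v = 0))"

locale closed_subspace =
  fixes V :: "'a::{real_inner,complete_space} set"
  assumes sub: "subspace V" and clo: "closed V"
begin

text \<open>The projection of \<open>x\<close> is the Riesz representer within \<open>V\<close> of
  the functional \<open>v \<mapsto> x \<bullet> v\<close>; this is where closedness and completeness
  enter.\<close>

lemma proj_props: "proj V x \<in> V \<and> (\<forall>v\<in>V. (x - proj V x) \<bullet> v = 0)"
proof -
  have "\<exists>w\<in>V. \<forall>v\<in>V. (\<lambda>v. x \<bullet> v) v = w \<bullet> v"
    by (rule riesz_representation_on_subspace[OF sub clo, where B="norm x"])
       (auto intro!: linearI simp: inner_simps Cauchy_Schwarz_ineq2)
  then have "\<exists>p. p \<in> V \<and> (\<forall>v\<in>V. (x - p) \<bullet> v = 0)" by (auto simp: inner_simps)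
  then show ?thesis unfolding proj_def by (rule someI_ex)
qed

lemma proj_in [simp]: "proj V x \<in> V" using proj_props by blast
lemma proj_orth: "v \<in> V \<Longrightarrow> (x - proj V x) \<bullet> v = 0" using proj_props by blast
lemma proj_inner: "v \<in> V \<Longrightarrow> proj V x \<bullet> v = x \<bullet> v" using proj_orth[of v x] by (simp add: inner_simps)

lemma proj_eqI: "p \<in> V \<Longrightarrow> (\<And>v. v \<in> V \<Longrightarrow> p \<bullet> v = x \<bullet> v) \<Longrightarrow> proj V x = p"
proof -
  assume p: "p \<in> V" "\<And>v. v \<in> V \<Longrightarrow> p \<bullet> v = x \<bullet> v"
  have "proj V x - p \<in> V" using p sub by (simp add: subspace_diff)
  then have "(proj V x - p) \<bullet> (proj V x - p) = 0"
    using p(2)[of "proj V x - p"] proj_inner[of "proj V x - p" x] by (simp add: inner_simps)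
  then show ?thesis by simp
qed

lemma proj_id [simp]: "x \<in> V \<Longrightarrow> proj V x = x" by (rule proj_eqI) auto

lemma linear_proj: "linear (proj V)"
  by (rule linearI; rule proj_eqI)
     (auto simp: subspace_add subspace_scale sub inner_simps proj_inner)

lemma proj_pythagoras: "(norm x)\<^sup>2 = (norm (proj V x))\<^sup>2 + (norm (x - proj V x))\<^sup>2"
  using proj_orth[of "proj V x" x]
  by (simp add: power2_norm_eq_inner inner_simps inner_commute)

lemma norm_proj_le: "norm (proj V x) \<le> norm x"
  by (rule power2_le_imp_le) (use proj_pythagoras[of x] in auto)

lemma proj_best: "v \<in> V \<Longrightarrow> norm (x - proj V x) \<le> norm (x - v)"
proof -
  assume v: "v \<in> V"
  have "(norm (x - v))\<^sup>2 = (norm (x - proj V x))\<^sup>2 + (norm (proj V x - v))\<^sup>2"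
    using proj_orth[of "proj V x - v" x] v sub
    by (simp add: subspace_diff power2_norm_eq_inner inner_simps inner_commute)
  then have "(norm (x - proj V x))\<^sup>2 \<le> (norm (x - v))\<^sup>2" by simp
  then show ?thesis by (rule power2_le_imp_le) simp
qed

lemma norm_compl_le: "norm (x - proj V x) \<le> norm x"
  using proj_best[of 0 x] subspace_0[OF sub] by simp

lemma proj_selfadj: "proj V x \<bullet> y = x \<bullet> proj V y"
  using proj_inner[of "proj V x" y] proj_inner[of "proj V y" x] by (simp add: inner_commute)

lemma bounded_linear_proj: "bounded_linear (proj V)"
  using linear_proj norm_proj_le
  by (auto intro!: bounded_linear_intro[where K=1] simp: linear_add linear_scale)

end

text \<open>An orthogonal generating set gives a continuous projection formula \<open>p\<close>, and
  the span is the set of its fixed points.\<close>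

lemma closed_span_finite:
  fixes B :: "'a::real_inner set"
  assumes "finite B" shows "closed (span B)"
proof -
  obtain C where C: "finite C" "span C = span B" "pairwise orthogonal C"
    using basis_orthogonal[OF assms] by blast
  \<comment> \<open>\<open>C\<close> may contain 0; division by zero then yields the coefficient 0,
    which is harmless.\<close>
  define p where "p x = (\<Sum>c\<in>C. (x \<bullet> c / (c \<bullet> c)) *\<^sub>R c)" for x
  have px: "p x = x" if "x \<in> span C" for x
    using that
  proof (induct rule: span_induct_alt)
    case base show ?case by (simp add: p_def)
  next
    case (step k b y)
    have "p b = (\<Sum>c\<in>C. if c = b then b else 0)" unfolding p_def
    proof (rule sum.cong)
      fix c assume "c \<in> C"
      then show "(b \<bullet> c / (c \<bullet> c)) *\<^sub>R c = (if c = b then b else 0)"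
        using C(3) step(1) by (cases "c = b"; cases "c = 0") (auto simp: pairwise_def orthogonal_def)
    qed simp
    then have "p b = b" using step(1) C(1) by simp
    moreover have "p (k *\<^sub>R b + y) = k *\<^sub>R p b + p y"
      unfolding p_def by (simp add: inner_simps add_divide_distrib scaleR_add_left sum.distrib scaleR_sum_right)
    ultimately show ?case using step by simp
  qed
  have pin: "p x \<in> span C" for x unfolding p_def by (intro span_sum span_scale span_base)
  have "span C = {x. p x = x}"
  proof (intro set_eqI iffI)
    fix x assume "x \<in> {x. p x = x}"
    then show "x \<in> span C" using pin[of x] by simp
  qed (use px in simp)
  moreover have "continuous_on UNIV p"
    unfolding p_def divide_inverse by (intro continuous_intros)
  ultimately show ?thesis using C(2) closed_Collect_eq[of p "\<lambda>x. x"] by (auto intro: continuous_intros)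
qed

lemma closed_subspace_span_finite:
  fixes B :: "'a::{real_inner,complete_space} set"
  shows "finite B \<Longrightarrow> closed_subspace (span B)"
  by unfold_locales (simp_all add: closed_span_finite)

lemma closed_subspace_of_finite_dim:
  fixes V :: "'a::{real_inner,complete_space} set"
  assumes "subspace V" "finite B" "V \<subseteq> span B"
  shows "closed_subspace V" "\<exists>C. finite C \<and> V = span C"
proof -
  obtain C where C: "C \<subseteq> V" "independent C" "V \<subseteq> span C"
    using maximal_independent_subset[of V] by blast
  have "finite C"
    using independent_span_bound[OF assms(2) C(2)] C(1) assms(3) by auto
  moreover have "V = span C" using C assms(1) by (metis span_subspace)
  ultimately show "\<exists>C. finite C \<and> V = span C" "closed_subspace V"
    using closed_subspace_span_finite by auto
qed

text \<open>\<open>W\<close> is an arbitrary set: the complement is an intersection of kernels of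
  continuous functionals. Weak differentiability is a condition of this form, so the graphs of the
  weak gradient and divergence get their closedness from here.\<close>

lemma closed_subspace_orthogonal_complement:
  fixes W :: "'a::{real_inner,complete_space} set"
  shows "closed_subspace {x. \<forall>w\<in>W. x \<bullet> w = 0}"
proof
  show "subspace {x. \<forall>w\<in>W. x \<bullet> w = 0}" by (auto simp: subspace_def inner_simps)
  have "{x. \<forall>w\<in>W. x \<bullet> w = 0} = (\<Inter>w\<in>W. {x. x \<bullet> w = 0})" by auto
  then show "closed {x. \<forall>w\<in>W. x \<bullet> w = 0}"
    by (auto intro!: closed_INT closed_Collect_eq continuous_intros)
qed

text \<open>Gliding hump argument avoiding the Baire category theorem (Sokal).\<close>

lemma uniform_boundedness:
  fixes T :: "'i \<Rightarrow> 'a::banach \<Rightarrow> 'b::real_normed_vector"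
  assumes bl: "\<And>i. i \<in> I \<Longrightarrow> bounded_linear (T i)"
    and pw: "\<And>x. \<exists>C. \<forall>i\<in>I. norm (T i x) \<le> C"
  shows "\<exists>C. \<forall>i\<in>I. \<forall>x. norm (T i x) \<le> C * norm x"
proof (rule ccontr)
  assume neg: "\<not> ?thesis"
  have hump: "\<exists>x'. dist x x' \<le> r \<and> (\<exists>i\<in>I. norm (T i x') > n)" if r: "r > 0" for x r n
  proof -
    obtain i v where i: "i \<in> I" and v: "norm (T i v) > (n / r) * norm v"
      using neg by (meson not_le)
    interpret bounded_linear "T i" by (rule bl[OF i])
    have "v \<noteq> 0" using v by (auto simp: zero)
    define w where "w = (r / norm v) *\<^sub>R v"
    have nw: "norm w = r" using \<open>v \<noteq> 0\<close> r by (simp add: w_def)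
    have Tw: "norm (T i w) > n"
    proof -
      have "norm (T i w) = r / norm v * norm (T i v)" using r by (simp add: w_def scaleR)
      also have "\<dots> > r / norm v * ((n / r) * norm v)"
        using v r \<open>v \<noteq> 0\<close> by (intro mult_strict_left_mono) auto
      finally show ?thesis using r \<open>v \<noteq> 0\<close> by simp
    qed
    \<comment> \<open>The images of \<open>x + w\<close> and \<open>x - w\<close> differ by twice
      the image of \<open>w\<close>, so one of them is at least as large as that image, whatever
      \<open>x\<close> is.\<close>
    have "norm (T i (2 *\<^sub>R w)) \<le> norm (T i (x + w)) + norm (T i (x - w))"
      using norm_triangle_ineq4[of "T i (x + w)" "T i (x - w)"]
      by (simp add: add diff scaleR algebra_simps scaleR_2)
    then have "2 * norm (T i w) \<le> norm (T i (x + w)) + norm (T i (x - w))"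
      by (simp add: scaleR)
    then have "norm (T i (x + w)) > n \<or> norm (T i (x - w)) > n" using Tw by linarith
    then show ?thesis
      using i nw by (auto simp: dist_norm intro: exI[of _ "x + w"] exI[of _ "x - w"])
  qed
  text \<open>Radii shrink so fast that the hump at stage \<open>n\<close> survives all later corrections.\<close>
  define good where "good n p q \<longleftrightarrow> (case (p, q) of ((x, r), (x', r')) \<Rightarrow>
     dist x x' \<le> r / 2 \<and> 0 < r' \<and> r' \<le> r / 2 \<and>
     (\<exists>i\<in>I. \<forall>y. dist x' y \<le> r' \<longrightarrow> norm (T i y) \<ge> real n))" for n :: nat and p q :: "'a \<times> real"
  have ex: "\<exists>q. good n p q" if p: "0 < snd p" for n p
  proof -
    obtain x' i where x': "dist (fst p) x' \<le> snd p / 2" "i \<in> I" "norm (T i x') > real n + 1"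
      using hump[of "snd p / 2" "fst p" "real n + 1"] p by auto
    interpret bounded_linear "T i" by (rule bl[OF x'(2)])
    obtain K where K: "K > 0" "\<And>x. norm (T i x) \<le> norm x * K" using pos_bounded by blast
    \<comment> \<open>Within radius \<open>1 / K\<close> the value of the operator moves by at most
      1, which the surplus 1 in \<open>real n + 1\<close> absorbs.\<close>
    have "norm (T i y) \<ge> real n" if "dist x' y \<le> min (snd p / 2) (1 / K)" for y
    proof -
      have "norm (T i (x' - y)) \<le> norm (x' - y) * K" by (rule K)
      also have "\<dots> \<le> 1 / K * K" using that K by (intro mult_right_mono) (auto simp: dist_norm)
      finally have "norm (T i x' - T i y) \<le> 1" using K by (simp add: diff)
      then show ?thesis using x'(3) norm_triangle_ineq2[of "T i x'" "T i y"] by linarith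
    qed
    then have "\<exists>i\<in>I. \<forall>y. dist x' y \<le> min (snd p / 2) (1 / K) \<longrightarrow> norm (T i y) \<ge> real n"
      using x'(2) by blast
    then show ?thesis using x'(1) p K(1)
      unfolding good_def case_prod_unfold fst_conv snd_conv
      by (intro exI[of _ "(x', min (snd p / 2) (1 / K))"]) simp
  qed
  define P where "P = rec_nat (0, 1) (\<lambda>n p. SOME q. good n p q)"
  have pos: "0 < snd (P n)" for n
  proof (induct n)
    case (Suc n)
    have "good n (P n) (P (Suc n))" unfolding P_def using someI_ex[OF ex[OF Suc, of n]] by (simp add: P_def)
    then show ?case by (auto simp: good_def split: prod.splits)
  qed (simp add: P_def)
  have gd: "good n (P n) (P (Suc n))" for n
    using someI_ex[OF ex[OF pos[of n], of n]] by (simp add: P_def)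
  define x r where "x n = fst (P n)" and "r n = snd (P n)" for n
  have g1: "dist (x n) (x (Suc n)) \<le> r n / 2" and g2: "r (Suc n) \<le> r n / 2"
    and g3: "\<exists>i\<in>I. \<forall>y. dist (x (Suc n)) y \<le> r (Suc n) \<longrightarrow> norm (T i y) \<ge> real n" for n
    using gd[of n] by (auto simp: good_def x_def r_def split: prod.splits)
  have nest: "dist (x n) (x (n + k)) \<le> r n - r (n + k)" for n k
  proof (induct k)
    case (Suc k)
    then show ?case using g1[of "n + k"] g2[of "n + k"] dist_triangle[of "x n" "x (n + Suc k)" "x (n + k)"]
      by simp
  qed simp
  have rp: "0 < r n" for n using pos by (simp add: r_def)
  have rb: "r n \<le> (1/2)^n" for n
  proof (induct n)
    case 0 show ?case by (simp add: r_def P_def)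
  next
    case (Suc n) then show ?case using g2[of n] by simp
  qed
  have "Cauchy x"
  proof (rule metric_CauchyI)
    fix e :: real assume "e > 0"
    then obtain M where M: "(1/2)^M < e / 2" using real_arch_pow_inv[of "e/2" "1/2"] by auto
    have "dist (x M) (x m) < e / 2" if "m \<ge> M" for m
      using nest[of M "m - M"] that rp[of m] rb[of M] M by simp
    then have "dist (x m) (x n) < e" if "m \<ge> M" "n \<ge> M" for m n
      using that dist_triangle_half_r[of "x M" "x m" e "x n"] by blast
    then show "\<exists>M. \<forall>m\<ge>M. \<forall>n\<ge>M. dist (x m) (x n) < e" by blast
  qed
  then obtain z where z: "x \<longlonglongrightarrow> z" using Cauchy_convergent convergent_def by blast
  have zr: "dist (x n) z \<le> r n" for n
  proof (rule LIMSEQ_le_const2[of "\<lambda>k. dist (x n) (x (n + k))"])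
    show "(\<lambda>k. dist (x n) (x (n + k))) \<longlonglongrightarrow> dist (x n) z"
      using LIMSEQ_ignore_initial_segment[OF z, of n] by (intro tendsto_intros) (simp add: add.commute)
    show "\<exists>N. \<forall>k\<ge>N. dist (x n) (x (n + k)) \<le> r n" using nest rp less_imp_le by (smt (verit))
  qed
  obtain C where C: "\<forall>i\<in>I. norm (T i z) \<le> C" using pw by blast
  obtain n where "real n > C" using reals_Archimedean2 by blast
  then show False using g3[of n] zr[of "Suc n"] C by force
qed

section \<open>Spectral approximation of compact self-adjoint operators\<close>

definition self_adjoint :: "('a::real_inner \<Rightarrow> 'a) \<Rightarrow> bool" where
  "self_adjoint A \<longleftrightarrow> bounded_linear A \<and> (\<forall>x y. A x \<bullet> y = x \<bullet> A y)"

text \<open>Total boundedness of the image of the unit ball: in a complete space this is relative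
  compactness, and the form with balls passes directly to operator-norm limits.\<close>

definition compact_op :: "('a::real_inner \<Rightarrow> 'a) \<Rightarrow> bool" where
  "compact_op A \<longleftrightarrow> (\<forall>e>0. \<exists>k. finite k \<and> A ` cball 0 1 \<subseteq> (\<Union>y\<in>k. ball y e))"

text \<open>Adding one generator, the set is a continuous image of an interval times the previous
  set. It plays the role of Heine-Borel for a finite span inside an arbitrary normed space.\<close>

lemma compact_combinations:
  fixes C :: "'a::real_normed_vector set"
  assumes "finite C"
  shows "compact {y. \<exists>t. (\<forall>c\<in>C. \<bar>t c\<bar> \<le> B) \<and> y = (\<Sum>c\<in>C. t c *\<^sub>R c)}"
  using assms
proof (induct C)
  case empty then show ?case by simp
next
  case (insert a C)
  let ?K = "{y. \<exists>t. (\<forall>c\<in>C. \<bar>t c\<bar> \<le> B) \<and> y = (\<Sum>c\<in>C. t c *\<^sub>R c)}"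
  let ?K' = "{y. \<exists>t. (\<forall>c\<in>insert a C. \<bar>t c\<bar> \<le> B) \<and> y = (\<Sum>c\<in>insert a C. t c *\<^sub>R c)}"
  have "?K' = (\<lambda>(r, y). r *\<^sub>R a + y) ` ({-B..B} \<times> ?K)"
  proof (intro set_eqI iffI)
    fix y assume "y \<in> ?K'"
    then obtain t where t: "\<forall>c\<in>insert a C. \<bar>t c\<bar> \<le> B" "y = (\<Sum>c\<in>insert a C. t c *\<^sub>R c)" by blast
    have y: "y = t a *\<^sub>R a + (\<Sum>c\<in>C. t c *\<^sub>R c)" using t(2) insert(1,2) by simp
    have "t a \<in> {-B..B}" using t(1) by (simp add: abs_le_iff)
    moreover have "(\<Sum>c\<in>C. t c *\<^sub>R c) \<in> ?K" using t(1) by blast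
    ultimately show "y \<in> (\<lambda>(r, y). r *\<^sub>R a + y) ` ({-B..B} \<times> ?K)"
      unfolding y by (intro image_eqI[where x="(t a, \<Sum>c\<in>C. t c *\<^sub>R c)"]) simp_all
  next
    fix y assume "y \<in> (\<lambda>(r, y). r *\<^sub>R a + y) ` ({-B..B} \<times> ?K)"
    then obtain r t where r: "r \<in> {-B..B}" and t: "\<forall>c\<in>C. \<bar>t c\<bar> \<le> B"
      and y: "y = r *\<^sub>R a + (\<Sum>c\<in>C. t c *\<^sub>R c)" by auto
    have "(\<Sum>c\<in>insert a C. (t(a := r)) c *\<^sub>R c) = y"
      using insert(1,2) y by (simp add: fun_upd_def) (rule sum.cong, auto)
    moreover have "\<forall>c\<in>insert a C. \<bar>(t(a := r)) c\<bar> \<le> B" using r t by (auto simp: abs_le_iff)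
    ultimately show "y \<in> ?K'" by blast
  qed
  moreover have "compact ({-B..B} \<times> ?K)" by (intro compact_Times insert) auto
  moreover have "continuous_on ({-B..B} \<times> ?K) (\<lambda>(r, y). r *\<^sub>R a + y)"
    unfolding case_prod_unfold by (intro continuous_intros)
  ultimately show ?case by (simp add: compact_continuous_image)
qed

text \<open>In orthogonal coordinates for the span, the coefficients of \<open>A x\<close> with
  \<open>norm x \<le> 1\<close> are uniformly bounded, so the image of the ball lies in a compact
  set of combinations.\<close>

lemma compact_op_finite_rank:
  fixes A :: "'a::{real_inner,complete_space} \<Rightarrow> 'a"
  assumes A: "bounded_linear A" and B: "finite B" "range A \<subseteq> span B"
  shows "compact_op A"
proof -
  obtain C where C: "finite C" "span C = span B" "pairwise orthogonal C"
    using basis_orthogonal[OF B(1)] by blast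
  interpret V: closed_subspace "span C" using C closed_subspace_span_finite by blast
  obtain K where K: "K > 0" "\<And>x. norm (A x) \<le> norm x * K"
    using bounded_linear.pos_bounded[OF A] by blast
  have K0: "norm (A x) \<le> K" if "norm x \<le> 1" for x
    using K(2)[of x] mult_right_mono[OF that, of K] K(1) by linarith
  \<comment> \<open>A common bound for all coefficients: the one at \<open>c\<close> is at most
    \<open>K / norm c\<close>, and the sum dominates each of its terms. A zero vector contributes
    0.\<close>
  define D where "D = (\<Sum>c\<in>C. K / norm c)"
  define M where "M = {y. \<exists>t. (\<forall>c\<in>C. \<bar>t c\<bar> \<le> D) \<and> y = (\<Sum>c\<in>C. t c *\<^sub>R c)}"
  have cM: "compact M" unfolding M_def by (rule compact_combinations[OF C(1)])
  have expand: "y = (\<Sum>c\<in>C. (y \<bullet> c / (c \<bullet> c)) *\<^sub>R c)" if y: "y \<in> span C" for y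
  proof -
    let ?p = "\<Sum>c\<in>C. (y \<bullet> c / (c \<bullet> c)) *\<^sub>R c"
    have pin: "?p \<in> span C" by (intro span_sum span_scale span_base)
    have "(y - ?p) \<bullet> b = 0" if b: "b \<in> C" for b
    proof -
      have "?p \<bullet> b = (\<Sum>c\<in>C. if c = b then y \<bullet> b else 0)"
        unfolding inner_sum_left
      proof (rule sum.cong)
        fix c assume "c \<in> C"
        then show "((y \<bullet> c / (c \<bullet> c)) *\<^sub>R c) \<bullet> b = (if c = b then y \<bullet> b else 0)"
          using C(3) b by (cases "c = b"; cases "c = 0") (auto simp: pairwise_def orthogonal_def)
      qed simp
      then show ?thesis using b C(1) by (simp add: inner_diff)
    qed
    then have "orthogonal (y - ?p) b" if "b \<in> span C" for b
      using orthogonal_to_span[of b C "y - ?p"] that by (auto simp: orthogonal_def)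
    then have "orthogonal (y - ?p) (y - ?p)" using y pin span_diff by blast
    then show ?thesis by (simp add: orthogonal_def)
  qed
  have sub: "A ` cball 0 1 \<subseteq> M"
  proof
    fix y assume "y \<in> A ` cball 0 1"
    then obtain x where x: "norm x \<le> 1" "y = A x" by auto
    have yC: "y \<in> span C" using x B C by auto
    have "\<bar>y \<bullet> c / (c \<bullet> c)\<bar> \<le> D" if c: "c \<in> C" for c
    proof (cases "c = 0")
      case True
      then show ?thesis using K(1) by (auto simp: D_def intro!: sum_nonneg)
    next
      case False
      have "\<bar>y \<bullet> c / (c \<bullet> c)\<bar> = \<bar>y \<bullet> c\<bar> / (norm c * norm c)"
        by (simp add: abs_divide dot_square_norm power2_eq_square)
      also have "\<dots> \<le> (norm y * norm c) / (norm c * norm c)"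
        by (intro divide_right_mono Cauchy_Schwarz_ineq2) auto
      also have "\<dots> = norm y / norm c" using False by simp
      also have "\<dots> \<le> K / norm c" using K0[OF x(1)] x(2) by (intro divide_right_mono) auto
      also have "\<dots> \<le> D" unfolding D_def by (rule member_le_sum[OF c]) (use K C in auto)
      finally show ?thesis .
    qed
    then show "y \<in> M" unfolding M_def
      by (intro CollectI exI[of _ "\<lambda>c. y \<bullet> c / (c \<bullet> c)"] conjI ballI expand[OF yC])
  qed
  show ?thesis unfolding compact_op_def
  proof (intro allI impI)
    fix e :: real assume "e > 0"
    then obtain k where "finite k" "M \<subseteq> (\<Union>y\<in>k. ball y e)"
      using cM unfolding compact_eq_totally_bounded by blast
    then show "\<exists>k. finite k \<and> A ` cball 0 1 \<subseteq> (\<Union>y\<in>k. ball y e)" using sub by blast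
  qed
qed

lemma compact_op_limit:
  fixes A :: "'a::{real_inner,complete_space} \<Rightarrow> 'a"
  assumes lim: "\<And>e. e > 0 \<Longrightarrow> \<exists>F. compact_op F \<and> (\<forall>x. norm (A x - F x) \<le> e * norm x)"
  shows "compact_op A"
  unfolding compact_op_def
proof (intro allI impI)
  fix e :: real assume e: "e > 0"
  obtain F where F: "compact_op F" and AF: "\<And>x. norm (A x - F x) \<le> e/2 * norm x"
    using lim[of "e/2"] e by auto
  obtain k where k: "finite k" "F ` cball 0 1 \<subseteq> (\<Union>y\<in>k. ball y (e/2))"
    using F e unfolding compact_op_def by (meson half_gt_zero)
  have "A ` cball 0 1 \<subseteq> (\<Union>y\<in>k. ball y e)"
  proof
    fix z assume "z \<in> A ` cball 0 1"
    then obtain x where x: "norm x \<le> 1" "z = A x" by auto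
    then obtain y where y: "y \<in> k" "dist y (F x) < e/2" using k(2) by (force simp: dist_commute)
    have "norm (A x - F x) \<le> e / 2" using AF[of x] mult_left_mono[OF x(1), of "e/2"] e by linarith
    then have "dist (F x) (A x) \<le> e/2" by (simp add: dist_norm norm_minus_commute)
    then have "dist y (A x) < e" using y(2) dist_triangle[of y "A x" "F x"] by linarith
    then show "z \<in> (\<Union>y\<in>k. ball y e)" using x(2) y(1) by auto
  qed
  then show "\<exists>k. finite k \<and> A ` cball 0 1 \<subseteq> (\<Union>y\<in>k. ball y e)" using k(1) by blast
qed

lemma compact_op_subsequence:
  fixes A :: "'a::{real_inner,complete_space} \<Rightarrow> 'a"
  assumes A: "compact_op A" and x: "\<And>n. norm (x n) \<le> 1"
  shows "\<exists>r y. strict_mono (r::nat\<Rightarrow>nat) \<and> (\<lambda>n. A (x (r n))) \<longlonglongrightarrow> y"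
proof -
  let ?S = "closure (A ` cball 0 1)"
  have c: "compact ?S" unfolding compact_eq_totally_bounded
  proof (intro conjI allI impI)
    show "complete ?S" by (simp add: complete_eq_closed)
    fix e :: real assume e: "e > 0"
    obtain k where k: "finite k" "A ` cball 0 1 \<subseteq> (\<Union>y\<in>k. ball y (e/2))"
      using A e unfolding compact_op_def by (meson half_gt_zero)
    have "A ` cball 0 1 \<subseteq> (\<Union>y\<in>k. cball y (e/2))"
      by (rule order_trans[OF k(2)]) (intro UN_mono order_refl ball_subset_cball)
    moreover have "closed (\<Union>y\<in>k. cball y (e/2))" using k(1) by (intro closed_UN) auto
    ultimately have "?S \<subseteq> (\<Union>y\<in>k. cball y (e/2))" by (rule closure_minimal)
    also have "\<dots> \<subseteq> (\<Union>y\<in>k. ball y e)"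
      using e by (intro UN_mono order_refl) auto
    finally show "\<exists>k. finite k \<and> ?S \<subseteq> (\<Union>x\<in>k. ball x e)" using k(1) by blast
  qed
  have "\<forall>n. A (x n) \<in> ?S" using x by (auto intro!: closure_subset[THEN subsetD])
  then obtain l r where "strict_mono (r::nat\<Rightarrow>nat)" "((\<lambda>n. A (x n)) \<circ> r) \<longlonglongrightarrow> l"
    using c[unfolded compact_def, THEN spec, of "\<lambda>n. A (x n)"] by blast
  then show ?thesis by (auto simp: o_def)
qed

text \<open>A maximizing sequence of the Rayleigh quotient on \<open>W\<close> subconverges to an eigenvector.\<close>

lemma eigenvector_above:
  fixes A :: "'a::{real_inner,complete_space} \<Rightarrow> 'a"
  assumes sa: "self_adjoint A" and cpt: "compact_op A"
    and W: "closed_subspace W" and inv: "\<And>x. x \<in> W \<Longrightarrow> A x \<in> W"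
    and t: "t \<ge> 0" and x0: "x0 \<in> W" "A x0 \<bullet> x0 > t * (norm x0)\<^sup>2"
  shows "\<exists>\<mu> y. \<mu> > t \<and> y \<in> W \<and> y \<noteq> 0 \<and> A y = \<mu> *\<^sub>R y"
proof -
  interpret W: closed_subspace W by (rule W)
  have bl: "bounded_linear A" and sym: "\<And>x y. A x \<bullet> y = x \<bullet> A y"
    using sa unfolding self_adjoint_def by auto
  interpret bounded_linear A by (rule bl)
  obtain K where K: "K > 0" "\<And>x. norm (A x) \<le> norm x * K" using pos_bounded by blast
  define R where "R = (\<lambda>x. A x \<bullet> x) ` {x\<in>W. norm x = 1}"
  define M where "M = Sup R"
  have bdd: "bdd_above R"
  proof (rule bdd_aboveI)
    fix r assume "r \<in> R"
    then obtain x where x: "norm x = 1" "r = A x \<bullet> x" by (auto simp: R_def)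
    have "r \<le> norm (A x) * norm x" using x norm_cauchy_schwarz by blast
    then show "r \<le> K" using x K(2)[of x] by simp
  qed
  have x0n: "x0 \<noteq> 0" using x0(2) by (auto simp: zero)
  let ?e = "(1 / norm x0) *\<^sub>R x0"
  have eR: "A ?e \<bullet> ?e \<in> R" unfolding R_def
    using x0n x0(1) W.sub by (intro imageI) (simp add: subspace_scale)
  have "A ?e \<bullet> ?e = (A x0 \<bullet> x0) / (norm x0)\<^sup>2" by (simp add: scaleR power2_eq_square)
  also have "\<dots> > t" using x0(2) x0n by (simp add: pos_less_divide_eq)
  finally have Mt: "M > t" using cSup_upper[OF eR bdd] unfolding M_def by linarith
  have MA: "A x \<bullet> x \<le> M * (norm x)\<^sup>2" if "x \<in> W" for x
  proof (cases "x = 0")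
    case False
    let ?e = "(1 / norm x) *\<^sub>R x"
    have "A ?e \<bullet> ?e \<in> R" unfolding R_def
      using False that W.sub by (intro imageI) (simp add: subspace_scale)
    then have "A ?e \<bullet> ?e \<le> M" unfolding M_def by (rule cSup_upper[OF _ bdd])
    moreover have "A ?e \<bullet> ?e = (A x \<bullet> x) / (norm x)\<^sup>2" by (simp add: scaleR power2_eq_square)
    ultimately have "(A x \<bullet> x) / (norm x)\<^sup>2 \<le> M" by linarith
    then show ?thesis using False by (simp add: pos_divide_le_eq)
  qed (simp add: zero)
  \<comment> \<open>With \<open>M\<close> the supremum of the Rayleigh quotient on \<open>W\<close>,
    the form of \<open>B\<close> is nonnegative on \<open>W\<close>, and the eigenvectors for
    \<open>M\<close> are the null vectors of \<open>B\<close>.\<close>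
  define B where "B x = M *\<^sub>R x - A x" for x
  define L where "L = \<bar>M\<bar> + K"
  have L0: "L > 0" using K by (simp add: L_def)
  have BL: "norm (B x) \<le> L * norm x" for x
  proof -
    have "norm (B x) \<le> norm (M *\<^sub>R x) + norm (A x)" unfolding B_def by (rule norm_triangle_ineq4)
    also have "\<dots> \<le> \<bar>M\<bar> * norm x + K * norm x"
      using K(2)[of x] by (simp add: mult.commute)
    also have "\<dots> = L * norm x" by (simp add: L_def algebra_simps)
    finally show ?thesis .
  qed
  have Binv: "B x \<in> W" if "x \<in> W" for x
    unfolding B_def using that inv W.sub by (simp add: subspace_diff subspace_scale)
  have Bnn: "B x \<bullet> x \<ge> 0" if "x \<in> W" for x
    using MA[OF that] by (simp add: B_def inner_diff dot_square_norm)
  \<comment> \<open>Cauchy-Schwarz for the semidefinite form of \<open>B\<close>, obtained by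
    evaluating the form at the gradient step \<open>?z\<close>. It turns a Rayleigh quotient close
    to \<open>M\<close> into a small residual.\<close>
  have CS: "(norm (B x))\<^sup>2 \<le> L * (B x \<bullet> x)" if x: "x \<in> W" for x
  proof -
    let ?z = "x - (1/L) *\<^sub>R B x"
    have zW: "?z \<in> W" using x Binv W.sub by (simp add: subspace_diff subspace_scale)
    have Bsym: "B (B x) \<bullet> x = B x \<bullet> B x"
      using sym[of "B x" x] by (simp add: B_def[of "B x"]) (simp add: B_def inner_simps)
    have "B ?z = B x - (1/L) *\<^sub>R B (B x)"
      by (simp add: B_def[of "x - _"] B_def[of "B x"] diff scaleR)
         (simp add: B_def algebra_simps)
    then have "B ?z \<bullet> ?z = (B x - (1/L) *\<^sub>R B (B x)) \<bullet> ?z" by (simp only:)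
    also have "\<dots> = B x \<bullet> x - (1/L) * (B x \<bullet> B x) - (1/L) * (B (B x) \<bullet> x) + (1/L) * (1/L) * (B (B x) \<bullet> B x)"
      by (simp add: inner_diff algebra_simps)
    finally have "B ?z \<bullet> ?z = B x \<bullet> x - 2 * (1/L) * (norm (B x))\<^sup>2 + (1/L) * (1/L) * (B (B x) \<bullet> B x)"
      by (simp add: Bsym dot_square_norm)
    moreover have "B (B x) \<bullet> B x \<le> L * (norm (B x))\<^sup>2"
    proof -
      have "B (B x) \<bullet> B x \<le> norm (B (B x)) * norm (B x)" by (rule norm_cauchy_schwarz)
      also have "\<dots> \<le> (L * norm (B x)) * norm (B x)" by (intro mult_right_mono BL) auto
      finally show ?thesis by (simp add: power2_eq_square)
    qed
    then have "(1/L) * (1/L) * (B (B x) \<bullet> B x) \<le> (1/L) * (1/L) * (L * (norm (B x))\<^sup>2)"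
      using L0 by (intro mult_left_mono) auto
    then have "(1/L) * (1/L) * (B (B x) \<bullet> B x) \<le> (1/L) * (norm (B x))\<^sup>2" using L0 by simp
    ultimately have "(1/L) * (norm (B x))\<^sup>2 \<le> B x \<bullet> x" using Bnn[OF zW] by linarith
    then show ?thesis using L0 by (simp add: field_simps)
  qed
  have "\<exists>x. x \<in> W \<and> norm x = 1 \<and> A x \<bullet> x > M - inverse (real (Suc n))" for n
  proof -
    have "M - inverse (real (Suc n)) < Sup R" unfolding M_def by simp
    then obtain r where "r \<in> R" "M - inverse (real (Suc n)) < r"
      using less_cSupE eR by (metis empty_iff)
    then show ?thesis by (auto simp: R_def)
  qed
  then obtain x where xW: "\<And>n. x n \<in> W" and x1: "\<And>n. norm (x n) = 1"
    and xA: "\<And>n. A (x n) \<bullet> x n > M - inverse (real (Suc n))" by metis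
  have Bx: "(\<lambda>n. B (x n)) \<longlonglongrightarrow> 0"
  proof -
    have "norm ((norm (B (x n)))\<^sup>2) \<le> L * inverse (real (Suc n))" for n
    proof -
      have "B (x n) \<bullet> x n \<le> inverse (real (Suc n))"
        using xA[of n] x1[of n] by (simp add: B_def inner_diff dot_square_norm)
      then have "L * (B (x n) \<bullet> x n) \<le> L * inverse (real (Suc n))" using L0 by (intro mult_left_mono) auto
      then show ?thesis using CS[OF xW, of n] by simp
    qed
    moreover have "(\<lambda>n. L * inverse (real (Suc n))) \<longlonglongrightarrow> 0"
      by (rule tendsto_mult_right_zero[OF LIMSEQ_inverse_real_of_nat])
    ultimately have "(\<lambda>n. (norm (B (x n)))\<^sup>2) \<longlonglongrightarrow> 0"
      by (metis (no_types, lifting) Lim_null_comparison always_eventually)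
    then have "(\<lambda>n. sqrt ((norm (B (x n)))\<^sup>2)) \<longlonglongrightarrow> sqrt 0" by (rule tendsto_real_sqrt)
    then show ?thesis by (simp add: tendsto_norm_zero_iff)
  qed
  obtain r y where r: "strict_mono (r::nat\<Rightarrow>nat)" and y: "(\<lambda>n. A (x (r n))) \<longlonglongrightarrow> y"
    using compact_op_subsequence[OF cpt, of x] x1 by (metis order_refl)
  have "(\<lambda>n. B (x (r n))) \<longlonglongrightarrow> 0" using LIMSEQ_subseq_LIMSEQ[OF Bx r] by (simp add: o_def)
  \<comment> \<open>Only \<open>A (x (r n))\<close> is known to converge so far. The vanishing
    residual transfers convergence to \<open>M *\<^sub>R x (r n)\<close>, and
    \<open>M > t \<ge> 0\<close> allows division by \<open>M\<close>.\<close>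
  from tendsto_add[OF this y] have "(\<lambda>n. M *\<^sub>R x (r n)) \<longlonglongrightarrow> y" by (simp add: B_def)
  from tendsto_scaleR[OF tendsto_const this, of "1/M"]
  have xz: "(\<lambda>n. x (r n)) \<longlonglongrightarrow> (1/M) *\<^sub>R y" using Mt t by simp
  let ?z = "(1/M) *\<^sub>R y"
  have "?z \<in> W" using closed_sequentially[OF W.clo _ xz] xW by blast
  moreover have "norm ?z = 1"
    using tendsto_norm[OF xz] x1 LIMSEQ_unique tendsto_const by fastforce
  moreover have "A ?z = y" using LIMSEQ_unique[OF tendsto[OF xz] y] .
  then have "A ?z = M *\<^sub>R ?z" using Mt t by simp
  ultimately show ?thesis using Mt by (intro exI[of _ M] exI[of _ ?z]) auto
qed

text \<open>The orthogonal complement of \<open>B\<close> is invariant because \<open>B\<close>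
  consists of eigenvectors. A larger Rayleigh quotient there would produce an eigenvector above
  \<open>t\<close> in the complement, which by \<open>above\<close> also lies in the span of
  \<open>B\<close> and hence vanishes.\<close>

lemma rayleigh_bound_off_eigenvectors:
  fixes A :: "'a::{real_inner,complete_space} \<Rightarrow> 'a"
  assumes sa: "self_adjoint A" and cpt: "compact_op A" and t: "t \<ge> 0"
    and eB: "\<And>b. b \<in> B \<Longrightarrow> \<exists>\<mu>. A b = \<mu> *\<^sub>R b"
    and above: "\<And>\<mu> y. \<mu> > t \<Longrightarrow> A y = \<mu> *\<^sub>R y \<Longrightarrow> y \<in> span B"
    and x: "\<And>b. b \<in> B \<Longrightarrow> x \<bullet> b = 0"
  shows "A x \<bullet> x \<le> t * (norm x)\<^sup>2"
proof (rule ccontr)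
  assume neg: "\<not> ?thesis"
  define W where "W = {x. \<forall>w\<in>B. x \<bullet> w = 0}"
  have W: "closed_subspace W" unfolding W_def by (rule closed_subspace_orthogonal_complement)
  have inv: "A z \<in> W" if z: "z \<in> W" for z
  proof -
    have "A z \<bullet> b = 0" if b: "b \<in> B" for b
    proof -
      obtain \<mu> where "A b = \<mu> *\<^sub>R b" using eB[OF b] by blast
      moreover have "A z \<bullet> b = z \<bullet> A b" using sa by (simp add: self_adjoint_def)
      ultimately show ?thesis using z b by (simp add: W_def)
    qed
    then show ?thesis by (simp add: W_def)
  qed
  have "x \<in> W" using x by (simp add: W_def)
  then obtain \<mu> y where y: "\<mu> > t" "y \<in> W" "y \<noteq> 0" "A y = \<mu> *\<^sub>R y"
    using eigenvector_above[OF sa cpt W inv t, of x] neg by auto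
  have "orthogonal y y"
    by (rule orthogonal_to_span[OF above[OF y(1,4)]]) (use y(2) in \<open>simp add: W_def orthogonal_def\<close>)
  then show False using y(3) by (simp add: orthogonal_def)
qed

lemma self_adjoint_eigenvectors_orthogonal:
  assumes "self_adjoint A" "A x = a *\<^sub>R x" "A y = b *\<^sub>R y" "a \<noteq> b"
  shows "x \<bullet> y = 0"
proof -
  have "A x \<bullet> y = x \<bullet> A y" using assms(1) by (simp add: self_adjoint_def)
  then show ?thesis using assms(2-4) by simp
qed

lemma inner_linear_combinations:
  fixes \<phi> :: "'i \<Rightarrow> 'a::real_inner"
  shows "(\<Sum>j\<in>F. a j *\<^sub>R \<phi> j) \<bullet> (\<Sum>l\<in>F. b l *\<^sub>R \<phi> l) = (\<Sum>j\<in>F. \<Sum>l\<in>F. a j * b l * (\<phi> j \<bullet> \<phi> l))"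
  unfolding inner_sum_left by (rule sum.cong) (simp_all add: inner_sum_right sum_distrib_left mult_ac)

text \<open>The \<open>\<phi> j\<close> need not be orthogonal within one eigenspace. Cross terms
  between different eigenvalues vanish, so in the remaining ones the weight
  \<open>\<nu> j - t\<close> splits into two square roots, and the form of \<open>A - t\<close>
  becomes a squared norm.\<close>

lemma rayleigh_ge_on_eigenspan:
  fixes A :: "'a::real_inner \<Rightarrow> 'a"
  assumes sa: "self_adjoint A" and F: "finite F"
    and e: "\<And>j. j \<in> F \<Longrightarrow> A (\<phi> j) = \<nu> j *\<^sub>R \<phi> j" and t: "\<And>j. j \<in> F \<Longrightarrow> t \<le> \<nu> j"
    and x: "x = (\<Sum>j\<in>F. c j *\<^sub>R \<phi> j)"
  shows "t * (norm x)\<^sup>2 \<le> A x \<bullet> x"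
proof -
  interpret bounded_linear A using sa by (simp add: self_adjoint_def)
  have Ax: "A x = (\<Sum>j\<in>F. (c j * \<nu> j) *\<^sub>R \<phi> j)"
    unfolding x sum scaleR by (rule sum.cong) (auto simp: e)
  define d where "d j = c j * sqrt (\<nu> j - t)" for j
  have "A x \<bullet> x - t * (norm x)\<^sup>2 = (A x - t *\<^sub>R x) \<bullet> x"
    by (simp add: inner_diff dot_square_norm)
  also have "A x - t *\<^sub>R x = (\<Sum>j\<in>F. (c j * (\<nu> j - t)) *\<^sub>R \<phi> j)"
    unfolding Ax unfolding x by (simp add: scaleR_sum_right sum_subtractf[symmetric] algebra_simps)
  also have "\<dots> \<bullet> x = (\<Sum>j\<in>F. \<Sum>l\<in>F. (c j * (\<nu> j - t)) * c l * (\<phi> j \<bullet> \<phi> l))"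
    unfolding x by (rule inner_linear_combinations)
  also have "\<dots> = (\<Sum>j\<in>F. \<Sum>l\<in>F. d j * d l * (\<phi> j \<bullet> \<phi> l))"
  proof (intro sum.cong refl)
    fix j l assume jl: "j \<in> F" "l \<in> F"
    show "(c j * (\<nu> j - t)) * c l * (\<phi> j \<bullet> \<phi> l) = d j * d l * (\<phi> j \<bullet> \<phi> l)"
    proof (cases "\<nu> j = \<nu> l")
      case True
      have "sqrt (\<nu> l - t) * sqrt (\<nu> l - t) = \<nu> l - t" using t[OF jl(2)] by simp
      then show ?thesis unfolding d_def True by (simp add: algebra_simps)
    next
      case False
      then have "\<phi> j \<bullet> \<phi> l = 0"
        using self_adjoint_eigenvectors_orthogonal[OF sa e[OF jl(1)] e[OF jl(2)]] by blast
      then show ?thesis by simp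
    qed
  qed
  also have "\<dots> = (\<Sum>j\<in>F. d j *\<^sub>R \<phi> j) \<bullet> (\<Sum>j\<in>F. d j *\<^sub>R \<phi> j)"
    by (rule inner_linear_combinations[symmetric])
  finally show ?thesis using inner_ge_zero[of "\<Sum>j\<in>F. d j *\<^sub>R \<phi> j"] by linarith
qed

text \<open>Projected onto \<open>span C\<close>, the \<open>\<phi> j\<close> are more vectors than
  the dimension admits, so a nontrivial combination of them projects to 0.\<close>

lemma combination_orthogonal_to_fewer_vectors:
  fixes \<phi> :: "nat \<Rightarrow> 'a::{real_inner,complete_space}"
  assumes F: "finite F" and C: "finite C" "card C < card F"
    and indep: "\<And>c. (\<Sum>j\<in>F. c j *\<^sub>R \<phi> j) = 0 \<Longrightarrow> \<forall>j\<in>F. c j = 0"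
  shows "\<exists>c. (\<Sum>j\<in>F. c j *\<^sub>R \<phi> j) \<noteq> 0 \<and> (\<forall>y\<in>C. (\<Sum>j\<in>F. c j *\<^sub>R \<phi> j) \<bullet> y = 0)"
proof -
  interpret P: closed_subspace "span C" by (rule closed_subspace_span_finite[OF C(1)])
  let ?p = "\<lambda>j. proj (span C) (\<phi> j)"
  have "\<exists>c. (\<Sum>j\<in>F. c j *\<^sub>R ?p j) = 0 \<and> (\<exists>j\<in>F. c j \<noteq> 0)"
  proof (cases "inj_on ?p F")
    case True
    have "\<not> independent (?p ` F)"
    proof
      assume "independent (?p ` F)"
      then have "card (?p ` F) \<le> card C"
        using independent_span_bound[OF C(1), of "?p ` F"] P.proj_in by blast
      then show False using C(2) True by (simp add: card_image)
    qed
    then obtain u v where u: "(\<Sum>w\<in>?p ` F. u w *\<^sub>R w) = 0" "v \<in> ?p ` F" "u v \<noteq> 0"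
      using F dependent_finite[of "?p ` F"] by auto
    have "(\<Sum>j\<in>F. u (?p j) *\<^sub>R ?p j) = 0" using u(1) True by (simp add: sum.reindex)
    then show ?thesis using u(2,3) by (intro exI[of _ "\<lambda>j. u (?p j)"]) auto
  next
    \<comment> \<open>Two equal projections give a relation with coefficients 1 and -1. The case is
      separate because linear dependence is a property of the set of vectors, which forgets
      repetitions.\<close>
    case False
    then obtain a b where ab: "a \<in> F" "b \<in> F" "a \<noteq> b" "?p a = ?p b" by (auto simp: inj_on_def)
    define c where "c j = (if j = a then 1 else 0) + (if j = b then - 1 else (0::real))" for j
    have "(\<Sum>j\<in>F. c j *\<^sub>R ?p j) = (\<Sum>j\<in>F. if j = a then ?p j else 0) + (\<Sum>j\<in>F. if j = b then - ?p j else 0)"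
      unfolding sum.distrib[symmetric] by (rule sum.cong) (auto simp: c_def)
    also have "\<dots> = 0" using ab F by simp
    finally show ?thesis using ab by (intro exI[of _ c]) (auto simp: c_def)
  qed
  then obtain c j where c: "(\<Sum>j\<in>F. c j *\<^sub>R ?p j) = 0" "j \<in> F" "c j \<noteq> 0" by blast
  let ?x = "\<Sum>j\<in>F. c j *\<^sub>R \<phi> j"
  have "proj (span C) ?x = 0"
    using c(1) by (simp add: linear_sum[OF P.linear_proj] linear_scale[OF P.linear_proj])
  then have "?x \<bullet> y = 0" if "y \<in> C" for y
    using P.proj_inner[of y ?x] that by (simp add: span_base)
  moreover have "?x \<noteq> 0" using indep[of c] c(2,3) by blast
  ultimately show ?thesis by blast
qed

text \<open>Independence replaces orthonormality, and completeness is demanded for positive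
  eigenvalues only, so a kernel of any dimension is left out. The order is nonincreasing because
  \<open>\<nu>\<close> will be \<open>1 / (1 + \<lambda>)\<close> with nondecreasing
  \<lambda>.\<close>

definition eigen_system ::
    "('a::real_inner \<Rightarrow> 'a) \<Rightarrow> nat set \<Rightarrow> (nat \<Rightarrow> real) \<Rightarrow> (nat \<Rightarrow> 'a) \<Rightarrow> bool" where
  "eigen_system A I \<nu> \<phi> \<longleftrightarrow>
     (\<forall>k\<in>I. 0 < \<nu> k \<and> A (\<phi> k) = \<nu> k *\<^sub>R \<phi> k) \<and>
     (\<forall>j\<in>I. \<forall>k\<in>I. j \<le> k \<longrightarrow> \<nu> k \<le> \<nu> j) \<and>
     (\<forall>F c. finite F \<and> F \<subseteq> I \<and> (\<Sum>k\<in>F. c k *\<^sub>R \<phi> k) = 0 \<longrightarrow> (\<forall>k\<in>F. c k = 0)) \<and>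
     (\<forall>\<mu> y. 0 < \<mu> \<and> A y = \<mu> *\<^sub>R y \<longrightarrow> y \<in> span (\<phi> ` {k\<in>I. \<nu> k = \<mu>}))"

lemma eigen_systemD:
  assumes "eigen_system A I \<nu> \<phi>"
  shows "k \<in> I \<Longrightarrow> 0 < \<nu> k" "k \<in> I \<Longrightarrow> A (\<phi> k) = \<nu> k *\<^sub>R \<phi> k"
    "j \<in> I \<Longrightarrow> k \<in> I \<Longrightarrow> j \<le> k \<Longrightarrow> \<nu> k \<le> \<nu> j"
    "finite F \<Longrightarrow> F \<subseteq> I \<Longrightarrow> (\<Sum>k\<in>F. c k *\<^sub>R \<phi> k) = 0 \<Longrightarrow> \<forall>k\<in>F. c k = 0"
    "0 < \<mu> \<Longrightarrow> A y = \<mu> *\<^sub>R y \<Longrightarrow> y \<in> span (\<phi> ` {k\<in>I. \<nu> k = \<mu>})"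
proof -
  note e = assms[unfolded eigen_system_def]
  show "k \<in> I \<Longrightarrow> 0 < \<nu> k" "k \<in> I \<Longrightarrow> A (\<phi> k) = \<nu> k *\<^sub>R \<phi> k" using e[THEN conjunct1] by blast+
  show "j \<in> I \<Longrightarrow> k \<in> I \<Longrightarrow> j \<le> k \<Longrightarrow> \<nu> k \<le> \<nu> j"
    using e[THEN conjunct2, THEN conjunct1] by blast
  show "finite F \<Longrightarrow> F \<subseteq> I \<Longrightarrow> (\<Sum>k\<in>F. c k *\<^sub>R \<phi> k) = 0 \<Longrightarrow> \<forall>k\<in>F. c k = 0"
    using e[THEN conjunct2, THEN conjunct2, THEN conjunct1, THEN spec, THEN spec, of F c] by blast
  show "0 < \<mu> \<Longrightarrow> A y = \<mu> *\<^sub>R y \<Longrightarrow> y \<in> span (\<phi> ` {k\<in>I. \<nu> k = \<mu>})"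
    using e[THEN conjunct2, THEN conjunct2, THEN conjunct2, THEN spec, THEN spec, of \<mu> y] by blast
qed

text \<open>Half of the min-max principle: the first \<open>k\<close> eigenvectors of \<open>A\<close> contain a combination
  orthogonal to fewer than \<open>k\<close> eigenvectors of \<open>A'\<close>.\<close>

lemma eigenvalue_perturbation:
  fixes A A' :: "'a::{real_inner,complete_space} \<Rightarrow> 'a"
  assumes sa: "self_adjoint A" and sa': "self_adjoint A'" and cpt: "compact_op A'"
    and es: "eigen_system A I \<nu> \<phi>" and es': "eigen_system A' I' \<nu>' \<phi>'"
    and k: "1 \<le> k" "{1..k} \<subseteq> I" and I': "I' \<subseteq> {1..}" "\<And>j. j \<in> I' \<Longrightarrow> {1..j} \<subseteq> I'"
    and close: "\<And>x. norm (A x - A' x) \<le> \<eta> * norm x"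
    and t: "0 \<le> t" "t + \<eta> < \<nu> k"
  shows "k \<in> I' \<and> t < \<nu>' k"
proof (rule ccontr)
  assume neg: "\<not> ?thesis"
  define J where "J = {j\<in>I'. t < \<nu>' j}"
  \<comment> \<open>If the claim fails at \<open>k\<close>, monotonicity and the initial-segment
    shape of \<open>I'\<close> leave fewer than \<open>k\<close> eigenvalues of \<open>A'\<close>
    above \<open>t\<close>.\<close>
  have J: "J \<subseteq> {1..<k}"
  proof
    fix j assume j: "j \<in> J"
    have "\<not> k \<le> j"
    proof
      assume "k \<le> j"
      then have kI: "k \<in> I'" using I'(2)[of j] j k(1) by (auto simp: J_def)
      then have "\<nu>' j \<le> \<nu>' k" using eigen_systemD(3)[OF es' kI] j \<open>k \<le> j\<close> by (auto simp: J_def)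
      then show False using neg kI j by (auto simp: J_def)
    qed
    then show "j \<in> {1..<k}" using j I'(1) by (auto simp: J_def)
  qed
  then have fJ: "finite J" using finite_subset by blast
  have "card (\<phi>' ` J) < card {1..k}"
    using card_image_le[OF fJ, of \<phi>'] card_mono[OF _ J] k(1) by simp
  then obtain c where c: "(\<Sum>j\<in>{1..k}. c j *\<^sub>R \<phi> j) \<noteq> 0"
      "\<forall>y\<in>\<phi>' ` J. (\<Sum>j\<in>{1..k}. c j *\<^sub>R \<phi> j) \<bullet> y = 0"
    using combination_orthogonal_to_fewer_vectors[of "{1..k}" "\<phi>' ` J" \<phi>] fJ
      eigen_systemD(4)[OF es _ k(2)] by auto
  define x where "x = (\<Sum>j\<in>{1..k}. c j *\<^sub>R \<phi> j)"
  have lower: "\<nu> k * (norm x)\<^sup>2 \<le> A x \<bullet> x"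
  proof (rule rayleigh_ge_on_eigenspan[OF sa _ _ _ x_def])
    fix j assume j: "j \<in> {1..k}"
    then show "A (\<phi> j) = \<nu> j *\<^sub>R \<phi> j" using k(2) by (intro eigen_systemD(2)[OF es]) auto
    show "\<nu> k \<le> \<nu> j" using j k by (intro eigen_systemD(3)[OF es]) auto
  qed simp
  have upper: "A' x \<bullet> x \<le> t * (norm x)\<^sup>2"
  proof (rule rayleigh_bound_off_eigenvectors[OF sa' cpt t(1)])
    show "\<exists>\<mu>. A' b = \<mu> *\<^sub>R b" if "b \<in> \<phi>' ` J" for b
      using that eigen_systemD(2)[OF es'] by (auto simp: J_def)
    show "x \<bullet> b = 0" if "b \<in> \<phi>' ` J" for b
      using c(2) that unfolding x_def by blast
    show "y \<in> span (\<phi>' ` J)" if "t < \<mu>" "A' y = \<mu> *\<^sub>R y" for \<mu> y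
    proof -
      have "y \<in> span (\<phi>' ` {k\<in>I'. \<nu>' k = \<mu>})"
        using eigen_systemD(5)[OF es' _ that(2)] that(1) t(1) by simp
      also have "\<dots> \<subseteq> span (\<phi>' ` J)" using that(1) by (intro span_mono image_mono) (auto simp: J_def)
      finally show ?thesis .
    qed
  qed
  have "(A x - A' x) \<bullet> x \<le> norm (A x - A' x) * norm x" by (rule norm_cauchy_schwarz)
  also have "\<dots> \<le> (\<eta> * norm x) * norm x" by (intro mult_right_mono close) auto
  finally have "A x \<bullet> x - A' x \<bullet> x \<le> \<eta> * (norm x)\<^sup>2" by (simp add: inner_diff power2_eq_square)
  then have "\<nu> k * (norm x)\<^sup>2 \<le> (t + \<eta>) * (norm x)\<^sup>2" using lower upper by (simp add: algebra_simps)
  moreover have "(norm x)\<^sup>2 > 0" using c(1) by (simp add: x_def)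
  ultimately show False using t(2) by (simp add: mult_le_cancel_right)
qed

text \<open>The operator \<open>A2\<close> is \<open>\<nu>^2 - (A - \<nu>)^2\<close>, so a small
  residual is a large Rayleigh quotient of \<open>A2\<close>. The multiple of the identity in the
  square cancels, so \<open>A2\<close> has finite rank and \<open>eigenvector_above\<close> applies;
  \<open>e \<le> \<nu>\<close> makes its threshold \<open>\<nu>^2 - e^2\<close> nonnegative.\<close>

lemma eigenvector_near:
  fixes A :: "'a::{real_inner,complete_space} \<Rightarrow> 'a"
  assumes sa: "self_adjoint A" and B: "finite B" "range A \<subseteq> span B"
    and W: "closed_subspace W" and inv: "\<And>x. x \<in> W \<Longrightarrow> A x \<in> W"
    and e: "0 < e" "e \<le> \<nu>" and x: "x \<in> W" "norm (A x - \<nu> *\<^sub>R x) < e * norm x"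
  shows "\<exists>\<mu> y. \<bar>\<mu> - \<nu>\<bar> < e \<and> y \<in> W \<and> y \<noteq> 0 \<and> A y = \<mu> *\<^sub>R y"
proof -
  interpret W: closed_subspace W by (rule W)
  have bl: "bounded_linear A" and sym: "\<And>x y. A x \<bullet> y = x \<bullet> A y"
    using sa unfolding self_adjoint_def by auto
  interpret bounded_linear A by (rule bl)
  define A2 where "A2 x = (2 * \<nu>) *\<^sub>R A x - A (A x)" for x
  have bl2: "bounded_linear A2" unfolding A2_def
    by (intro bounded_linear_sub bounded_linear_compose[OF bounded_linear_scaleR_right bl] bounded_linear_compose[OF bl bl])
  have sa2: "self_adjoint A2" unfolding self_adjoint_def
  proof (intro conjI bl2 allI)
    fix x y show "A2 x \<bullet> y = x \<bullet> A2 y" unfolding A2_def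
      using sym[of x y] sym[of "A x" y] sym[of x "A y"] by (simp add: inner_diff)
  qed
  have "range A2 \<subseteq> span B" unfolding A2_def using B(2) by (auto intro!: span_diff span_scale)
  then have cpt2: "compact_op A2" by (rule compact_op_finite_rank[OF bl2 B(1)])
  have inv2: "A2 z \<in> W" if "z \<in> W" for z
    unfolding A2_def using that inv W.sub by (simp add: subspace_diff subspace_scale)
  have sq: "(norm (A z - \<nu> *\<^sub>R z))\<^sup>2 = \<nu>\<^sup>2 * (norm z)\<^sup>2 - A2 z \<bullet> z" for z
    unfolding A2_def power2_norm_eq_inner using sym[of "A z" z]
    by (simp add: inner_diff inner_commute[of z "A z"] power2_eq_square algebra_simps)
  have "(norm (A x - \<nu> *\<^sub>R x))\<^sup>2 < (e * norm x)\<^sup>2" using x(2) by (intro power_strict_mono) auto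
  then have "A2 x \<bullet> x > (\<nu>\<^sup>2 - e\<^sup>2) * (norm x)\<^sup>2" unfolding sq by (simp add: power_mult_distrib algebra_simps)
  moreover have "\<nu>\<^sup>2 - e\<^sup>2 \<ge> 0" using e by simp
  ultimately obtain \<mu> y where y: "\<mu> > \<nu>\<^sup>2 - e\<^sup>2" "y \<in> W" "y \<noteq> 0" "A2 y = \<mu> *\<^sub>R y"
    using eigenvector_above[OF sa2 cpt2 W inv2 _ x(1)] by blast
  have "(norm (A y - \<nu> *\<^sub>R y))\<^sup>2 = (\<nu>\<^sup>2 - \<mu>) * (norm y)\<^sup>2"
    unfolding sq y(4) by (simp add: dot_square_norm algebra_simps)
  then have "0 \<le> (\<nu>\<^sup>2 - \<mu>) * (norm y)\<^sup>2" by (metis zero_le_power2)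
  then have nn: "0 \<le> \<nu>\<^sup>2 - \<mu>" using y(3) by (simp add: zero_le_mult_iff)
  define \<kappa> where "\<kappa> = sqrt (\<nu>\<^sup>2 - \<mu>)"
  have k: "0 \<le> \<kappa>" "\<kappa>\<^sup>2 = \<nu>\<^sup>2 - \<mu>" using nn by (auto simp: \<kappa>_def)
  have "\<kappa>\<^sup>2 < e\<^sup>2" using k y(1) by simp
  then have ke: "\<kappa> < e" by (rule power_less_imp_less_base) (use e in simp)
  \<comment> \<open>Since \<open>(A - \<nu>)^2 y = \<kappa>^2 y\<close>, the product of
    \<open>A - (\<nu> - \<kappa>)\<close> and \<open>A - (\<nu> + \<kappa>)\<close> annihilates
    \<open>y\<close>. Either the first factor does so already, or its value \<open>z\<close> is an
    eigenvector for \<open>\<nu> + \<kappa>\<close>.\<close>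
  define z where "z = A y - (\<nu> - \<kappa>) *\<^sub>R y"
  have AAy: "A (A y) = (2 * \<nu>) *\<^sub>R A y - \<mu> *\<^sub>R y" using y(4) by (simp add: A2_def algebra_simps)
  show ?thesis
  proof (cases "z = 0")
    case True
    then have "A y = (\<nu> - \<kappa>) *\<^sub>R y" by (simp add: z_def)
    then show ?thesis using y ke k(1) by (intro exI[of _ "\<nu> - \<kappa>"] exI[of _ y]) auto
  next
    case False
    have m: "\<mu> = (\<nu> + \<kappa>) * (\<nu> - \<kappa>)" using k(2) by (simp add: power2_eq_square algebra_simps)
    have "A (A y) = (\<nu> - \<kappa>) *\<^sub>R A y + (\<nu> + \<kappa>) *\<^sub>R A y - ((\<nu> + \<kappa>) * (\<nu> - \<kappa>)) *\<^sub>R y"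
      unfolding AAy m scaleR_add_left[symmetric] by simp
    then have "A z = (\<nu> + \<kappa>) *\<^sub>R z"
      unfolding z_def diff scaleR scaleR_diff_right scaleR_scaleR by simp
    moreover have "z \<in> W" unfolding z_def using y(2) inv W.sub by (simp add: subspace_diff subspace_scale)
    ultimately show ?thesis using False ke k(1) by (intro exI[of _ "\<nu> + \<kappa>"] exI[of _ z]) auto
  qed
qed

text \<open>\<open>\<epsilon>\<close> depends only on the gaps of \<open>S\<close> around
  \<open>\<nu> i\<close>, so one threshold serves all approximating operators. Orthogonally to the
  cluster of \<open>A\<close>, the operator \<open>A - \<nu> i\<close> is bounded below: otherwise
  \<open>eigenvector_near\<close> would give an eigenvalue close to \<open>\<nu> i\<close> outside
  the cluster. Hence the distance of \<open>\<sigma>\<close> from the cluster is bounded by the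
  residual of \<open>\<sigma>\<close> under \<open>A\<close>, which is
  \<open>A \<sigma> - S \<sigma>\<close>.\<close>

lemma eigenspace_approximation:
  fixes S :: "'a::{real_inner,complete_space} \<Rightarrow> 'a"
  assumes sa: "self_adjoint S" and cpt: "compact_op S" and es: "eigen_system S {1..} \<nu> \<phi>"
    and i: "1 \<le> i" and m: "1 \<le> m"
    and mult: "\<And>k. 1 \<le> k \<Longrightarrow> \<nu> k = \<nu> i \<longleftrightarrow> k \<in> {i..<i + m}"
  shows "\<exists>\<epsilon>>0. \<forall>A n \<nu>' \<phi>' B. self_adjoint A \<and> finite B \<and> range A \<subseteq> span B \<and>
      eigen_system A {1..n} \<nu>' \<phi>' \<and> (\<forall>x. norm (S x - A x) \<le> \<epsilon> * norm x) \<longrightarrow>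
      i + m - 1 \<le> n \<and>
      (\<forall>\<sigma>. S \<sigma> = \<nu> i *\<^sub>R \<sigma> \<longrightarrow>
         (\<exists>w\<in>span (\<phi>' ` {i..<i + m}). norm (\<sigma> - w) \<le> norm (S \<sigma> - A \<sigma>) / \<epsilon>))"
proof -
  have vi: "\<nu> i > 0" using eigen_systemD(1)[OF es] i by simp
  \<comment> \<open>Half the distance to the neighbouring eigenvalues, with the arbitrary value 1 if
    there is none above; the entry \<open>\<nu> i / 2\<close> keeps the thresholds used below
    nonnegative.\<close>
  define e where "e = Min {\<nu> i / 2, (\<nu> i - \<nu> (i + m)) / 2, (if i = 1 then 1 else (\<nu> (i - 1) - \<nu> i) / 2)}"
  have up: "\<nu> i < \<nu> (i - 1)" if "i \<noteq> 1"
  proof -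
    have "\<nu> i \<le> \<nu> (i - 1)" using eigen_systemD(3)[OF es, of "i - 1" i] i that by simp
    moreover have "\<nu> (i - 1) \<noteq> \<nu> i" using mult[of "i - 1"] i that by auto
    ultimately show ?thesis by simp
  qed
  have dn: "\<nu> (i + m) < \<nu> i"
  proof -
    have "\<nu> (i + m) \<le> \<nu> i" using eigen_systemD(3)[OF es, of i "i + m"] i by simp
    moreover have "\<nu> (i + m) \<noteq> \<nu> i" using mult[of "i + m"] i by auto
    ultimately show ?thesis by simp
  qed
  have e0: "e > 0" unfolding e_def using vi up dn by simp
  have emin: "e \<le> r" if "r \<in> {\<nu> i / 2, (\<nu> i - \<nu> (i + m)) / 2, (if i = 1 then 1 else (\<nu> (i - 1) - \<nu> i) / 2)}" for r
    unfolding e_def using that by (intro Min_le) simp_all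
  have e1: "2 * e \<le> \<nu> i" using emin[of "\<nu> i / 2"] by simp
  have e2: "2 * e \<le> \<nu> i - \<nu> (i + m)" using emin[of "(\<nu> i - \<nu> (i + m)) / 2"] by simp
  have e3: "2 * e \<le> \<nu> (i - 1) - \<nu> i" if "i \<noteq> 1"
    using emin[of "(\<nu> (i - 1) - \<nu> i) / 2"] that by simp
  define \<epsilon> where "\<epsilon> = e / 2"
  have ep: "0 < \<epsilon>" "\<epsilon> < e" using e0 by (auto simp: \<epsilon>_def)
  have main: "i + m - 1 \<le> n \<and>
      (\<forall>\<sigma>. S \<sigma> = \<nu> i *\<^sub>R \<sigma> \<longrightarrow>
         (\<exists>w\<in>span (\<phi>' ` {i..<i + m}). norm (\<sigma> - w) \<le> norm (S \<sigma> - A \<sigma>) / \<epsilon>))"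
    if saA: "self_adjoint A" and B: "finite B" "range A \<subseteq> span B"
      and esA: "eigen_system A {1..n} \<nu>' \<phi>'" and close: "\<And>x. norm (S x - A x) \<le> \<epsilon> * norm x"
    for A n \<nu>' \<phi>' and B :: "'a set"
  proof -
    have blA: "bounded_linear A" using saA by (simp add: self_adjoint_def)
    interpret A: bounded_linear A by (rule blA)
    have cptA: "compact_op A" by (rule compact_op_finite_rank[OF blA B])
    have close': "norm (A x - S x) \<le> \<epsilon> * norm x" for x using close[of x] by (simp add: norm_minus_commute)
    have fwd: "k \<in> {1..n} \<and> t < \<nu>' k" if "1 \<le> k" "0 \<le> t" "t + \<epsilon> < \<nu> k" for k t
      by (rule eigenvalue_perturbation[OF sa saA cptA es esA that(1) _ _ _ close that(2,3)]) auto
    have bwd: "t < \<nu> k" if "k \<in> {1..n}" "0 \<le> t" "t + \<epsilon> < \<nu>' k" for k t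
      using eigenvalue_perturbation[OF saA sa cpt esA es _ _ _ _ close' that(2,3)] that(1) by auto
    have "\<nu> (i + m - 1) = \<nu> i" using mult[of "i + m - 1"] i m by auto
    then have "i + m - 1 \<in> {1..n}" using fwd[of "i + m - 1" "\<nu> i - e"] i m e0 e1 ep by auto
    then have n: "i + m - 1 \<le> n" by simp
    \<comment> \<open>\<open>fwd\<close> keeps the eigenvalues of \<open>A\<close> with index below
      \<open>i\<close> above \<open>\<nu> i + e\<close>. If one with index from \<open>i + m\<close>
      on came within \<open>e\<close>, \<open>bwd\<close> would lift \<open>\<nu> (i + m)\<close>
      above \<open>\<nu> i - 2 * e\<close>.\<close>
    have gap: "k \<in> {i..<i + m}" if k: "k \<in> {1..n}" and near: "\<bar>\<nu>' k - \<nu> i\<bar> < e" for k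
    proof (rule ccontr)
      assume "k \<notin> {i..<i + m}"
      then consider "k < i" | "i + m \<le> k" by force
      then show False
      proof cases
        case 1
        then have "i \<noteq> 1" "\<nu> (i - 1) \<le> \<nu> k" using k eigen_systemD(3)[OF es, of k "i - 1"] by auto
        then have "\<nu> i + e + \<epsilon> < \<nu> k" using e3 ep by simp
        then have "\<nu> i + e < \<nu>' k" using fwd[of k "\<nu> i + e"] k vi e0 by auto
        then show False using near by simp
      next
        case 2
        have "\<nu> i - 2 * e < \<nu> k" using bwd[OF k, of "\<nu> i - 2 * e"] e1 ep near by auto
        moreover have "\<nu> k \<le> \<nu> (i + m)" using 2 i eigen_systemD(3)[OF es, of "i + m" k] by simp
        ultimately show False using e2 by simp
      qed
    qed
    define Bc where "Bc = \<phi>' ` {i..<i + m}"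
    have fB: "finite Bc" by (simp add: Bc_def)
    interpret P: closed_subspace "span Bc" by (rule closed_subspace_span_finite[OF fB])
    define Wp where "Wp = {x. \<forall>b\<in>Bc. x \<bullet> b = 0}"
    have Wp: "closed_subspace Wp" unfolding Wp_def by (rule closed_subspace_orthogonal_complement)
    have eB: "A b \<in> span Bc" if b: "b \<in> Bc" for b
    proof -
      obtain k where k: "k \<in> {i..<i + m}" "b = \<phi>' k"
        using b unfolding Bc_def by blast
      then have "A b = \<nu>' k *\<^sub>R b" using eigen_systemD(2)[OF esA, of k] n i by auto
      then show ?thesis using that by (simp add: span_scale span_base)
    qed
    have invB: "A x \<in> span Bc" if "x \<in> span Bc" for x
      using that
    proof (induct rule: span_induct_alt)
      case base then show ?case by (simp add: A.zero span_zero)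
    next
      case (step c b y) then show ?case by (simp add: A.add A.scaleR span_add span_scale eB)
    qed
    have ortho: "x \<bullet> b = 0" if "x \<in> Wp" "b \<in> span Bc" for x b
      using orthogonal_to_span[of b Bc x] that by (simp add: orthogonal_def Wp_def)
    have invW: "A x \<in> Wp" if "x \<in> Wp" for x
      using that ortho[OF that] eB saA by (simp add: Wp_def self_adjoint_def)
    have far: "e * norm x \<le> norm (A x - \<nu> i *\<^sub>R x)" if x: "x \<in> Wp" for x
    proof (rule ccontr)
      assume "\<not> ?thesis"
      then obtain \<mu> y where y: "\<bar>\<mu> - \<nu> i\<bar> < e" "y \<in> Wp" "y \<noteq> 0" "A y = \<mu> *\<^sub>R y"
        using eigenvector_near[OF saA B Wp invW e0 _ x, of "\<nu> i"] e1 e0 by auto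
      have "0 < \<mu>" using y(1) e1 e0 by linarith
      then have "y \<in> span (\<phi>' ` {k\<in>{1..n}. \<nu>' k = \<mu>})" by (rule eigen_systemD(5)[OF esA _ y(4)])
      also have "\<dots> \<subseteq> span Bc" unfolding Bc_def using gap y(1) by (intro span_mono image_mono) auto
      finally show False using ortho[OF y(2), of y] y(3) by simp
    qed
    have "\<exists>w\<in>span Bc. norm (\<sigma> - w) \<le> norm (S \<sigma> - A \<sigma>) / \<epsilon>" if \<sigma>: "S \<sigma> = \<nu> i *\<^sub>R \<sigma>" for \<sigma>
    proof -
      define w x where "w = proj (span Bc) \<sigma>" and "x = \<sigma> - w"
      have xW: "x \<in> Wp" unfolding Wp_def x_def w_def using P.proj_orth span_base by blast
      have wB: "w \<in> span Bc" by (simp add: w_def)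
      define v where "v = A \<sigma> - \<nu> i *\<^sub>R \<sigma>"
      have v: "v = (A w - \<nu> i *\<^sub>R w) + (A x - \<nu> i *\<^sub>R x)"
        by (simp add: v_def x_def A.diff algebra_simps)
      have "A w - \<nu> i *\<^sub>R w \<in> span Bc" using wB invB by (simp add: span_diff span_scale)
      moreover have "A x - \<nu> i *\<^sub>R x \<in> Wp"
        using xW invW closed_subspace.sub[OF Wp] by (simp add: subspace_diff subspace_scale)
      \<comment> \<open>The cluster span and its complement are both invariant, so the two parts of
        the residual \<open>v\<close> are orthogonal and the part in the complement is no longer
        than \<open>v\<close>.\<close>
      ultimately have "proj (span Bc) v = A w - \<nu> i *\<^sub>R w"
        using v ortho by (intro P.proj_eqI) (auto simp: inner_add)
      then have "norm (A x - \<nu> i *\<^sub>R x) \<le> norm v" using P.norm_compl_le[of v] v by simp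
      moreover have "norm v = norm (S \<sigma> - A \<sigma>)" unfolding v_def \<sigma> by (rule norm_minus_commute)
      ultimately have "e * norm x \<le> norm (S \<sigma> - A \<sigma>)" using far[OF xW] by linarith
      moreover have "\<epsilon> * norm x \<le> e * norm x" using ep by (intro mult_right_mono) auto
      ultimately have "norm x \<le> norm (S \<sigma> - A \<sigma>) / \<epsilon>" using ep(1) by (simp add: pos_le_divide_eq mult.commute)
      then show ?thesis using wB by (auto simp: x_def)
    qed
    then show ?thesis using n by (auto simp: Bc_def)
  qed
  then show ?thesis using ep(1) by (intro exI[of _ \<epsilon>]) blast
qed

section \<open>The Hilbert space of square integrable functions\<close>

lemma L2I: "f \<in> borel_measurable (lebesgue_on \<Omega>) \<Longrightarrow>
    integrable (lebesgue_on \<Omega>) (\<lambda>x. (norm (f x))\<^sup>2) \<Longrightarrow> f \<in> L2 \<Omega>"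
  and L2D: "f \<in> L2 \<Omega> \<Longrightarrow> f \<in> borel_measurable (lebesgue_on \<Omega>)"
    "f \<in> L2 \<Omega> \<Longrightarrow> integrable (lebesgue_on \<Omega>) (\<lambda>x. (norm (f x))\<^sup>2)"
  by (simp_all add: L2_def)

lemma L2_bound:
  assumes "f \<in> borel_measurable (lebesgue_on \<Omega>)" "integrable (lebesgue_on \<Omega>) g"
    "\<And>x. (norm (f x))\<^sup>2 \<le> g x"
  shows "f \<in> L2 \<Omega>"
proof (rule L2I[OF assms(1)])
  have "AE x in lebesgue_on \<Omega>. norm ((norm (f x))\<^sup>2) \<le> norm (g x)"
    using assms(3) by (intro AE_I2) (simp add: order_trans[OF _ abs_ge_self])
  then show "integrable (lebesgue_on \<Omega>) (\<lambda>x. (norm (f x))\<^sup>2)"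
    using assms(1) by (intro Bochner_Integration.integrable_bound[OF assms(2)]) measurable
qed

lemma L2_inner_integrable:
  assumes "f \<in> L2 \<Omega>" "g \<in> L2 \<Omega>"
  shows "integrable (lebesgue_on \<Omega>) (\<lambda>x. f x \<bullet> g x)"
proof (rule Bochner_Integration.integrable_bound)
  show "integrable (lebesgue_on \<Omega>) (\<lambda>x. (norm (f x))\<^sup>2 + (norm (g x))\<^sup>2)"
    using assms by (intro Bochner_Integration.integrable_add L2D)
  show "(\<lambda>x. f x \<bullet> g x) \<in> borel_measurable (lebesgue_on \<Omega>)"
    using assms by (intro borel_measurable_inner L2D)
  have "norm (f x \<bullet> g x) \<le> norm ((norm (f x))\<^sup>2 + (norm (g x))\<^sup>2)" for x
  proof -
    have "\<bar>f x \<bullet> g x\<bar> \<le> norm (f x) * norm (g x)" by (rule Cauchy_Schwarz_ineq2)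
    also have "\<dots> \<le> (norm (f x))\<^sup>2 + (norm (g x))\<^sup>2"
      using sum_squares_bound[of "norm (f x)" "norm (g x)"]
        mult_nonneg_nonneg[OF norm_ge_zero[of "f x"] norm_ge_zero[of "g x"]] by linarith
    finally show ?thesis by simp
  qed
  then show "AE x in lebesgue_on \<Omega>. norm (f x \<bullet> g x) \<le> norm ((norm (f x))\<^sup>2 + (norm (g x))\<^sup>2)"
    by (intro AE_I2)
qed

lemma L2_add: "(\<lambda>x. f x + g x) \<in> L2 \<Omega>" if "f \<in> L2 \<Omega>" "g \<in> L2 \<Omega>"
proof (rule L2_bound)
  show "(\<lambda>x. f x + g x) \<in> borel_measurable (lebesgue_on \<Omega>)"
    using that by (intro borel_measurable_add L2D)
  show "integrable (lebesgue_on \<Omega>) (\<lambda>x. 2 * ((norm (f x))\<^sup>2 + (norm (g x))\<^sup>2))"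
    using that by (intro integrable_mult_right Bochner_Integration.integrable_add L2D)
  show "(norm (f x + g x))\<^sup>2 \<le> 2 * ((norm (f x))\<^sup>2 + (norm (g x))\<^sup>2)" for x
  proof -
    have "(norm (f x + g x))\<^sup>2 \<le> (norm (f x) + norm (g x))\<^sup>2"
      by (intro power_mono norm_triangle_ineq) auto
    then show ?thesis
      using sum_squares_bound[of "norm (f x)" "norm (g x)"] by (simp add: power2_sum)
  qed
qed

lemma L2_scaleR: "(\<lambda>x. c *\<^sub>R f x) \<in> L2 \<Omega>" if "f \<in> L2 \<Omega>"
proof (rule L2I)
  show "(\<lambda>x. c *\<^sub>R f x) \<in> borel_measurable (lebesgue_on \<Omega>)"
    using L2D(1)[OF that] by measurable
  show "integrable (lebesgue_on \<Omega>) (\<lambda>x. (norm (c *\<^sub>R f x))\<^sup>2)"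
    unfolding norm_scaleR power_mult_distrib by (intro integrable_mult_right L2D that)
qed

lemma L2_zero: "(\<lambda>x. 0) \<in> L2 \<Omega>" by (rule L2I) auto

lemma L2_uminus: "(\<lambda>x. - f x) \<in> L2 \<Omega>" if "f \<in> L2 \<Omega>"
  using L2_scaleR[OF that, of "-1"] by simp

lemma L2_diff: "(\<lambda>x. f x - g x) \<in> L2 \<Omega>" if "f \<in> L2 \<Omega>" "g \<in> L2 \<Omega>"
  using L2_add[OF that(1) L2_uminus[OF that(2)]] by simp

section \<open>The Hilbert space of classes modulo null sets\<close>

definition l2_rel :: "('a::euclidean_space \<Rightarrow> 'b::euclidean_space) \<Rightarrow> ('a \<Rightarrow> 'b) \<Rightarrow> bool" where
  "l2_rel f g \<longleftrightarrow> f \<in> L2 UNIV \<and> g \<in> L2 UNIV \<and> (AE x in lebesgue_on UNIV. f x = g x)"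

quotient_type (overloaded) ('a, 'b) l2 = "'a::euclidean_space \<Rightarrow> 'b::euclidean_space" / partial: l2_rel
proof (rule part_equivpI)
  show "\<exists>x::'a \<Rightarrow> 'b. l2_rel x x" by (rule exI[of _ "\<lambda>x. 0"]) (simp add: l2_rel_def L2_zero)
  show "symp (l2_rel :: ('a \<Rightarrow> 'b) \<Rightarrow> _)" by (rule sympI) (auto simp: l2_rel_def)
  show "transp (l2_rel :: ('a \<Rightarrow> 'b) \<Rightarrow> _)"
  proof (rule transpI)
    fix f g h :: "'a \<Rightarrow> 'b" assume a: "l2_rel f g" "l2_rel g h"
    then have "AE x in lebesgue_on UNIV. f x = g x" "AE x in lebesgue_on UNIV. g x = h x"
      by (auto simp: l2_rel_def)
    then have "AE x in lebesgue_on UNIV. f x = h x" by eventually_elim simp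
    then show "l2_rel f h" using a by (auto simp: l2_rel_def)
  qed
qed

lemma L2_inner_cong_AE:
  assumes "f \<in> L2 \<Omega>" "f' \<in> L2 \<Omega>" "g \<in> L2 \<Omega>" "g' \<in> L2 \<Omega>"
    "AE x in lebesgue_on \<Omega>. f x = f' x" "AE x in lebesgue_on \<Omega>. g x = g' x"
  shows "L2_inner \<Omega> f g = L2_inner \<Omega> f' g'"
  unfolding L2_inner_def
proof (rule integral_cong_AE)
  show "(\<lambda>x. f x \<bullet> g x) \<in> borel_measurable (lebesgue_on \<Omega>)"
    by (rule borel_measurable_inner[OF L2D(1)[OF assms(1)] L2D(1)[OF assms(3)]])
  show "(\<lambda>x. f' x \<bullet> g' x) \<in> borel_measurable (lebesgue_on \<Omega>)"
    by (rule borel_measurable_inner[OF L2D(1)[OF assms(2)] L2D(1)[OF assms(4)]])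
  show "AE x in lebesgue_on \<Omega>. f x \<bullet> g x = f' x \<bullet> g' x" using assms(5,6) by eventually_elim simp
qed

instantiation l2 :: (euclidean_space, euclidean_space) real_inner
begin

lift_definition zero_l2 :: "('a, 'b) l2" is "\<lambda>x. 0" by (simp add: l2_rel_def L2_zero)
lift_definition plus_l2 :: "('a, 'b) l2 \<Rightarrow> ('a, 'b) l2 \<Rightarrow> ('a, 'b) l2" is "\<lambda>f g x. f x + g x"
  unfolding l2_rel_def by (auto intro: L2_add)
lift_definition uminus_l2 :: "('a, 'b) l2 \<Rightarrow> ('a, 'b) l2" is "\<lambda>f x. - f x"
  unfolding l2_rel_def by (auto intro: L2_uminus)
lift_definition minus_l2 :: "('a, 'b) l2 \<Rightarrow> ('a, 'b) l2 \<Rightarrow> ('a, 'b) l2" is "\<lambda>f g x. f x - g x"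
  unfolding l2_rel_def by (auto intro: L2_diff)
lift_definition scaleR_l2 :: "real \<Rightarrow> ('a, 'b) l2 \<Rightarrow> ('a, 'b) l2" is "\<lambda>c f x. c *\<^sub>R f x"
  unfolding l2_rel_def by (auto intro: L2_scaleR)
lift_definition inner_l2 :: "('a, 'b) l2 \<Rightarrow> ('a, 'b) l2 \<Rightarrow> real" is "L2_inner UNIV"
  unfolding l2_rel_def by (rule L2_inner_cong_AE) auto
definition norm_l2 :: "('a, 'b) l2 \<Rightarrow> real" where "norm_l2 x = sqrt (x \<bullet> x)"
definition dist_l2 :: "('a, 'b) l2 \<Rightarrow> ('a, 'b) l2 \<Rightarrow> real" where "dist_l2 x y = norm (x - y)"
definition sgn_l2 :: "('a, 'b) l2 \<Rightarrow> ('a, 'b) l2" where "sgn_l2 x = inverse (norm x) *\<^sub>R x"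
definition uniformity_l2 :: "(('a, 'b) l2 \<times> ('a, 'b) l2) filter" where
  "uniformity_l2 = (INF e\<in>{0<..}. principal {(x, y). dist x y < e})"
definition open_l2 :: "('a, 'b) l2 set \<Rightarrow> bool" where
  "open_l2 U = (\<forall>x\<in>U. eventually (\<lambda>(x', y). x' = x \<longrightarrow> y \<in> U) uniformity)"

instance
proof
  fix x y z :: "('a, 'b) l2" and a b r :: real and U :: "('a, 'b) l2 set"
  show "x + y + z = x + (y + z)" by transfer (simp add: l2_rel_def add.assoc L2_add)
  show "x + y = y + x" by transfer (simp add: l2_rel_def add.commute L2_add)
  show "0 + x = x" by transfer (simp add: l2_rel_def)
  show "- x + x = 0" by transfer (simp add: l2_rel_def L2_zero)
  show "x - y = x + - y" by transfer (simp add: l2_rel_def L2_diff)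
  show "a *\<^sub>R (x + y) = a *\<^sub>R x + a *\<^sub>R y"
    by transfer (simp add: l2_rel_def scaleR_add_right L2_add L2_scaleR)
  show "(a + b) *\<^sub>R x = a *\<^sub>R x + b *\<^sub>R x"
    by transfer (simp add: l2_rel_def scaleR_add_left L2_add L2_scaleR)
  show "a *\<^sub>R b *\<^sub>R x = (a * b) *\<^sub>R x" by transfer (simp add: l2_rel_def L2_scaleR)
  show "1 *\<^sub>R x = x" by transfer (simp add: l2_rel_def)
  show "dist x y = norm (x - y)" by (rule dist_l2_def)
  show "sgn x = inverse (norm x) *\<^sub>R x" by (rule sgn_l2_def)
  show "uniformity = (INF e\<in>{0<..}. principal {(x, y :: ('a, 'b) l2). dist x y < e})" by (rule uniformity_l2_def)
  show "open U = (\<forall>x\<in>U. eventually (\<lambda>(x', y). x' = x \<longrightarrow> y \<in> U) uniformity)" by (rule open_l2_def)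
  show "x \<bullet> y = y \<bullet> x" by transfer (simp add: L2_inner_def inner_commute)
  show "(x + y) \<bullet> z = x \<bullet> z + y \<bullet> z"
  proof transfer
    fix f g h :: "'a \<Rightarrow> 'b" assume "l2_rel f f" "l2_rel g g" "l2_rel h h"
    then show "L2_inner UNIV (\<lambda>x. f x + g x) h = L2_inner UNIV f h + L2_inner UNIV g h"
      unfolding L2_inner_def inner_add_left
      by (intro Bochner_Integration.integral_add L2_inner_integrable) (auto simp: l2_rel_def)
  qed
  show "r *\<^sub>R x \<bullet> y = r * (x \<bullet> y)" by transfer (simp add: L2_inner_def)
  show "0 \<le> x \<bullet> x" by transfer (simp add: L2_inner_def)
  show "x \<bullet> x = 0 \<longleftrightarrow> x = 0"
  proof transfer
    fix f :: "'a \<Rightarrow> 'b" assume "l2_rel f f"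
    then have f: "f \<in> L2 UNIV" by (simp add: l2_rel_def)
    have "L2_inner UNIV f f = 0 \<longleftrightarrow> (AE x in lebesgue_on UNIV. f x \<bullet> f x = 0)"
      unfolding L2_inner_def
      by (rule integral_nonneg_eq_0_iff_AE[OF L2_inner_integrable[OF f f]]) simp
    then show "(L2_inner UNIV f f = 0) = l2_rel f (\<lambda>x. 0)" using f by (simp add: l2_rel_def L2_zero)
  qed
  show "norm x = sqrt (x \<bullet> x)" by (rule norm_l2_def)
qed

end

text \<open>A type cannot depend on \<open>\<Omega>\<close>, so classes live on the whole space and
  functions on \<open>\<Omega>\<close> enter by extension with zero. L2 over \<open>\<Omega>\<close>
  becomes the closed subspace \<open>L2_range \<Omega>\<close>.\<close>

definition cls :: "'a::euclidean_space set \<Rightarrow> ('a \<Rightarrow> 'b::euclidean_space) \<Rightarrow> ('a, 'b) l2" where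
  "cls \<Omega> f = abs_l2 (\<lambda>x. if x \<in> \<Omega> then f x else 0)"

lemma L2_extend_by_zero:
  fixes f :: "'a::euclidean_space \<Rightarrow> 'b::euclidean_space"
  assumes "\<Omega> \<in> sets lebesgue"
  shows "(\<lambda>x. if x \<in> \<Omega> then f x else 0) \<in> L2 UNIV \<longleftrightarrow> f \<in> L2 \<Omega>"
proof -
  have eq: "(\<lambda>x. (norm (if x \<in> \<Omega> then f x else 0))\<^sup>2) = (\<lambda>x. indicator \<Omega> x *\<^sub>R (norm (f x))\<^sup>2)"
    by (auto simp: indicator_def)
  have "integrable (lebesgue_on \<Omega>) (\<lambda>x. (norm (f x))\<^sup>2) \<longleftrightarrow>
        integrable lebesgue (\<lambda>x. indicator \<Omega> x *\<^sub>R (norm (f x))\<^sup>2)"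
    using assms by (intro integrable_restrict_space) auto
  then show ?thesis
    unfolding L2_def mem_Collect_eq lebesgue_on_UNIV_eq borel_measurable_if[OF assms] eq by blast
qed

lemma cls_inner:
  fixes f g :: "'a::euclidean_space \<Rightarrow> 'b::euclidean_space"
  assumes \<Omega>: "\<Omega> \<in> sets lebesgue" and fg: "f \<in> L2 \<Omega>" "g \<in> L2 \<Omega>"
  shows "cls \<Omega> f \<bullet> cls \<Omega> g = L2_inner \<Omega> f g"
proof -
  let ?e = "\<lambda>f x. if x \<in> \<Omega> then f x else (0::'b)"
  have r: "l2_rel (?e f) (?e f)" "l2_rel (?e g) (?e g)"
    using fg L2_extend_by_zero[OF \<Omega>] by (auto simp: l2_rel_def)
  have "cls \<Omega> f \<bullet> cls \<Omega> g = L2_inner UNIV (?e f) (?e g)"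
    unfolding cls_def using r by (simp add: inner_l2.abs_eq)
  also have "\<dots> = (LINT x|lebesgue. indicator \<Omega> x *\<^sub>R (f x \<bullet> g x))"
    unfolding L2_inner_def lebesgue_on_UNIV_eq by (rule arg_cong[where f="integral\<^sup>L lebesgue"]) (auto simp: indicator_def)
  also have "\<dots> = L2_inner \<Omega> f g"
    unfolding L2_inner_def using \<Omega> by (intro integral_restrict_space[symmetric]) auto
  finally show ?thesis .
qed

lemma cls_norm:
  assumes "\<Omega> \<in> sets lebesgue" "f \<in> L2 \<Omega>"
  shows "norm (cls \<Omega> f) = L2_norm \<Omega> f"
  using cls_inner[OF assms(1,2,2)] by (simp add: L2_norm_def norm_eq_sqrt_inner)

lemma cls_eq_iff:
  fixes f g :: "'a::euclidean_space \<Rightarrow> 'b::euclidean_space"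
  assumes \<Omega>: "\<Omega> \<in> sets lebesgue" and fg: "f \<in> L2 \<Omega>" "g \<in> L2 \<Omega>"
  shows "cls \<Omega> f = cls \<Omega> g \<longleftrightarrow> (AE x in lebesgue_on \<Omega>. f x = g x)"
proof -
  let ?e = "\<lambda>f x. if x \<in> \<Omega> then f x else (0::'b)"
  have r: "?e f \<in> L2 UNIV" "?e g \<in> L2 UNIV" using fg L2_extend_by_zero[OF \<Omega>] by auto
  have "cls \<Omega> f = cls \<Omega> g \<longleftrightarrow> l2_rel (?e f) (?e g)"
    unfolding cls_def using r Quotient_rel[OF Quotient_l2, of "?e f" "?e g"] by (auto simp: l2_rel_def)
  also have "\<dots> \<longleftrightarrow> (AE x in lebesgue. ?e f x = ?e g x)"
    using r unfolding l2_rel_def lebesgue_on_UNIV_eq by blast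
  also have "\<dots> \<longleftrightarrow> (AE x in lebesgue. x \<in> \<Omega> \<longrightarrow> f x = g x)" by (intro AE_cong) auto
  also have "\<dots> \<longleftrightarrow> (AE x in lebesgue_on \<Omega>. f x = g x)"
    using \<Omega> by (intro AE_restrict_space_iff[symmetric]) auto
  finally show ?thesis .
qed

lemma cls_add:
  assumes \<Omega>: "\<Omega> \<in> sets lebesgue" and fg: "f \<in> L2 \<Omega>" "g \<in> L2 \<Omega>"
  shows "cls \<Omega> (\<lambda>x. f x + g x) = cls \<Omega> f + cls \<Omega> g"
proof -
  have r: "l2_rel (\<lambda>x. if x \<in> \<Omega> then f x else 0) (\<lambda>x. if x \<in> \<Omega> then f x else 0)"
    "l2_rel (\<lambda>x. if x \<in> \<Omega> then g x else 0) (\<lambda>x. if x \<in> \<Omega> then g x else 0)"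
    using fg L2_extend_by_zero[OF \<Omega>] by (auto simp: l2_rel_def)
  show ?thesis unfolding cls_def plus_l2.abs_eq[OF r]
    by (rule arg_cong[where f=abs_l2]) auto
qed

lemma cls_scaleR:
  assumes \<Omega>: "\<Omega> \<in> sets lebesgue" and f: "f \<in> L2 \<Omega>"
  shows "cls \<Omega> (\<lambda>x. c *\<^sub>R f x) = c *\<^sub>R cls \<Omega> f"
proof -
  have r: "l2_rel (\<lambda>x. if x \<in> \<Omega> then f x else 0) (\<lambda>x. if x \<in> \<Omega> then f x else 0)"
    using f L2_extend_by_zero[OF \<Omega>] by (auto simp: l2_rel_def)
  show ?thesis unfolding cls_def scaleR_l2.abs_eq[OF r]
    by (rule arg_cong[where f=abs_l2]) auto
qed

lemma cls_zero: "\<Omega> \<in> sets lebesgue \<Longrightarrow> cls \<Omega> (\<lambda>x. 0) = 0"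
  unfolding cls_def zero_l2_def by simp

lemma cls_diff:
  assumes \<Omega>: "\<Omega> \<in> sets lebesgue" and fg: "f \<in> L2 \<Omega>" "g \<in> L2 \<Omega>"
  shows "cls \<Omega> (\<lambda>x. f x - g x) = cls \<Omega> f - cls \<Omega> g"
  using cls_add[OF \<Omega> fg(1) L2_scaleR[OF fg(2), of "-1"]] cls_scaleR[OF \<Omega> fg(2), of "-1"] by simp

lemma L2_sum:
  assumes "finite F" "\<And>k. k \<in> F \<Longrightarrow> f k \<in> L2 \<Omega>"
  shows "(\<lambda>x. \<Sum>k\<in>F. c k *\<^sub>R f k x) \<in> L2 \<Omega>"
  using assms by (induct F) (auto simp: L2_zero intro!: L2_add L2_scaleR)

lemma cls_sum:
  assumes \<Omega>: "\<Omega> \<in> sets lebesgue" and "finite F" "\<And>k. k \<in> F \<Longrightarrow> f k \<in> L2 \<Omega>"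
  shows "cls \<Omega> (\<lambda>x. \<Sum>k\<in>F. c k *\<^sub>R f k x) = (\<Sum>k\<in>F. c k *\<^sub>R cls \<Omega> (f k))"
  using assms(2,3)
proof (induct F)
  case (insert a F)
  have "cls \<Omega> (\<lambda>x. c a *\<^sub>R f a x + (\<Sum>k\<in>F. c k *\<^sub>R f k x)) =
        cls \<Omega> (\<lambda>x. c a *\<^sub>R f a x) + cls \<Omega> (\<lambda>x. \<Sum>k\<in>F. c k *\<^sub>R f k x)"
    using insert by (intro cls_add[OF \<Omega>] L2_scaleR L2_sum) auto
  then show ?case using insert cls_scaleR[OF \<Omega>, of "f a" "c a"] by simp
qed (simp add: cls_zero[OF \<Omega>])

lemma UNIV_lebesgue: "UNIV \<in> sets lebesgue" by simp

lemma abs_l2_UNIV: "cls UNIV f = abs_l2 f" by (simp add: cls_def)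

lemma l2_cases:
  obtains f where "f \<in> L2 UNIV" "x = cls UNIV f"
  using Quotient_rep_abs[OF Quotient_l2] Quotient_abs_rep[OF Quotient_l2, of x]
    Quotient_rep_reflp[OF Quotient_l2, of x] that[of "rep_l2 x"]
  by (auto simp: l2_rel_def abs_l2_UNIV)

definition L2_range :: "'a::euclidean_space set \<Rightarrow> ('a, 'b::euclidean_space) l2 set" where
  "L2_range \<Omega> = cls \<Omega> ` L2 \<Omega>"

text \<open>As an orthogonal complement, the range is closed.\<close>

lemma L2_range_eq:
  assumes \<Omega>: "\<Omega> \<in> sets lebesgue"
  shows "L2_range \<Omega> = {x. \<forall>g\<in>cls UNIV ` {g \<in> L2 UNIV. \<forall>y\<in>\<Omega>. g y = 0}. x \<bullet> g = 0}"
proof (intro set_eqI iffI)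
  fix x :: "('a, 'b) l2" assume "x \<in> L2_range \<Omega>"
  then obtain f where f: "f \<in> L2 \<Omega>" "x = cls \<Omega> f" by (auto simp: L2_range_def)
  let ?f = "\<lambda>x. if x \<in> \<Omega> then f x else 0"
  have f': "?f \<in> L2 UNIV" using f L2_extend_by_zero[OF \<Omega>] by auto
  have x: "x = cls UNIV ?f" unfolding f by (simp add: cls_def)
  have "x \<bullet> cls UNIV g = 0" if "g \<in> L2 UNIV" "\<forall>y\<in>\<Omega>. g y = 0" for g
  proof -
    have "(\<lambda>x. ?f x \<bullet> g x) = (\<lambda>x. 0)" using that(2) by auto
    then show ?thesis unfolding x cls_inner[OF UNIV_lebesgue f' that(1)] L2_inner_def by simp
  qed
  then show "x \<in> {x. \<forall>g\<in>cls UNIV ` {g \<in> L2 UNIV. \<forall>y\<in>\<Omega>. g y = 0}. x \<bullet> g = 0}" by auto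
next
  fix x :: "('a, 'b) l2" assume x: "x \<in> {x. \<forall>g\<in>cls UNIV ` {g \<in> L2 UNIV. \<forall>y\<in>\<Omega>. g y = 0}. x \<bullet> g = 0}"
  obtain f where f: "f \<in> L2 UNIV" "x = cls UNIV f" by (rule l2_cases)
  have m: "f \<in> borel_measurable lebesgue" using L2D(1)[OF f(1)] by (simp add: lebesgue_on_UNIV_eq)
  have "f \<in> L2 \<Omega>"
  proof (rule L2I)
    show "f \<in> borel_measurable (lebesgue_on \<Omega>)" using m by (rule measurable_restrict_space1)
    have "integrable lebesgue (\<lambda>x. indicator \<Omega> x *\<^sub>R (norm (f x))\<^sup>2)"
      using L2D(2)[OF f(1)] \<Omega> by (intro integrable_mult_indicator) (auto simp: lebesgue_on_UNIV_eq)
    then show "integrable (lebesgue_on \<Omega>) (\<lambda>x. (norm (f x))\<^sup>2)"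
      using integrable_restrict_space[of \<Omega> lebesgue "\<lambda>x. (norm (f x))\<^sup>2"] \<Omega> by auto
  qed
  then have f': "(\<lambda>x. if x \<in> \<Omega> then f x else 0) \<in> L2 UNIV" using L2_extend_by_zero[OF \<Omega>] by auto
  \<comment> \<open>The part of \<open>f\<close> outside \<open>\<Omega>\<close>. It is among the
    functions to which \<open>x\<close> is orthogonal, and its product with \<open>f\<close> is its
    own square.\<close>
  define g where "g = (\<lambda>x. f x - (if x \<in> \<Omega> then f x else 0))"
  have g: "g \<in> L2 UNIV" unfolding g_def by (rule L2_diff[OF f(1) f'])
  have g0: "\<forall>y\<in>\<Omega>. g y = 0" by (simp add: g_def)
  have "x \<bullet> cls UNIV g = 0" using x g g0 by auto
  then have "L2_inner UNIV f g = 0" using cls_inner[OF UNIV_lebesgue f(1) g] f(2) by simp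
  moreover have "(\<lambda>x. f x \<bullet> g x) = (\<lambda>x. g x \<bullet> g x)" by (auto simp: g_def)
  ultimately have "L2_inner UNIV g g = 0" by (simp add: L2_inner_def)
  then have "cls UNIV g = 0" using cls_inner[OF UNIV_lebesgue g g] by simp
  then have "x = cls UNIV (\<lambda>x. if x \<in> \<Omega> then f x else 0)"
    unfolding g_def cls_diff[OF UNIV_lebesgue f(1) f'] f(2) by simp
  then have "x = cls \<Omega> f" by (simp add: cls_def)
  then show "x \<in> L2_range \<Omega>" using \<open>f \<in> L2 \<Omega>\<close> by (auto simp: L2_range_def)
qed

text \<open>Riesz-Fischer. On the whole space L2 is not contained in L1, so a positive integrable
  weight \<open>w\<close> is used: the weighted sequence is Cauchy in L1, a subsequence of it is
  Cauchy almost everywhere, and dividing by \<open>w\<close> gives the pointwise limit.\<close>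

instance l2 :: (euclidean_space, euclidean_space) complete_space
proof
  fix X :: "nat \<Rightarrow> ('a, 'b) l2" assume cX: "Cauchy X"
  have "\<exists>f. f \<in> L2 UNIV \<and> X n = cls UNIV f" for n by (rule l2_cases[of "X n"]) blast
  then obtain f where f: "\<And>n. f n \<in> L2 UNIV" and Xf: "\<And>n. X n = cls UNIV (f n)" by metis
  let ?M = "lebesgue_on (UNIV :: 'a set)"
  have fm [measurable]: "f n \<in> borel_measurable ?M" for n by (rule L2D(1)[OF f])
  obtain w :: "'a \<Rightarrow> real" where w: "w \<in> borel_measurable lborel" "\<And>x. w x > 0" "\<And>x. w x \<le> 1" "integrable lborel w"
    using sigma_finite_measure.obtain_positive_integrable_function[OF sigma_finite_lborel] by blast
  have wm [measurable]: "w \<in> borel_measurable ?M"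
    unfolding lebesgue_on_UNIV_eq using w(1) measurable_completion by blast
  have wi: "integrable ?M w"
    unfolding lebesgue_on_UNIV_eq using w(4,1) by (simp add: integrable_completion)
  have w2: "w \<in> L2 UNIV"
  proof (rule L2_bound[OF wm wi])
    show "(norm (w x))\<^sup>2 \<le> w x" for x
      using w(2,3)[of x] mult_left_le[of "w x" "w x"] by (simp add: power2_eq_square)
  qed
  define s where "s n x = w x *\<^sub>R f n x" for n x
  have normL2: "(\<lambda>x. norm (g x)) \<in> L2 UNIV" if "g \<in> L2 UNIV" for g :: "'a \<Rightarrow> 'b"
    using that unfolding L2_def by auto
  have si: "integrable ?M (s n)" for n
  proof (rule Bochner_Integration.integrable_bound[OF L2_inner_integrable[OF w2 normL2[OF f[of n]]]])
    show "s n \<in> borel_measurable ?M" unfolding s_def by measurable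
    show "AE x in ?M. norm (s n x) \<le> norm (w x \<bullet> norm (f n x))" using w(2) by (auto simp: s_def abs_mult)
  qed
  have sC: "\<exists>N. \<forall>i\<ge>N. \<forall>j\<ge>N. (LINT x|?M. norm (s i x - s j x)) < e" if e: "e > 0" for e
  proof -
    define K where "K = norm (cls UNIV w) + 1"
    have K: "K > 0" by (simp add: K_def add_nonneg_pos)
    obtain N where N: "\<And>i j. i \<ge> N \<Longrightarrow> j \<ge> N \<Longrightarrow> norm (X i - X j) < e / K"
      using CauchyD[OF cX, of "e / K"] e K by auto
    have "(LINT x|?M. norm (s i x - s j x)) < e" if ij: "i \<ge> N" "j \<ge> N" for i j
    proof -
      let ?d = "\<lambda>x. f i x - f j x"
      have d: "?d \<in> L2 UNIV" by (intro L2_diff f)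
      have "(LINT x|?M. norm (s i x - s j x)) = L2_inner UNIV w (\<lambda>x. norm (?d x))"
        unfolding L2_inner_def s_def
      proof (rule Bochner_Integration.integral_cong)
        fix x show "norm (w x *\<^sub>R f i x - w x *\<^sub>R f j x) = w x \<bullet> norm (f i x - f j x)"
          using w(2)[of x] by (simp add: scaleR_diff_right[symmetric] del: scaleR_diff_right)
      qed simp
      also have "\<dots> = cls UNIV w \<bullet> cls UNIV (\<lambda>x. norm (?d x))"
        by (rule cls_inner[OF UNIV_lebesgue w2 normL2[OF d], symmetric])
      also have "\<dots> \<le> norm (cls UNIV w) * norm (cls UNIV (\<lambda>x. norm (?d x)))" by (rule norm_cauchy_schwarz)
      also have "norm (cls UNIV (\<lambda>x. norm (?d x))) = norm (cls UNIV ?d)"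
        unfolding cls_norm[OF UNIV_lebesgue normL2[OF d]] cls_norm[OF UNIV_lebesgue d]
        by (simp add: L2_norm_def L2_inner_def dot_square_norm power2_eq_square)
      also have "cls UNIV ?d = X i - X j" unfolding Xf by (rule cls_diff[OF UNIV_lebesgue f f])
      also have "norm (cls UNIV w) * norm (X i - X j) \<le> K * norm (X i - X j)"
        by (intro mult_right_mono) (auto simp: K_def)
      also have "\<dots> < K * (e / K)" using N[OF ij] K by (intro mult_strict_left_mono)
      finally show ?thesis using K by simp
    qed
    then show ?thesis by blast
  qed
  obtain r where r: "strict_mono r" "AE x in ?M. Cauchy (\<lambda>i. s (r i) x)"
    by (rule cauchy_L1_AE_cauchy_subseq[of ?M s, OF si sC])
  define g where "g x = lim (\<lambda>i. f (r i) x)" for x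
  have gm [measurable]: "g \<in> borel_measurable ?M" unfolding g_def by (rule borel_measurable_lim_metric) (rule fm)
  have AEg: "AE x in ?M. (\<lambda>i. f (r i) x) \<longlonglongrightarrow> g x"
    using r(2)
  proof eventually_elim
    case (elim x)
    then obtain l where "(\<lambda>i. s (r i) x) \<longlonglongrightarrow> l" using Cauchy_convergent convergent_def by blast
    then have "(\<lambda>i. inverse (w x) *\<^sub>R s (r i) x) \<longlonglongrightarrow> inverse (w x) *\<^sub>R l" by (intro tendsto_intros)
    moreover have "(\<lambda>i. inverse (w x) *\<^sub>R s (r i) x) = (\<lambda>i. f (r i) x)" using w(2)[of x] by (simp add: s_def)
    ultimately have "convergent (\<lambda>i. f (r i) x)" by (auto simp: convergent_def)
    then show ?case unfolding g_def by (simp add: convergent_LIMSEQ_iff)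
  qed
  \<comment> \<open>Fatou's lemma along the subsequence carries the Cauchy bound over to the
    distance from \<open>g\<close>. This yields both that \<open>g\<close> is in L2 and that the
    sequence converges to it.\<close>
  have fatou: "(\<integral>\<^sup>+x. ennreal ((norm (f n x - g x))\<^sup>2) \<partial>?M) \<le> ennreal (e\<^sup>2)"
    if N: "\<And>i. i \<ge> N \<Longrightarrow> norm (X n - X i) \<le> e" and e: "e > 0" for n N e
  proof -
    have "(\<integral>\<^sup>+x. ennreal ((norm (f n x - g x))\<^sup>2) \<partial>?M)
        = (\<integral>\<^sup>+x. liminf (\<lambda>i. ennreal ((norm (f n x - f (r i) x))\<^sup>2)) \<partial>?M)"
    proof (rule nn_integral_cong_AE)
      show "AE x in ?M. ennreal ((norm (f n x - g x))\<^sup>2) = liminf (\<lambda>i. ennreal ((norm (f n x - f (r i) x))\<^sup>2))"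
        using AEg
      proof eventually_elim
        case (elim x)
        then have "(\<lambda>i. ennreal ((norm (f n x - f (r i) x))\<^sup>2)) \<longlonglongrightarrow> ennreal ((norm (f n x - g x))\<^sup>2)"
          by (intro tendsto_ennrealI tendsto_intros)
        then show ?case by (rule lim_imp_Liminf[OF trivial_limit_sequentially, symmetric])
      qed
    qed
    also have "\<dots> \<le> liminf (\<lambda>i. \<integral>\<^sup>+x. ennreal ((norm (f n x - f (r i) x))\<^sup>2) \<partial>?M)"
      by (rule nn_integral_liminf) measurable
    also have "\<dots> \<le> liminf (\<lambda>i. ennreal (e\<^sup>2))"
    proof (rule Liminf_mono)
      show "\<forall>\<^sub>F i in sequentially. (\<integral>\<^sup>+x. ennreal ((norm (f n x - f (r i) x))\<^sup>2) \<partial>?M) \<le> ennreal (e\<^sup>2)"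
        unfolding eventually_sequentially
      proof (intro exI allI impI)
        fix i assume "N \<le> i"
        then have i: "N \<le> r i" using seq_suble[OF r(1), of i] by simp
        have d: "(\<lambda>x. f n x - f (r i) x) \<in> L2 UNIV" by (intro L2_diff f)
        have "(\<integral>\<^sup>+x. ennreal ((norm (f n x - f (r i) x))\<^sup>2) \<partial>?M) = ennreal (LINT x|?M. (norm (f n x - f (r i) x))\<^sup>2)"
          by (rule nn_integral_eq_integral[OF L2D(2)[OF d]]) simp
        also have "(LINT x|?M. (norm (f n x - f (r i) x))\<^sup>2) = (norm (X n - X (r i)))\<^sup>2"
          unfolding Xf cls_diff[OF UNIV_lebesgue f f, symmetric] power2_norm_eq_inner[of "cls _ _"] cls_inner[OF UNIV_lebesgue d d]
          by (simp add: L2_inner_def dot_square_norm)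
        also have "ennreal \<dots> \<le> ennreal (e\<^sup>2)"
          using N[OF i] by (intro ennreal_leI power_mono) auto
        finally show "(\<integral>\<^sup>+x. ennreal ((norm (f n x - f (r i) x))\<^sup>2) \<partial>?M) \<le> ennreal (e\<^sup>2)" .
      qed
    qed
    also have "\<dots> = ennreal (e\<^sup>2)" by (simp add: Liminf_const)
    finally show ?thesis .
  qed
  have CN: "\<exists>N. \<forall>n\<ge>N. \<forall>i\<ge>N. norm (X n - X i) \<le> e" if "e > 0" for e
    using CauchyD[OF cX that] less_imp_le by blast
  have fg: "(\<lambda>x. f n x - g x) \<in> L2 UNIV" if "\<And>i. i \<ge> N \<Longrightarrow> norm (X n - X i) \<le> e" "e > 0" for n N e
  proof (rule L2I)
    show "integrable ?M (\<lambda>x. (norm (f n x - g x))\<^sup>2)"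
    proof (rule integrableI_bounded)
      have "(\<integral>\<^sup>+x. ennreal (norm ((norm (f n x - g x))\<^sup>2)) \<partial>?M) \<le> ennreal (e\<^sup>2)"
        using fatou[of N n e] that by simp
      also have "\<dots> < \<infinity>" by simp
      finally show "(\<integral>\<^sup>+x. ennreal (norm ((norm (f n x - g x))\<^sup>2)) \<partial>?M) < \<infinity>" .
    qed measurable
  qed measurable
  have g: "g \<in> L2 UNIV"
  proof -
    obtain N where N: "\<And>n i. n \<ge> N \<Longrightarrow> i \<ge> N \<Longrightarrow> norm (X n - X i) \<le> 1" using CN[of 1] by auto
    have "(\<lambda>x. f N x - g x) \<in> L2 UNIV" by (rule fg[of N N 1]) (auto intro: N)
    from L2_diff[OF f[of N] this] show ?thesis by simp
  qed
  have "X \<longlonglongrightarrow> cls UNIV g"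
  proof (rule LIMSEQ_I)
    fix e :: real assume e: "e > 0"
    obtain N where N: "\<And>n i. n \<ge> N \<Longrightarrow> i \<ge> N \<Longrightarrow> norm (X n - X i) \<le> e / 2" using CN[of "e/2"] e by auto
    have "norm (X n - cls UNIV g) < e" if n: "n \<ge> N" for n
    proof -
      have d: "(\<lambda>x. f n x - g x) \<in> L2 UNIV" by (intro L2_diff f g)
      have "ennreal ((norm (X n - cls UNIV g))\<^sup>2) = ennreal (LINT x|?M. (norm (f n x - g x))\<^sup>2)"
        unfolding Xf cls_diff[OF UNIV_lebesgue f g, symmetric] power2_norm_eq_inner[of "cls _ _"] cls_inner[OF UNIV_lebesgue d d]
        by (simp add: L2_inner_def dot_square_norm)
      also have "\<dots> = (\<integral>\<^sup>+x. ennreal ((norm (f n x - g x))\<^sup>2) \<partial>?M)"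
        by (rule nn_integral_eq_integral[OF L2D(2)[OF d], symmetric]) simp
      also have "\<dots> \<le> ennreal ((e/2)\<^sup>2)" using fatou[of N n "e/2"] N[OF n] e by simp
      finally have "(norm (X n - cls UNIV g))\<^sup>2 \<le> (e/2)\<^sup>2" by simp
      then have "norm (X n - cls UNIV g) \<le> e / 2" by (rule power2_le_imp_le) (use e in simp)
      then show ?thesis using e by simp
    qed
    then show "\<exists>N. \<forall>n\<ge>N. norm (X n - cls UNIV g) < e" by blast
  qed
  then show "convergent X" by (auto simp: convergent_def)
qed

instance l2 :: (euclidean_space, euclidean_space) banach ..

lemma closed_subspace_L2_range:
  "\<Omega> \<in> sets lebesgue \<Longrightarrow> closed_subspace (L2_range \<Omega>)"
  unfolding L2_range_eq by (rule closed_subspace_orthogonal_complement)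

section \<open>Test functions\<close>

lemma partial_derivI: "(\<phi> has_derivative D) (at x) \<Longrightarrow> partial_deriv i \<phi> x = D (axis i 1)"
  unfolding partial_deriv_def using frechet_derivative_at by metis

lemma partial_deriv_has_derivative:
  "\<phi> differentiable_on UNIV \<Longrightarrow> (\<phi> has_derivative frechet_derivative \<phi> (at x)) (at x)"
  by (simp add: differentiable_on_def frechet_derivative_works[symmetric])

text \<open>Needed for the Leibniz rule, where the undifferentiated factor is used one order
  lower.\<close>

lemma C_k_Suc: "C_k (Suc k) \<phi> \<Longrightarrow> C_k k \<phi>"
proof (induct k arbitrary: \<phi>)
  case 0 then show ?case by (auto intro: differentiable_imp_continuous_on)
next
  case (Suc k)
  have "C_k k (partial_deriv i \<phi>)" for i by (rule Suc(1)) (use Suc(2) in simp)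
  then show ?case using Suc(2) by simp
qed

lemma C_k_const: "C_k k (\<lambda>x::real^'n::finite. c)"
proof (induct k arbitrary: c)
  case (Suc k)
  have "partial_deriv i (\<lambda>x::real^'n. c) = (\<lambda>x. 0)" for i
    by (rule ext, rule partial_derivI[OF has_derivative_const])
  then show ?case using Suc by simp
qed simp

lemma partial_deriv_add:
  assumes "\<phi> differentiable_on UNIV" "\<psi> differentiable_on UNIV"
  shows "partial_deriv i (\<lambda>x. \<phi> x + \<psi> x) = (\<lambda>x. partial_deriv i \<phi> x + partial_deriv i \<psi> x)"
proof
  fix x
  show "partial_deriv i (\<lambda>x. \<phi> x + \<psi> x) x = partial_deriv i \<phi> x + partial_deriv i \<psi> x"
    using partial_derivI[OF has_derivative_add[OF partial_deriv_has_derivative[OF assms(1)] partial_deriv_has_derivative[OF assms(2)]], of i x]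
    by (simp add: partial_deriv_def)
qed

lemma partial_deriv_mult:
  assumes "\<phi> differentiable_on UNIV" "\<psi> differentiable_on UNIV"
  shows "partial_deriv i (\<lambda>x. \<phi> x * \<psi> x) = (\<lambda>x. \<phi> x * partial_deriv i \<psi> x + partial_deriv i \<phi> x * \<psi> x)"
proof
  fix x
  show "partial_deriv i (\<lambda>x. \<phi> x * \<psi> x) x = \<phi> x * partial_deriv i \<psi> x + partial_deriv i \<phi> x * \<psi> x"
    using partial_derivI[OF has_derivative_mult[OF partial_deriv_has_derivative[OF assms(1)] partial_deriv_has_derivative[OF assms(2)]], of i x]
    by (simp add: partial_deriv_def)
qed

lemma differentiable_on_add_mult:
  fixes \<phi> \<psi> :: "real^'n::finite \<Rightarrow> real"
  assumes "\<phi> differentiable_on UNIV" "\<psi> differentiable_on UNIV"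
  shows "(\<lambda>x. \<phi> x + \<psi> x) differentiable_on UNIV" "(\<lambda>x. \<phi> x * \<psi> x) differentiable_on UNIV"
  using assms by (auto simp: differentiable_on_def)

lemma C_k_add: "C_k k \<phi> \<Longrightarrow> C_k k \<psi> \<Longrightarrow> C_k k (\<lambda>x. \<phi> x + \<psi> x)"
proof (induct k arbitrary: \<phi> \<psi>)
  case (Suc k)
  then show ?case by (simp add: partial_deriv_add differentiable_on_add_mult)
qed (simp add: continuous_on_add)

lemma C_k_mult: "C_k k \<phi> \<Longrightarrow> C_k k \<psi> \<Longrightarrow> C_k k (\<lambda>x. \<phi> x * \<psi> x)"
proof (induct k arbitrary: \<phi> \<psi>)
  case (Suc k)
  have d: "\<phi> differentiable_on UNIV" "\<psi> differentiable_on UNIV" using Suc(2,3) by auto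
  have "C_k k (\<lambda>x. \<phi> x * partial_deriv i \<psi> x + partial_deriv i \<phi> x * \<psi> x)" for i
    using Suc(2,3) by (intro C_k_add Suc(1) C_k_Suc[of k \<phi>] C_k_Suc[of k \<psi>]) auto
  then show ?case using d by (simp add: partial_deriv_mult[OF d] differentiable_on_add_mult)
qed (simp add: continuous_on_mult)

lemma C_k_prod: "finite F \<Longrightarrow> (\<And>j. j \<in> F \<Longrightarrow> C_k k (\<phi> j)) \<Longrightarrow> C_k k (\<lambda>x. \<Prod>j\<in>F. \<phi> j x)"
  by (induct F rule: finite_induct) (auto intro: C_k_const C_k_mult)

lemma C_k_coordinate: "C_k k (\<lambda>x::real^'n::finite. x $ j)"
proof (cases k)
  case (Suc l)
  have d: "((\<lambda>x::real^'n. x $ j) has_derivative (\<lambda>h. h $ j)) (at x)" for x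
    by (rule bounded_linear.has_derivative[OF bounded_linear_vec_nth has_derivative_ident])
  have "partial_deriv i (\<lambda>x::real^'n. x $ j) = (\<lambda>x. axis i 1 $ j)" for i
    by (rule ext, rule partial_derivI[OF d])
  moreover have "(\<lambda>x::real^'n. x $ j) differentiable_on UNIV"
    unfolding differentiable_on_def using d by (auto simp: differentiable_def)
  ultimately show ?thesis using Suc by (simp add: C_k_const)
qed (auto intro!: continuous_intros)

text \<open>Derivatives of \<open>exp (-1/t)\<close> stay in this family, so all are continuous at \<open>0\<close>.\<close>

definition flat :: "real poly \<Rightarrow> real \<Rightarrow> real" where
  "flat p t = (if 0 < t then poly p (1 / t) * exp (- (1 / t)) else 0)"

lemma poly_times_exp_tendsto_0: "((\<lambda>y. poly p y * exp (- y)) \<longlongrightarrow> (0::real)) at_top"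
proof -
  have "(\<lambda>y. poly p y * exp (- y)) = (\<lambda>y. \<Sum>i\<le>degree p. coeff p i * (y ^ i / exp y))"
    by (rule ext) (simp add: poly_altdef exp_minus sum_distrib_right divide_inverse mult.assoc)
  moreover have "((\<lambda>y. \<Sum>i\<le>degree p. coeff p i * (y ^ i / exp y)) \<longlongrightarrow> (\<Sum>i\<le>degree p. coeff p i * 0)) at_top"
    by (intro tendsto_sum tendsto_mult tendsto_const tendsto_power_div_exp_0)
  ultimately show ?thesis by simp
qed

text \<open>Chain rule with \<open>y = 1 / t\<close>: the derivative of \<open>p(y) exp(-y)\<close>
  with respect to \<open>t\<close> is \<open>y^2 (p - p')(y) exp(-y)\<close>.\<close>

definition flat_deriv :: "real poly \<Rightarrow> real poly" where
  "flat_deriv p = [:0, 0, 1:] * (p - pderiv p)"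

lemma flat_has_derivative: "(flat p has_real_derivative flat (flat_deriv p) t) (at t)"
proof -
  consider "t > 0" | "t < 0" | "t = 0" by linarith
  then show ?thesis
  proof cases
    case 1
    have inv: "((\<lambda>t. 1 / t) has_real_derivative - (1 / t\<^sup>2)) (at t)"
      using 1 by (auto intro!: derivative_eq_intros simp: power2_eq_square)
    have "((\<lambda>t. poly p (1 / t) * exp (- (1 / t))) has_real_derivative
        (poly (pderiv p) (1 / t) * - (1 / t\<^sup>2)) * exp (- (1 / t)) + exp (- (1 / t)) * - (- (1 / t\<^sup>2)) * poly p (1 / t)) (at t)"
      by (intro DERIV_mult DERIV_chain2[OF poly_DERIV inv] DERIV_fun_exp DERIV_minus inv)
    also have "(poly (pderiv p) (1 / t) * - (1 / t\<^sup>2)) * exp (- (1 / t)) + exp (- (1 / t)) * - (- (1 / t\<^sup>2)) * poly p (1 / t)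
        = flat (flat_deriv p) t"
      using 1 by (simp add: flat_def flat_deriv_def power2_eq_square algebra_simps)
    finally show ?thesis
      by (rule has_field_derivative_transform_within_open[where S="{0<..}"]) (use 1 in \<open>auto simp: flat_def\<close>)
  next
    case 2
    have "((\<lambda>t. 0) has_real_derivative flat (flat_deriv p) t) (at t)" using 2 by (simp add: flat_def)
    then show ?thesis
      by (rule has_field_derivative_transform_within_open[where S="{..<0}"]) (use 2 in \<open>auto simp: flat_def\<close>)
  next
    case 3
    \<comment> \<open>With \<open>y = 1 / h\<close> the difference quotient at 0 from the right is
      \<open>y p(y) exp(-y)\<close>, again a polynomial times a decaying exponential.\<close>
    have "((\<lambda>h. flat p h / h) \<longlongrightarrow> 0) (at_right 0)"
    proof -
      have "((\<lambda>h. poly ([:0, 1:] * p) (inverse h) * exp (- inverse h)) \<longlongrightarrow> 0) (at_right 0)"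
        by (rule filterlim_compose[OF poly_times_exp_tendsto_0 filterlim_inverse_at_top_right])
      moreover have "\<forall>\<^sub>F h in at_right 0. poly ([:0, 1:] * p) (inverse h) * exp (- inverse h) = flat p h / h"
        unfolding eventually_at_right_field
        by (rule exI[of _ 1]) (auto simp: flat_def divide_inverse)
      ultimately show ?thesis by (rule Lim_transform_eventually)
    qed
    moreover have "((\<lambda>h. flat p h / h) \<longlongrightarrow> 0) (at_left 0)"
    proof (rule Lim_transform_eventually)
      show "\<forall>\<^sub>F h in at_left 0. 0 = flat p h / h"
        unfolding eventually_at_left_field by (rule exI[of _ "-1"]) (auto simp: flat_def)
    qed simp
    ultimately have "((\<lambda>h. flat p h / h) \<longlongrightarrow> 0) (at 0)" by (intro filterlim_split_at)
    then show ?thesis using 3 by (simp add: DERIV_def flat_def)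
  qed
qed

lemma flat_coordinate_has_derivative:
  fixes j :: "'n::finite"
  shows "((\<lambda>x. flat p (a * x $ j + b)) has_derivative (\<lambda>h. flat (flat_deriv p) (a * x $ j + b) * (a * h $ j))) (at x)"
proof -
  have "((\<lambda>x::real^'n. x $ j) has_derivative (\<lambda>h. h $ j)) (at x)"
    by (rule bounded_linear.has_derivative[OF bounded_linear_vec_nth has_derivative_ident])
  then have "((\<lambda>x::real^'n. a * x $ j + b) has_derivative (\<lambda>h. a * h $ j)) (at x)"
    by (auto intro!: derivative_eq_intros)
  from has_derivative_compose[OF this has_field_derivative_imp_has_derivative[OF flat_has_derivative]]
  show ?thesis by simp
qed

lemma C_k_flat: "C_k k (\<lambda>x::real^'n::finite. flat p (a * x $ j + b))"
proof (induct k arbitrary: p)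
  case 0
  have "(\<lambda>x::real^'n. flat p (a * x $ j + b)) differentiable_on UNIV"
    unfolding differentiable_on_def differentiable_def using flat_coordinate_has_derivative by blast
  then show ?case by (simp add: differentiable_imp_continuous_on)
next
  case (Suc k)
  have "(\<lambda>x::real^'n. flat p (a * x $ j + b)) differentiable_on UNIV"
    unfolding differentiable_on_def differentiable_def using flat_coordinate_has_derivative by blast
  moreover have "partial_deriv i (\<lambda>x::real^'n. flat p (a * x $ j + b)) =
      (\<lambda>x. flat (flat_deriv p) (a * x $ j + b) * (a * axis i 1 $ j))" for i
    by (rule ext, rule partial_derivI[OF flat_coordinate_has_derivative])
  ultimately show ?case using Suc by (simp add: C_k_mult C_k_const)
qed

section \<open>Test functions and integration by parts\<close>

lemma test_functionsI:
  "(\<And>k. C_k k \<phi>) \<Longrightarrow> compact K \<Longrightarrow> K \<subseteq> \<Omega> \<Longrightarrow> (\<And>x. x \<notin> K \<Longrightarrow> \<phi> x = 0) \<Longrightarrow> \<phi> \<in> test_functions \<Omega>"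
  by (auto simp: test_functions_def)

lemma test_functionsE:
  assumes "\<phi> \<in> test_functions \<Omega>"
  obtains K where "compact K" "K \<subseteq> \<Omega>" "\<And>x. x \<notin> K \<Longrightarrow> \<phi> x = 0"
  using assms by (auto simp: test_functions_def)

lemma test_functions_C_k: "\<phi> \<in> test_functions \<Omega> \<Longrightarrow> C_k k \<phi>" by (simp add: test_functions_def)

lemma test_functions_differentiable: "\<phi> \<in> test_functions \<Omega> \<Longrightarrow> \<phi> differentiable_on UNIV"
  using test_functions_C_k[of \<phi> \<Omega> "Suc 0"] by simp

lemma test_functions_continuous: "\<phi> \<in> test_functions \<Omega> \<Longrightarrow> continuous_on UNIV \<phi>"
  using test_functions_C_k[of \<phi> \<Omega> 0] by simp

lemma test_functions_mult:
  assumes "\<phi> \<in> test_functions \<Omega>" "\<And>k. C_k k \<psi>"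
  shows "(\<lambda>x. \<psi> x * \<phi> x) \<in> test_functions \<Omega>"
proof -
  obtain K where K: "compact K" "K \<subseteq> \<Omega>" "\<And>x. x \<notin> K \<Longrightarrow> \<phi> x = 0" using test_functionsE[OF assms(1)] by blast
  show ?thesis
    by (rule test_functionsI[OF _ K(1,2)]) (auto intro!: C_k_mult assms(2) test_functions_C_k[OF assms(1)] simp: K(3))
qed

lemma test_functions_add:
  assumes "\<phi> \<in> test_functions \<Omega>" "\<psi> \<in> test_functions \<Omega>"
  shows "(\<lambda>x. \<phi> x + \<psi> x) \<in> test_functions \<Omega>"
proof -
  obtain K where K: "compact K" "K \<subseteq> \<Omega>" "\<And>x. x \<notin> K \<Longrightarrow> \<phi> x = 0" using test_functionsE[OF assms(1)] by blast
  obtain L where L: "compact L" "L \<subseteq> \<Omega>" "\<And>x. x \<notin> L \<Longrightarrow> \<psi> x = 0" using test_functionsE[OF assms(2)] by blast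
  show ?thesis
    by (rule test_functionsI[of _ "K \<union> L"])
      (use K L in \<open>auto intro!: C_k_add test_functions_C_k[OF assms(1)] test_functions_C_k[OF assms(2)]\<close>)
qed

lemma test_functions_zero: "(\<lambda>x. 0) \<in> test_functions \<Omega>"
  by (rule test_functionsI[of _ "{}"]) (auto intro: C_k_const)

lemma partial_deriv_zero_outside:
  assumes "closed K" "\<And>x. x \<notin> K \<Longrightarrow> \<phi> x = 0" "x \<notin> K"
  shows "partial_deriv i \<phi> x = 0"
proof -
  have "((\<lambda>x. 0) has_derivative (\<lambda>h. 0)) (at x)" by (rule has_derivative_const)
  then have "(\<phi> has_derivative (\<lambda>h. 0)) (at x)"
    by (rule has_derivative_transform_within_open[where s="- K"]) (use assms in auto)
  then show ?thesis by (rule partial_derivI)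
qed

lemma test_functions_partial_deriv:
  assumes "\<phi> \<in> test_functions \<Omega>"
  shows "partial_deriv i \<phi> \<in> test_functions \<Omega>"
proof -
  obtain K where K: "compact K" "K \<subseteq> \<Omega>" "\<And>x. x \<notin> K \<Longrightarrow> \<phi> x = 0" using test_functionsE[OF assms] by blast
  have "C_k k (partial_deriv i \<phi>)" for k using test_functions_C_k[OF assms, of "Suc k"] by simp
  then show ?thesis
    using partial_deriv_zero_outside[OF compact_imp_closed[OF K(1)] K(3)] by (intro test_functionsI[OF _ K(1,2)])
qed

lemma integrable_continuous_compact_support:
  fixes f :: "'a::euclidean_space \<Rightarrow> 'b::euclidean_space"
  assumes "continuous_on UNIV f" "compact K" "\<And>x. x \<notin> K \<Longrightarrow> f x = 0"
  shows "integrable lborel f" "integrable lebesgue f"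
proof -
  have "integrable lborel (\<lambda>x. indicator K x *\<^sub>R f x)"
    by (intro borel_integrable_compact[OF assms(2)] continuous_on_subset[OF assms(1)]) auto
  moreover have "(\<lambda>x. indicator K x *\<^sub>R f x) = f" using assms(3) by (auto simp: indicator_def)
  ultimately show "integrable lborel f" by simp
  moreover have "f \<in> borel_measurable lborel" using borel_measurable_continuous_onI[OF assms(1)] by simp
  ultimately show "integrable lebesgue f" by (simp add: integrable_completion)
qed

lemma L2_continuous_compact_support:
  fixes f :: "'a::euclidean_space \<Rightarrow> 'b::euclidean_space"
  assumes "continuous_on UNIV f" "compact K" "\<And>x. x \<notin> K \<Longrightarrow> f x = 0" "\<Omega> \<in> sets lebesgue"
  shows "f \<in> L2 \<Omega>"
proof (rule L2I)
  have "f \<in> borel_measurable lborel" using borel_measurable_continuous_onI[OF assms(1)] by simp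
  then have "f \<in> borel_measurable lebesgue" by (rule measurable_completion)
  then show "f \<in> borel_measurable (lebesgue_on \<Omega>)" by (rule measurable_restrict_space1)
  have "integrable lebesgue (\<lambda>x. (norm (f x))\<^sup>2)"
    by (rule integrable_continuous_compact_support[OF _ assms(2)]) (auto intro!: continuous_intros assms(1) simp: assms(3))
  then have "integrable lebesgue (\<lambda>x. indicator \<Omega> x *\<^sub>R (norm (f x))\<^sup>2)"
    using assms(4) by (intro integrable_mult_indicator) auto
  then show "integrable (lebesgue_on \<Omega>) (\<lambda>x. (norm (f x))\<^sup>2)"
    using integrable_restrict_space[of \<Omega> lebesgue "\<lambda>x. (norm (f x))\<^sup>2"] assms(4) by auto
qed

lemma test_functions_L2:
  assumes "\<phi> \<in> test_functions \<Omega>" "\<Omega> \<in> sets lebesgue" shows "\<phi> \<in> L2 \<Omega>"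
  using test_functionsE[OF assms(1)] L2_continuous_compact_support[OF test_functions_continuous[OF assms(1)]] assms(2)
  by metis

lemma L2_inner_eq_integral_lebesgue:
  assumes "\<Omega> \<in> sets lebesgue" "\<And>x. x \<notin> \<Omega> \<Longrightarrow> f x \<bullet> g x = 0"
  shows "L2_inner \<Omega> f g = (LINT x|lebesgue. f x \<bullet> g x)"
proof -
  have "L2_inner \<Omega> f g = (LINT x|lebesgue. indicator \<Omega> x *\<^sub>R (f x \<bullet> g x))"
    unfolding L2_inner_def using assms(1) by (intro integral_restrict_space) auto
  also have "(\<lambda>x. indicator \<Omega> x *\<^sub>R (f x \<bullet> g x)) = (\<lambda>x. f x \<bullet> g x)"
  proof
    fix x show "indicator \<Omega> x *\<^sub>R (f x \<bullet> g x) = f x \<bullet> g x"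
      by (cases "x \<in> \<Omega>") (simp_all add: assms(2))
  qed
  finally show ?thesis .
qed

text \<open>The integral of a difference quotient vanishes by translation invariance.\<close>

lemma integral_partial_deriv_eq_0:
  fixes \<phi> :: "real^'n::finite \<Rightarrow> real"
  assumes \<phi>: "\<phi> \<in> test_functions \<Omega>"
  shows "integral\<^sup>L lebesgue (partial_deriv i \<phi>) = 0"
proof -
  obtain K where K: "compact K" "K \<subseteq> \<Omega>" "\<And>x. x \<notin> K \<Longrightarrow> \<phi> x = 0" using test_functionsE[OF \<phi>] by blast
  define \<psi> where "\<psi> = partial_deriv i \<phi>"
  have \<psi>c: "continuous_on UNIV \<psi>"
    unfolding \<psi>_def by (rule test_functions_continuous[OF test_functions_partial_deriv[OF \<phi>]])
  have \<psi>0: "\<psi> x = 0" if "x \<notin> K" for x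
    unfolding \<psi>_def by (rule partial_deriv_zero_outside[OF compact_imp_closed[OF K(1)] K(3) that])
  have "compact (\<psi> ` K)" using \<psi>c K(1) by (meson compact_continuous_image continuous_on_subset subset_UNIV)
  then obtain M where M: "M > 0" "\<And>y. y \<in> \<psi> ` K \<Longrightarrow> norm y \<le> M" using compact_imp_bounded bounded_pos by metis
  have \<psi>M: "\<bar>\<psi> x\<bar> \<le> M" for x using M \<psi>0[of x] by (cases "x \<in> K") auto
  obtain R where R: "\<And>x. x \<in> K \<Longrightarrow> norm x \<le> R" using compact_imp_bounded[OF K(1)] bounded_pos by metis
  define e :: "real^'n" where "e = axis i 1"
  have ne: "norm e = 1" by (simp add: e_def)
  define t where "t n = inverse (real (Suc n))" for n
  have t: "0 < t n" "t n \<le> 1" for n by (auto simp: t_def inverse_le_1_iff)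
  have t0: "t \<longlonglongrightarrow> 0" unfolding t_def by (rule LIMSEQ_inverse_real_of_nat)
  have line: "((\<lambda>r. \<phi> (r *\<^sub>R e + x)) has_real_derivative \<psi> (r *\<^sub>R e + x)) (at r)" for x r
  proof -
    have "((\<lambda>r. r *\<^sub>R e + x) has_derivative (\<lambda>h. h *\<^sub>R e)) (at r)"
      by (auto intro!: derivative_eq_intros)
    from has_derivative_compose[OF this partial_deriv_has_derivative[OF test_functions_differentiable[OF \<phi>]]]
    have "((\<lambda>r. \<phi> (r *\<^sub>R e + x)) has_derivative (\<lambda>h. frechet_derivative \<phi> (at (r *\<^sub>R e + x)) (h *\<^sub>R e))) (at r)" .
    moreover have "frechet_derivative \<phi> (at y) (h *\<^sub>R e) = \<psi> y * h" for y h
      using linear_scale[OF has_derivative_linear[OF partial_deriv_has_derivative[OF test_functions_differentiable[OF \<phi>]]], of y h e]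
      by (simp add: \<psi>_def partial_deriv_def e_def)
    ultimately show ?thesis by (simp add: has_field_derivative_def)
  qed
  define d where "d n x = (\<phi> (t n *\<^sub>R e + x) - \<phi> x) / t n" for n x
  have \<phi>i: "integrable lborel \<phi>"
    by (rule integrable_continuous_compact_support(1)[OF test_functions_continuous[OF \<phi>] K(1,3)])
  have \<phi>m: "\<phi> \<in> borel_measurable borel" by (rule borel_measurable_continuous_onI[OF test_functions_continuous[OF \<phi>]])
  have d0: "integral\<^sup>L lborel (d n) = 0" for n
  proof -
    have "integrable (distr lborel borel ((+) (t n *\<^sub>R e))) \<phi>" using \<phi>i by (simp add: lborel_distr_plus)
    then have i: "integrable lborel (\<lambda>x. \<phi> (t n *\<^sub>R e + x))"
      using \<phi>m by (subst (asm) integrable_distr_eq) auto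
    have "integral\<^sup>L (distr lborel borel ((+) (t n *\<^sub>R e))) \<phi> = integral\<^sup>L lborel (\<lambda>x. \<phi> (t n *\<^sub>R e + x))"
      using \<phi>m by (intro integral_distr) auto
    then have "integral\<^sup>L lborel (\<lambda>x. \<phi> (t n *\<^sub>R e + x)) = integral\<^sup>L lborel \<phi>" by (simp add: lborel_distr_plus)
    then show ?thesis unfolding d_def using i \<phi>i by simp
  qed
  have "(\<lambda>n. integral\<^sup>L lborel (d n)) \<longlonglongrightarrow> integral\<^sup>L lborel \<psi>"
  \<comment> \<open>The mean value theorem bounds the difference quotients by \<open>M\<close>;
    since \<open>t n \<le> 1\<close>, they vanish outside the ball of radius
    \<open>R + 1\<close>.\<close>
  proof (rule integral_dominated_convergence[where w="\<lambda>x. indicator (cball 0 (R + 1)) x *\<^sub>R M"])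
    show "\<psi> \<in> borel_measurable lborel" using borel_measurable_continuous_onI[OF \<psi>c] by simp
    show "d n \<in> borel_measurable lborel" for n
    proof -
      have "(\<lambda>x. \<phi> (t n *\<^sub>R e + x)) \<in> borel_measurable borel"
        by (rule measurable_compose[OF _ \<phi>m]) simp
      then show ?thesis unfolding d_def using \<phi>m by simp
    qed
    show "integrable lborel (\<lambda>x::real^'n. indicator (cball 0 (R + 1)) x *\<^sub>R M)"
      by (rule borel_integrable_compact) auto
    show "AE x in lborel. (\<lambda>n. d n x) \<longlonglongrightarrow> \<psi> x"
    proof (rule AE_I2)
      fix x :: "real^'n"
      have "(\<lambda>h. (\<phi> ((0 + h) *\<^sub>R e + x) - \<phi> (0 *\<^sub>R e + x)) / h) \<midarrow>0\<rightarrow> \<psi> (0 *\<^sub>R e + x)"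
        using line[of x 0] unfolding DERIV_def .
      then have L: "((\<lambda>h. (\<phi> (h *\<^sub>R e + x) - \<phi> x) / h) \<longlongrightarrow> \<psi> x) (at 0)" by simp
      have "filterlim t (at 0) sequentially"
      proof (rule filterlim_atI[OF t0])
        have "t n \<noteq> 0" for n using t(1)[of n] by simp
        then show "\<forall>\<^sub>F n in sequentially. t n \<noteq> 0" by simp
      qed
      from filterlim_compose[OF L this]
      show "(\<lambda>n. d n x) \<longlonglongrightarrow> \<psi> x" by (simp add: d_def)
    qed
    show "AE x in lborel. norm (d n x) \<le> indicator (cball 0 (R + 1)) x *\<^sub>R M" for n
    proof (rule AE_I2)
      fix x :: "real^'n"
      show "norm (d n x) \<le> indicator (cball 0 (R + 1)) x *\<^sub>R M"
      proof (cases "x \<in> cball 0 (R + 1)")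
        case True
        obtain z where z: "\<phi> (t n *\<^sub>R e + x) - \<phi> (0 *\<^sub>R e + x) = (t n - 0) * \<psi> (z *\<^sub>R e + x)"
          using MVT2[OF t(1)[of n], of "\<lambda>r. \<phi> (r *\<^sub>R e + x)" "\<lambda>r. \<psi> (r *\<^sub>R e + x)"] line by blast
        then have "d n x = \<psi> (z *\<^sub>R e + x)" using t(1)[of n] by (simp add: d_def)
        then show ?thesis using True \<psi>M by simp
      next
        case False
        have "x \<notin> K" using False R[of x] by force
        moreover have "t n *\<^sub>R e + x \<notin> K"
        proof
          assume "t n *\<^sub>R e + x \<in> K"
          then have "norm (t n *\<^sub>R e + x) \<le> R" by (rule R)
          moreover have "norm x \<le> norm (t n *\<^sub>R e + x) + norm (t n *\<^sub>R e)"
            using norm_triangle_ineq4[of "t n *\<^sub>R e + x" "t n *\<^sub>R e"] by simp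
          moreover have "norm (t n *\<^sub>R e) \<le> 1" using t[of n] ne by simp
          ultimately show False using False by simp
        qed
        ultimately show ?thesis using K(3) False by (simp add: d_def)
      qed
    qed
  qed
  then have "integral\<^sup>L lborel \<psi> = 0" by (simp add: d0 LIMSEQ_const_iff)
  moreover have "integral\<^sup>L lebesgue \<psi> = integral\<^sup>L lborel \<psi>"
    using borel_measurable_continuous_onI[OF \<psi>c] by (intro integral_completion) simp
  ultimately show ?thesis by (simp add: \<psi>_def)
qed

text \<open>The product of two test functions is a test function, so each partial derivative of it
  integrates to 0; the Leibniz rule does the rest.\<close>

lemma test_function_integration_by_parts:
  assumes \<phi>: "\<phi> \<in> test_functions \<Omega>" and \<psi>: "\<psi> \<in> test_functions \<Omega>" and \<Omega>: "\<Omega> \<in> sets lebesgue"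
  shows "L2_inner \<Omega> \<phi> (partial_deriv i \<psi>) = - L2_inner \<Omega> (partial_deriv i \<phi>) \<psi>"
proof -
  have "(\<lambda>x. \<phi> x * \<psi> x) \<in> test_functions \<Omega>"
    by (rule test_functions_mult[OF \<psi> test_functions_C_k[OF \<phi>]])
  from integral_partial_deriv_eq_0[OF this, of i]
  have 0: "(LINT x|lebesgue. \<phi> x * partial_deriv i \<psi> x + partial_deriv i \<phi> x * \<psi> x) = 0"
    by (simp add: partial_deriv_mult[OF test_functions_differentiable[OF \<phi>] test_functions_differentiable[OF \<psi>]])
  have supp: "\<phi> x = 0" "\<psi> x = 0" if "x \<notin> \<Omega>" for x
    using that test_functionsE[OF \<phi>] test_functionsE[OF \<psi>] by (metis subsetD)+
  have eq: "(\<lambda>x. \<phi> x * partial_deriv i \<psi> x + partial_deriv i \<phi> x * \<psi> x) = (\<lambda>x. \<phi> x \<bullet> partial_deriv i \<psi> x + partial_deriv i \<phi> x \<bullet> \<psi> x)"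
    by simp
  have L: "L2_inner \<Omega> \<phi> (partial_deriv i \<psi>) + L2_inner \<Omega> (partial_deriv i \<phi>) \<psi> =
      (LINT x|lebesgue_on \<Omega>. \<phi> x * partial_deriv i \<psi> x + partial_deriv i \<phi> x * \<psi> x)"
    unfolding L2_inner_def eq
    by (rule Bochner_Integration.integral_add[symmetric];
        rule L2_inner_integrable; rule test_functions_L2[OF _ \<Omega>]; (rule test_functions_partial_deriv)?; fact)
  have "(LINT x|lebesgue_on \<Omega>. \<phi> x * partial_deriv i \<psi> x + partial_deriv i \<phi> x * \<psi> x)
     = (LINT x|lebesgue. indicator \<Omega> x *\<^sub>R (\<phi> x * partial_deriv i \<psi> x + partial_deriv i \<phi> x * \<psi> x))"
    using \<Omega> by (intro integral_restrict_space) auto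
  also have "(\<lambda>x. indicator \<Omega> x *\<^sub>R (\<phi> x * partial_deriv i \<psi> x + partial_deriv i \<phi> x * \<psi> x)) =
      (\<lambda>x. \<phi> x * partial_deriv i \<psi> x + partial_deriv i \<phi> x * \<psi> x)"
  proof
    fix x show "indicator \<Omega> x *\<^sub>R (\<phi> x * partial_deriv i \<psi> x + partial_deriv i \<phi> x * \<psi> x) =
        \<phi> x * partial_deriv i \<psi> x + partial_deriv i \<phi> x * \<psi> x"
      by (cases "x \<in> \<Omega>") (simp_all add: supp)
  qed
  finally show ?thesis using L 0 by simp
qed

text \<open>Each factor is a one-sided smooth cutoff at a face of the box. The scaling sharpens it,
  since \<open>exp (- 1 / (n * r))\<close> tends to 1 for every \<open>r > 0\<close>, while the bump
  stays 0 outside the open box.\<close>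

definition box_bump :: "real^'n::finite \<Rightarrow> real^'n \<Rightarrow> nat \<Rightarrow> real^'n \<Rightarrow> real" where
  "box_bump a b n x = (\<Prod>j\<in>UNIV. flat 1 (real (Suc n) * (x $ j - a $ j)) * flat 1 (real (Suc n) * (b $ j - x $ j)))"

lemma flat_1: "flat 1 t = (if 0 < t then exp (- (1 / t)) else 0)" by (simp add: flat_def)

lemma flat_1_bounds: "0 \<le> flat 1 t" "flat 1 t \<le> 1" by (auto simp: flat_1)

lemma box_bump_test_function:
  fixes a b :: "real^'n::finite"
  assumes "cbox a b \<subseteq> \<Omega>" shows "box_bump a b n \<in> test_functions \<Omega>"
proof (rule test_functionsI[OF _ compact_cbox assms])
  fix k
  have "C_k k (\<lambda>x::real^'n. flat 1 (real (Suc n) * x $ j + - (real (Suc n) * a $ j)) * flat 1 (- real (Suc n) * x $ j + real (Suc n) * b $ j))" for j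
    by (intro C_k_mult C_k_flat)
  then have "C_k k (\<lambda>x::real^'n. flat 1 (real (Suc n) * (x $ j - a $ j)) * flat 1 (real (Suc n) * (b $ j - x $ j)))" for j
    by (simp only: right_diff_distrib mult_minus_left add_uminus_conv_diff) (simp add: algebra_simps)
  then show "C_k k (box_bump a b n)" unfolding box_bump_def by (intro C_k_prod) auto
next
  fix x assume "x \<notin> cbox a b"
  then obtain j where "\<not> (a $ j \<le> x $ j \<and> x $ j \<le> b $ j)" by (auto simp: mem_box_cart)
  then have "flat 1 (real (Suc n) * (x $ j - a $ j)) * flat 1 (real (Suc n) * (b $ j - x $ j)) = 0"
    by (auto simp: flat_1 zero_less_mult_iff)
  then show "box_bump a b n x = 0" unfolding box_bump_def by (intro prod_zero) auto
qed

lemma box_bump_bounds: "0 \<le> box_bump a b n x" "box_bump a b n x \<le> 1"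
  unfolding box_bump_def by (auto intro!: prod_nonneg prod_le_1 mult_le_one simp: flat_1_bounds)

lemma box_bump_tendsto:
  fixes a b :: "real^'n::finite"
  shows "(\<lambda>n. box_bump a b n x) \<longlonglongrightarrow> indicator (box a b) x"
proof (cases "x \<in> box a b")
  case True
  have f: "(\<lambda>n. flat 1 (real (Suc n) * r)) \<longlonglongrightarrow> 1" if r: "r > 0" for r
  proof -
    have "(\<lambda>n. exp (- (inverse r * inverse (real (Suc n))))) \<longlonglongrightarrow> exp (- (inverse r * 0))"
      by (intro tendsto_intros LIMSEQ_inverse_real_of_nat)
    moreover have "flat 1 (real (Suc n) * r) = exp (- (inverse r * inverse (real (Suc n))))" for n
      using r by (simp add: flat_1 divide_inverse mult.commute)
    ultimately show ?thesis by simp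
  qed
  have "(\<lambda>n. box_bump a b n x) \<longlonglongrightarrow> (\<Prod>j\<in>(UNIV::'n set). 1 * 1)"
    unfolding box_bump_def using True by (intro tendsto_prod tendsto_mult f) (auto simp: mem_box_cart)
  then show ?thesis using True by simp
next
  case False
  then obtain j where j: "\<not> (a $ j < x $ j \<and> x $ j < b $ j)" by (auto simp: mem_box_cart)
  have "box_bump a b n x = 0" for n
  proof -
    have "flat 1 (real (Suc n) * (x $ j - a $ j)) * flat 1 (real (Suc n) * (b $ j - x $ j)) = 0"
      using j by (auto simp: flat_1 zero_less_mult_iff)
    then show ?thesis unfolding box_bump_def by (intro prod_zero) auto
  qed
  then show ?thesis using False by simp
qed

text \<open>The bumps converge to indicators of boxes, and boxes generate the Borel sets.\<close>

lemma AE_zero_if_orthogonal_to_test_functions: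
  fixes g :: "real^'n::finite \<Rightarrow> real"
  assumes \<Omega>: "open \<Omega>" and g: "g \<in> L2 \<Omega>"
    and orth: "\<And>\<phi>. \<phi> \<in> test_functions \<Omega> \<Longrightarrow> L2_inner \<Omega> g \<phi> = 0"
  shows "AE x in lebesgue_on \<Omega>. g x = 0"
proof -
  have \<Omega>m: "\<Omega> \<in> sets lebesgue" using \<Omega> by simp
  have indL2: "(\<lambda>x. indicator (box a b) x) \<in> (L2 \<Omega> :: (real^'n \<Rightarrow> real) set)" for a b
  proof (rule L2I)
    show "(\<lambda>x. indicat_real (box a b) x) \<in> borel_measurable (lebesgue_on \<Omega>)"
      by (rule measurable_restrict_space1) (simp add: borel_measurable_indicator)
    have "integrable lebesgue (indicat_real (\<Omega> \<inter> box a b))"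
    proof (rule integrable_real_indicator)
      show "\<Omega> \<inter> box a b \<in> sets lebesgue" using \<Omega>m by (intro sets.Int) auto
      have "emeasure lebesgue (\<Omega> \<inter> box a b) \<le> emeasure lebesgue (box a b)" by (rule emeasure_mono) auto
      also have "\<dots> < \<infinity>" by (simp add: emeasure_lborel_box_eq)
      finally show "emeasure lebesgue (\<Omega> \<inter> box a b) < \<infinity>" .
    qed
    moreover have "(\<lambda>x. indicat_real \<Omega> x *\<^sub>R (norm (indicat_real (box a b) x))\<^sup>2) = indicat_real (\<Omega> \<inter> box a b)"
      by (auto simp: indicator_def)
    ultimately show "integrable (lebesgue_on \<Omega>) (\<lambda>x. (norm (indicat_real (box a b) x))\<^sup>2)"
      using integrable_restrict_space[of \<Omega> lebesgue "\<lambda>x. (norm (indicat_real (box a b) x))\<^sup>2"] \<Omega>m by auto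
  qed
  have box0: "L2_inner \<Omega> g (indicator (box a b)) = 0" if ab: "cbox a b \<subseteq> \<Omega>" for a b
  proof -
    have t: "box_bump a b n \<in> test_functions \<Omega>" for n by (rule box_bump_test_function[OF ab])
    have "(\<lambda>n. L2_inner \<Omega> g (box_bump a b n)) \<longlonglongrightarrow> L2_inner \<Omega> g (indicator (box a b))"
      unfolding L2_inner_def
    \<comment> \<open>The bumps vanish off the open box and are at most 1 on it, so \<open>g\<close>
      times the indicator dominates.\<close>
    proof (rule integral_dominated_convergence[where w="\<lambda>x. norm (g x \<bullet> indicator (box a b) x)"])
      show "(\<lambda>x. g x \<bullet> indicat_real (box a b) x) \<in> borel_measurable (lebesgue_on \<Omega>)"
        by (intro borel_measurable_inner L2D(1) g indL2)
      show "(\<lambda>x. g x \<bullet> box_bump a b n x) \<in> borel_measurable (lebesgue_on \<Omega>)" for n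
        by (intro borel_measurable_inner L2D(1) g test_functions_L2[OF t \<Omega>m])
      show "integrable (lebesgue_on \<Omega>) (\<lambda>x. norm (g x \<bullet> indicator (box a b) x))"
        by (intro integrable_norm L2_inner_integrable g indL2)
      show "AE x in lebesgue_on \<Omega>. (\<lambda>n. g x \<bullet> box_bump a b n x) \<longlonglongrightarrow> g x \<bullet> indicator (box a b) x"
        by (intro AE_I2 tendsto_inner tendsto_const box_bump_tendsto)
      show "AE x in lebesgue_on \<Omega>. norm (g x \<bullet> box_bump a b n x) \<le> norm (g x \<bullet> indicator (box a b) x)" for n
      proof (rule AE_I2)
        fix x
        show "norm (g x \<bullet> box_bump a b n x) \<le> norm (g x \<bullet> indicator (box a b) x)"
        proof (cases "x \<in> box a b")
          case True
          then show ?thesis using box_bump_bounds[of a b n x]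
            by (simp add: abs_mult mult_left_le)
        next
          case False
          then obtain j where j: "\<not> (a $ j < x $ j \<and> x $ j < b $ j)" by (auto simp: mem_box_cart)
          have "flat 1 (real (Suc n) * (x $ j - a $ j)) * flat 1 (real (Suc n) * (b $ j - x $ j)) = 0"
            using j by (auto simp: flat_1 zero_less_mult_iff)
          then have "box_bump a b n x = 0" unfolding box_bump_def by (intro prod_zero) auto
          then show ?thesis by simp
        qed
      qed
    qed
    then have "(\<lambda>n. 0) \<longlonglongrightarrow> L2_inner \<Omega> g (indicator (box a b))" using orth[OF t] by simp
    then show ?thesis by (simp add: LIMSEQ_const_iff)
  qed
  have onbox: "AE x in lebesgue. x \<in> box a b \<longrightarrow> g x = 0" if ab: "cbox a b \<subseteq> \<Omega>" for a b
  proof -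
    have boxO: "box a b \<subseteq> \<Omega>" using ab box_subset_cbox by blast
    define f where "f x = indicator (box a b) x * g x" for x
    have "\<Omega> \<inter> space lebesgue \<in> sets lebesgue" using \<Omega>m by simp
    from iffD1[OF integrable_restrict_space[OF this] L2_inner_integrable[OF g indL2]]
    have "integrable lebesgue (\<lambda>x. indicator \<Omega> x *\<^sub>R (g x \<bullet> indicator (box a b) x))" .
    moreover have "(\<lambda>x. indicator \<Omega> x *\<^sub>R (g x \<bullet> indicator (box a b) x)) = f"
    proof
      fix x show "indicator \<Omega> x *\<^sub>R (g x \<bullet> indicator (box a b) x) = f x"
        using boxO by (cases "x \<in> box a b") (auto simp: f_def)
    qed
    ultimately have fi: "integrable lebesgue f" by simp
    \<comment> \<open>The generator argument runs over Borel sets, so the Lebesgue measurable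
      \<open>f\<close> is replaced by a Borel function equal to it almost everywhere.\<close>
    obtain f' where f': "f' \<in> borel_measurable lborel" and ff': "AE x in lborel. f x = f' x"
      using completion_ex_borel_measurable_real[OF borel_measurable_integrable[OF fi]] by auto
    have ff'': "AE x in lebesgue. f x = f' x" by (rule AE_completion[OF ff'])
    have f'm: "f' \<in> borel_measurable lebesgue" using f' by (rule measurable_completion)
    have "integrable lebesgue f'"
      using integrable_cong_AE[OF borel_measurable_integrable[OF fi] f'm ff''] fi by simp
    then have f'i: "integrable lborel f'" using f' by (simp add: integrable_completion)
    have inti: "set_integrable lborel A f'" if "A \<in> sets borel" for A
      unfolding set_integrable_def using that f'i by (intro integrable_mult_indicator) auto
    have boxes: "(LINT x:box c d|lborel. f' x) = 0" for c d
    proof -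
      \<comment> \<open>Cutting an arbitrary box down to \<open>box a b\<close> gives again a box
        whose closed version lies in \<open>\<Omega>\<close>, so \<open>box0\<close>
        applies.\<close>
      obtain p q where pq: "box a b \<inter> box c d = box p q" "cbox p q \<subseteq> cbox a b"
        by (rule that[OF box_Int_box]) (simp add: Int_interval[symmetric])
      have "(LINT x:box c d|lborel. f' x) = (LINT x|lebesgue. indicator (box c d) x *\<^sub>R f' x)"
        unfolding set_lebesgue_integral_def using f'
        by (intro integral_completion[symmetric]) simp
      also have "\<dots> = (LINT x|lebesgue. indicator (box c d) x *\<^sub>R f x)"
      proof (rule integral_cong_AE)
        have "box c d \<in> sets lebesgue" by simp
        note ind = borel_measurable_indicator[OF this, where 'b=real]
        show "(\<lambda>x. indicat_real (box c d) x *\<^sub>R f' x) \<in> borel_measurable lebesgue"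
          by (rule borel_measurable_scaleR[OF ind f'm])
        show "(\<lambda>x. indicat_real (box c d) x *\<^sub>R f x) \<in> borel_measurable lebesgue"
          by (rule borel_measurable_scaleR[OF ind borel_measurable_integrable[OF fi]])
        show "AE x in lebesgue. indicator (box c d) x *\<^sub>R f' x = indicat_real (box c d) x *\<^sub>R f x"
          using ff'' by eventually_elim simp
      qed
      also have "(\<lambda>x. indicat_real (box c d) x *\<^sub>R f x) = (\<lambda>x. g x \<bullet> indicator (box p q) x)"
        unfolding f_def pq(1)[symmetric] by (auto simp: indicator_def)
      also have "(LINT x|lebesgue. g x \<bullet> indicator (box p q) x) = L2_inner \<Omega> g (indicator (box p q))"
      proof (rule L2_inner_eq_integral_lebesgue[symmetric, OF \<Omega>m])
        fix x assume "x \<notin> \<Omega>"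
        then have "x \<notin> box p q" using pq(2) box_subset_cbox[of p q] ab by blast
        then show "g x \<bullet> indicat_real (box p q) x = 0" by simp
      qed
      also have "\<dots> = 0" using pq(2) ab by (intro box0) auto
      finally show ?thesis .
    qed
    have borel_sets: "sets (borel :: (real^'n) measure) = sigma_sets UNIV (range (\<lambda>(a, b). box a b))"
      by (subst borel_eq_box) simp
    have all: "(LINT x:A|lborel. f' x) = 0" if "A \<in> sets borel" for A
    proof -
      have st: "Int_stable (range (\<lambda>(a, b). box a b :: (real^'n) set))" by (auto simp: Int_stable_def box_Int_box)
      have UN: "(UNIV :: (real^'n) set) = (\<Union>n::nat. box (- (real n *\<^sub>R One)) (real n *\<^sub>R One))"
        by (rule UN_box_eq_UNIV[symmetric])
      have univ: "(LINT x:UNIV|lborel. f' x) = 0"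
      proof -
        have inc: "incseq (\<lambda>n::nat. box (- (real n *\<^sub>R One)) (real n *\<^sub>R One) :: (real^'n) set)"
          unfolding incseq_def by (auto simp: mem_box) (smt (verit) of_nat_mono)+
        have "(\<lambda>n::nat. LINT x:box (- (real n *\<^sub>R One)) (real n *\<^sub>R One)|lborel. f' x) \<longlonglongrightarrow>
            (LINT x:(\<Union>n::nat. box (- (real n *\<^sub>R One)) (real n *\<^sub>R One))|lborel. f' x)"
          using UN inti[of UNIV] inc by (intro set_integral_cont_up) auto
        then have "(\<lambda>n::nat. 0) \<longlonglongrightarrow> (LINT x:UNIV|lborel. f' x)" unfolding boxes UN[symmetric] .
        then show ?thesis by (simp add: LIMSEQ_const_iff)
      qed
      have G: "range (\<lambda>(a, b). box a b :: (real^'n) set) \<subseteq> Pow UNIV" by simp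
      have "A \<in> sigma_sets UNIV (range (\<lambda>(a, b). box a b))" using that borel_sets by simp
      from st G this show ?thesis
      proof (induct rule: sigma_sets_induct_disjoint)
        case (compl A)
        then have "A \<in> sets borel" using borel_sets by simp
        then have "(LINT x:UNIV|lborel. f' x) = (LINT x:A|lborel. f' x) + (LINT x:UNIV - A|lborel. f' x)"
          using set_integral_Un[of A "UNIV - A" lborel f'] inti by (simp add: Un_absorb1)
        then show ?case using compl univ by simp
      next
        case (union A)
        then have "A n \<in> sets borel" for n using borel_sets by auto
        then have "(LINT x:(\<Union>i. A i)|lborel. f' x) = (\<Sum>i. (LINT x:A i|lborel. f' x))"
          using union(1) inti by (intro lebesgue_integral_countable_add) (auto simp: disjoint_family_on_def)
        then show ?case using union by simp
      qed (use boxes in \<open>auto simp: set_lebesgue_integral_def[of _ "{}"]\<close>)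
    qed
    have "AE x in lborel. f' x = 0" by (rule sigma_finite_measure.density_zero[OF sigma_finite_lborel f'i]) (use all in simp)
    then have "AE x in lebesgue. f' x = 0" by (rule AE_completion)
    then show ?thesis using ff''
    proof eventually_elim
      case (elim x) then show ?case by (auto simp: f_def)
    qed
  qed
  \<comment> \<open>An open set is a countable union of closed boxes, and passing from open to
    closed boxes costs only their null boundaries.\<close>
  obtain D where D: "countable D" "D \<subseteq> Pow \<Omega>" "\<And>X. X \<in> D \<Longrightarrow> \<exists>a b. X = cbox a b" "\<Union>D = \<Omega>"
    using open_countable_Union_open_cbox[OF \<Omega>] by metis
  have "AE x in lebesgue. x \<in> X \<longrightarrow> g x = 0" if X: "X \<in> D" for X
  proof -
    obtain a b where ab: "X = cbox a b" using D(3)[OF X] by blast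
    have "cbox a b - box a b \<in> null_sets lebesgue"
      using negligible_frontier_interval[of a b] by (simp add: negligible_iff_null_sets)
    then have "AE x in lebesgue. x \<notin> cbox a b - box a b" by (rule AE_not_in)
    moreover have "AE x in lebesgue. x \<in> box a b \<longrightarrow> g x = 0" using D(2) X ab by (intro onbox) auto
    ultimately show ?thesis by eventually_elim (auto simp: ab)
  qed
  then have "AE x in lebesgue. \<forall>X\<in>D. x \<in> X \<longrightarrow> g x = 0" by (subst AE_ball_countable[OF D(1)]) blast
  then have "AE x in lebesgue. x \<in> \<Omega> \<longrightarrow> g x = 0" by eventually_elim (use D(4) in blast)
  then show ?thesis using AE_restrict_space_iff[of \<Omega> lebesgue "\<lambda>x. g x = 0"] \<Omega>m by simp
qed

section \<open>The least-squares operator in abstract form\<close>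

text \<open>
  In the application \<open>G\<close> is the graph of the gradient on \<open>H10\<close>, and \<open>D\<close> below is the graph of the
  divergence, as minus the adjoint of \<open>G\<close>.
\<close>

lemma closed_subspace_image:
  fixes f :: "'a::{real_inner,complete_space} \<Rightarrow> 'b::{real_inner,complete_space}"
  assumes V: "closed_subspace V" and f: "bounded_linear f"
    and below: "\<And>x. x \<in> V \<Longrightarrow> norm x \<le> C * norm (f x)"
  shows "closed_subspace (f ` V)"
proof
  interpret V: closed_subspace V by (rule V)
  interpret f: bounded_linear f by (rule f)
  show "subspace (f ` V)" using V.sub f.linear_axioms by (simp add: linear_subspace_image)
  show "closed (f ` V)"
    unfolding closed_sequential_limits
  proof (intro allI impI)
    fix y l assume y: "(\<forall>n. y n \<in> f ` V) \<and> y \<longlonglongrightarrow> l"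
    then have "\<forall>n. \<exists>x\<in>V. y n = f x" by blast
    then obtain x where x: "\<And>n. x n \<in> V" "\<And>n. y n = f (x n)" by metis
    \<comment> \<open>The lower bound \<open>below\<close> turns convergence of the images into the
      Cauchy property of the preimages.\<close>
    have "Cauchy x"
    proof (rule metric_CauchyI)
      fix e :: real assume e: "e > 0"
      define B where "B = \<bar>C\<bar> + 1"
      have B: "B > 0" by (simp add: B_def)
      obtain M where M: "\<And>m n. m \<ge> M \<Longrightarrow> n \<ge> M \<Longrightarrow> norm (y m - y n) < e / B"
        using CauchyD[OF LIMSEQ_imp_Cauchy, of y l "e / B"] y e B by auto
      have "dist (x m) (x n) < e" if mn: "m \<ge> M" "n \<ge> M" for m n
      proof -
        have "norm (x m - x n) \<le> C * norm (f (x m - x n))"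
          using x(1) V.sub by (intro below) (simp add: subspace_diff)
        also have "\<dots> = C * norm (y m - y n)" by (simp add: f.diff x(2))
        also have "\<dots> \<le> B * norm (y m - y n)" unfolding B_def by (intro mult_right_mono) auto
        also have "\<dots> < B * (e / B)" using M[OF mn] B by (intro mult_strict_left_mono)
        finally show ?thesis using B by (simp add: dist_norm)
      qed
      then show "\<exists>M. \<forall>m\<ge>M. \<forall>n\<ge>M. dist (x m) (x n) < e" by blast
    qed
    then obtain z where z: "x \<longlonglongrightarrow> z" using Cauchy_convergent convergent_def by blast
    have "z \<in> V" using closed_sequentially[OF V.clo _ z] x(1) by blast
    moreover have "y \<longlonglongrightarrow> f z" using f.tendsto[OF z] unfolding x(2)[symmetric] .
    then have "l = f z" using y LIMSEQ_unique by blast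
    ultimately show "l \<in> f ` V" by blast
  qed
qed

lemma closed_subspace_Times:
  assumes "closed_subspace A" "closed_subspace B"
  shows "closed_subspace (A \<times> B)"
proof
  interpret A: closed_subspace A by (rule assms)
  interpret B: closed_subspace B by (rule assms)
  show "closed (A \<times> B)" by (intro closed_Times A.clo B.clo)
  show "subspace (A \<times> B)" by (intro subspace_Times A.sub B.sub)
qed

lemma inner_fst_snd: "x \<bullet> y = fst x \<bullet> fst y + snd x \<bullet> snd y"
  by (simp add: inner_prod_def)

section \<open>The abstract problem and its symmetric reformulation\<close>

locale fosls =
  fixes Ls :: "'l::{real_inner,complete_space} set"
    and Vs :: "'v::{real_inner,complete_space} set"
    and G :: "('l \<times> 'v) set" and cP :: real
  assumes Ls: "closed_subspace Ls" and Vs: "closed_subspace Vs" and G: "closed_subspace G"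
    and GLV: "G \<subseteq> Ls \<times> Vs"
    and poincare: "y \<in> G \<Longrightarrow> norm (fst y) \<le> cP * norm (snd y)"
begin

definition D :: "('v \<times> 'l) set" where
  "D = {x. fst x \<in> Vs \<and> snd x \<in> Ls \<and> (\<forall>y\<in>G. snd y \<bullet> fst x + fst y \<bullet> snd x = 0)}"

lemma D_green: "x \<in> D \<Longrightarrow> y \<in> G \<Longrightarrow> snd y \<bullet> fst x = - (fst y \<bullet> snd x)"
  unfolding D_def by (auto simp: add_eq_0_iff)

lemma closed_subspace_D: "closed_subspace D"
proof -
  interpret L: closed_subspace Ls by (rule Ls)
  interpret V: closed_subspace Vs by (rule Vs)
  have D: "D = (Vs \<times> Ls) \<inter> {x. \<forall>w\<in>(\<lambda>y. (snd y, fst y)) ` G. x \<bullet> w = 0}"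
    by (auto simp: D_def inner_fst_snd inner_commute)
  have 1: "closed_subspace (Vs \<times> Ls)" by (rule closed_subspace_Times[OF Vs Ls])
  have 2: "closed_subspace {x::'v\<times>'l. \<forall>w\<in>(\<lambda>y. (snd y, fst y)) ` G. x \<bullet> w = 0}"
    by (rule closed_subspace_orthogonal_complement)
  show ?thesis unfolding D
  proof
    show "subspace ((Vs \<times> Ls) \<inter> {x. \<forall>w\<in>(\<lambda>y. (snd y, fst y)) ` G. x \<bullet> w = 0})"
      by (intro subspace_inter closed_subspace.sub[OF 1] closed_subspace.sub[OF 2])
    show "closed ((Vs \<times> Ls) \<inter> {x. \<forall>w\<in>(\<lambda>y. (snd y, fst y)) ` G. x \<bullet> w = 0})"
      by (intro closed_Int closed_subspace.clo[OF 1] closed_subspace.clo[OF 2])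
  qed
qed

text \<open>A closed \<open>G\<close> is its own double adjoint: the component of
  \<open>(e, q)\<close> orthogonal to \<open>G\<close>, with its entries swapped, lies in
  \<open>D\<close>, and \<open>orth\<close> then makes it orthogonal to \<open>(e, q)\<close>, hence
  zero.\<close>

lemma double_adjoint:
  assumes "e \<in> Ls" "q \<in> Vs" and orth: "\<And>x. x \<in> D \<Longrightarrow> q \<bullet> fst x + e \<bullet> snd x = 0"
  shows "(e, q) \<in> G"
proof -
  interpret G: closed_subspace G by (rule G)
  interpret L: closed_subspace Ls by (rule Ls)
  interpret V: closed_subspace Vs by (rule Vs)
  define p where "p = proj G (e, q)"
  define r where "r = (e, q) - p"
  have pG: "p \<in> G" by (simp add: p_def)
  have r0: "r \<bullet> y = 0" if "y \<in> G" for y unfolding r_def p_def by (rule G.proj_orth[OF that])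
  have "fst r \<in> Ls" "snd r \<in> Vs" unfolding r_def
    using pG GLV assms(1,2) L.sub V.sub by (auto simp: subspace_diff mem_Times_iff)
  then have "(snd r, fst r) \<in> D"
    using r0 by (auto simp: D_def inner_fst_snd inner_commute add.commute)
  then have "(e, q) \<bullet> r = 0" using orth[of "(snd r, fst r)"] by (simp add: inner_fst_snd)
  moreover have "p \<bullet> r = 0" using r0[OF pG] by (simp add: inner_commute)
  ultimately have "r \<bullet> r = 0" by (simp add: r_def inner_diff)
  then show ?thesis using pG by (simp add: r_def)
qed

text \<open>The gradients, placed in the space of pairs of a flux and its divergence. With 0 as
  second entry, the inner product with such a pair sees only the L2 product of gradient and
  flux.\<close>

definition K :: "('l \<times> 'v) set \<Rightarrow> ('v \<times> 'l) set" where
  "K Gh = (\<lambda>y. (snd y, 0)) ` Gh"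

text \<open>Here \<open>x\<close> stands for a flux with its divergence and \<open>y\<close> for
  \<open>u\<close> with its gradient, so \<open>x \<bullet> z\<close> collects the flux and the
  divergence term of the first equation.\<close>

definition sol :: "('v \<times> 'l) set \<Rightarrow> ('l \<times> 'v) set \<Rightarrow> 'l \<Rightarrow> 'v \<times> 'l \<Rightarrow> 'l \<times> 'v \<Rightarrow> bool" where
  "sol Dh Gh f x y \<longleftrightarrow> x \<in> Dh \<and> y \<in> Gh \<and>
     (\<forall>z\<in>Dh. x \<bullet> z - snd y \<bullet> fst z = - (f \<bullet> snd z)) \<and>
     (\<forall>w\<in>Gh. snd y \<bullet> snd w = fst x \<bullet> snd w)"

definition S :: "('v \<times> 'l) set \<Rightarrow> ('l \<times> 'v) set \<Rightarrow> 'v \<times> 'l \<Rightarrow> 'v \<times> 'l" where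
  "S Dh Gh x = proj Dh (proj (K Gh) (proj Dh x))"

lemma norm_pair_le: "norm x \<le> norm (fst x) + norm (snd x)"
  using norm_Pair_le[of "fst x" "snd x"] by simp

text \<open>By the Poincare inequality the gradient controls the function, so dropping the function
  component is a map bounded below on \<open>G\<close>, and its image stays closed.\<close>

lemma closed_subspace_K:
  assumes "closed_subspace Gh" "Gh \<subseteq> G"
  shows "closed_subspace (K Gh)"
  unfolding K_def
proof (rule closed_subspace_image[OF assms(1), where C="\<bar>cP\<bar> + 1"])
  show "bounded_linear (\<lambda>y::'l\<times>'v. (snd y, 0::'l))"
    by (intro bounded_linear_Pair bounded_linear_snd bounded_linear_zero)
  fix y assume "y \<in> Gh"
  then have "norm (fst y) \<le> cP * norm (snd y)" using assms(2) poincare by blast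
  also have "\<dots> \<le> \<bar>cP\<bar> * norm (snd y)" by (intro mult_right_mono) auto
  finally show "norm y \<le> (\<bar>cP\<bar> + 1) * norm (snd y, 0::'l)"
    using norm_pair_le[of y] by (simp add: norm_Pair algebra_simps)
qed

text \<open>The least-squares residual map, taking a flux \<sigma> and \<open>u\<close> to
  \<open>(\<sigma> - \<nabla>u, div \<sigma>)\<close>. The equations of \<open>sol\<close> are the
  normal equations for approximating \<open>(0, - f)\<close> by its values.\<close>

definition LS :: "('v \<times> 'l) \<times> ('l \<times> 'v) \<Rightarrow> 'v \<times> 'l" where
  "LS z = (fst (fst z) - snd (snd z), snd (fst z))"

lemma bounded_linear_LS: "bounded_linear LS"
  unfolding LS_def
  by (intro bounded_linear_Pair bounded_linear_sub bounded_linear_compose[OF bounded_linear_fst]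
      bounded_linear_compose[OF bounded_linear_snd] bounded_linear_fst bounded_linear_snd)

lemma norm_fst_snd_le: "norm (fst x) \<le> norm x" "norm (snd x) \<le> norm x"
  using norm_fst_le[of "fst x" "snd x"] norm_snd_le[of "snd x" "fst x"] by simp_all

lemma coercive:
  assumes x: "x \<in> D" and y: "y \<in> G"
  shows "norm (x, y) \<le> (5 + 5 * \<bar>cP\<bar> + \<bar>cP\<bar> * \<bar>cP\<bar>) * norm (LS (x, y))"
proof -
  define N c where "N = norm (LS (x, y))" and "c = \<bar>cP\<bar>"
  have N: "norm (fst x - snd y) \<le> N" "norm (snd x) \<le> N"
    unfolding N_def using norm_fst_snd_le[of "LS (x, y)"] by (auto simp: LS_def)
  have N0: "0 \<le> N" and c0: "0 \<le> c" by (auto simp: N_def c_def)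
  have pc: "norm (fst y) \<le> c * norm (snd y)"
    by (rule order_trans[OF poincare[OF y]]) (auto simp: c_def intro: mult_right_mono)
  have g: "norm (snd y) \<le> (c + 1) * N"
  proof (cases "snd y = 0")
    case False
    \<comment> \<open>Green's formula replaces the product of flux and gradient by one of
      \<open>u\<close> and the divergence, so the gradient is controlled by the two entries of
      \<open>LS\<close> alone once Poincare has handled \<open>u\<close>.\<close>
    have "snd y \<bullet> snd y = - (fst y \<bullet> snd x) - (fst x - snd y) \<bullet> snd y"
      using D_green[OF x y] by (simp add: inner_diff inner_commute)
    also have "\<dots> \<le> norm (fst y) * norm (snd x) + norm (fst x - snd y) * norm (snd y)"
      using Cauchy_Schwarz_ineq2[of "fst y" "snd x"] Cauchy_Schwarz_ineq2[of "fst x - snd y" "snd y"] by linarith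
    also have "\<dots> \<le> (c * norm (snd y)) * N + N * norm (snd y)"
      using pc N N0 c0 by (intro add_mono mult_mono) auto
    finally have "norm (snd y) * norm (snd y) \<le> ((c + 1) * N) * norm (snd y)"
      by (simp add: dot_square_norm power2_eq_square algebra_simps)
    then show ?thesis using False by simp
  qed (use N0 c0 in simp)
  have "norm (fst x) \<le> norm (fst x - snd y) + norm (snd y)"
    using norm_triangle_ineq[of "fst x - snd y" "snd y"] by simp
  then have fx: "norm (fst x) \<le> (c + 2) * N" using N(1) g by (simp add: algebra_simps)
  have fy: "norm (fst y) \<le> (c * (c + 1)) * N"
    using pc mult_left_mono[OF g c0] by (simp add: mult.assoc)
  have "norm (x, y) \<le> norm x + norm y" by (rule norm_Pair_le)
  also have "\<dots> \<le> (norm (fst x) + norm (snd x)) + (norm (fst y) + norm (snd y))"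
    by (intro add_mono norm_pair_le)
  also have "\<dots> \<le> ((c + 2) * N + N) + ((c * (c + 1)) * N + (c + 1) * N)"
    using fx fy g N(2) by (intro add_mono)
  also have "\<dots> = (4 + 3 * c + c * c) * N" by (simp add: algebra_simps)
  also have "\<dots> \<le> (5 + 5 * c + c * c) * N" using N0 c0 by (intro mult_right_mono) auto
  finally show ?thesis by (simp add: N_def c_def)
qed

end

locale fosls_pair = fosls +
  fixes Dh Gh
  assumes Dh: "closed_subspace Dh" "Dh \<subseteq> D" and Gh: "closed_subspace Gh" "Gh \<subseteq> G"
begin

sublocale Dh: closed_subspace Dh by (rule Dh)
sublocale Gh: closed_subspace Gh by (rule Gh)
sublocale Kh: closed_subspace "K Gh" by (rule closed_subspace_K[OF Gh])

text \<open>Coercivity makes the range of \<open>LS\<close> closed, so \<open>(0, - f)\<close> has a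
  projection onto it. Testing with pairs that have one entry 0 separates the two equations.\<close>

lemma sol_exists: "\<exists>x y. sol Dh Gh f x y"
proof -
  interpret R: closed_subspace "LS ` (Dh \<times> Gh)"
  proof (rule closed_subspace_image[OF closed_subspace_Times[OF Dh(1) Gh(1)] bounded_linear_LS])
    fix z assume "z \<in> Dh \<times> Gh"
    then show "norm z \<le> (5 + 5 * \<bar>cP\<bar> + \<bar>cP\<bar> * \<bar>cP\<bar>) * norm (LS z)"
      using coercive[of "fst z" "snd z"] Dh(2) Gh(2) by (auto simp: mem_Times_iff)
  qed
  obtain z where z: "z \<in> Dh \<times> Gh" "proj (LS ` (Dh \<times> Gh)) (0, - f) = LS z"
    using R.proj_in[of "(0, - f)"] by blast
  define x y where "x = fst z" and "y = snd z"
  have xy: "x \<in> Dh" "y \<in> Gh" "proj (LS ` (Dh \<times> Gh)) (0, - f) = LS (x, y)"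
    using z by (auto simp: x_def y_def mem_Times_iff)
  have o: "LS (x, y) \<bullet> LS (z, w) = (0, - f) \<bullet> LS (z, w)" if "z \<in> Dh" "w \<in> Gh" for z w
    using R.proj_inner[of "LS (z, w)" "(0, - f)"] that xy(3) by auto
  have "x \<bullet> z - snd y \<bullet> fst z = - (f \<bullet> snd z)" if "z \<in> Dh" for z
    using o[OF that subspace_0[OF Gh.sub]] by (simp add: LS_def inner_fst_snd inner_diff)
  moreover have "snd y \<bullet> snd w = fst x \<bullet> snd w" if "w \<in> Gh" for w
    using o[OF subspace_0[OF Dh.sub] that] by (simp add: LS_def inner_diff)
  ultimately show ?thesis using xy(1,2) unfolding sol_def by blast
qed

lemma sol_unique:
  assumes "sol Dh Gh f x y" "sol Dh Gh f x' y'"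
  shows "x = x'" "y = y'"
proof -
  define a b where "a = x - x'" and "b = y - y'"
  have a: "a \<in> Dh" and b: "b \<in> Gh"
    using assms Dh.sub Gh.sub by (auto simp: sol_def a_def b_def subspace_diff)
  have "x \<bullet> a - snd y \<bullet> fst a = x' \<bullet> a - snd y' \<bullet> fst a" using assms a by (simp add: sol_def)
  then have 1: "a \<bullet> a - snd b \<bullet> fst a = 0"
    by (simp add: a_def[of] b_def inner_diff_left)
  have "snd y \<bullet> snd b - snd y' \<bullet> snd b = fst x \<bullet> snd b - fst x' \<bullet> snd b" using assms b by (simp add: sol_def)
  then have 2: "snd b \<bullet> snd b = fst a \<bullet> snd b" by (simp add: a_def b_def inner_diff_left)
  have "LS (a, b) \<bullet> LS (a, b) = 0"
    using 1 2 by (simp add: LS_def inner_fst_snd inner_diff inner_commute)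
  then have "norm (a, b) \<le> 0" using coercive[of a b] a b Dh(2) Gh(2) by auto
  then have "(a, b) = 0" by simp
  then have "fst (a, b) = 0" "snd (a, b) = 0" by (simp_all only: fst_zero snd_zero)
  then show "x = x'" "y = y'" by (simp_all add: a_def b_def)
qed

lemma inner_K: "(snd w, 0) \<bullet> z = snd w \<bullet> fst z" by (simp add: inner_fst_snd)

text \<open>For data \<open>r\<close> times \<open>u\<close>, Green's formula turns the right-hand
  side into \<open>r\<close> times the gradient term, as \<open>Dh \<subseteq> D\<close> and
  \<open>Gh \<subseteq> G\<close>. The first equation then says that \<open>x\<close> is
  \<open>1 + r\<close> times the projected gradient, the second that the gradient is the projection
  of \<open>x\<close>.\<close>

lemma eigen_of_sol:
  assumes s: "sol Dh Gh (r *\<^sub>R fst y) x y" and l: "0 < r"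
  shows "x = (1 + r) *\<^sub>R proj Dh (snd y, 0)" "proj (K Gh) x = (snd y, 0)"
    "S Dh Gh x = (1 / (1 + r)) *\<^sub>R x"
proof -
  have xD: "x \<in> Dh" and yG: "y \<in> Gh" using s by (auto simp: sol_def)
  have "proj Dh ((1 + r) *\<^sub>R (snd y, 0)) = x"
  proof (rule Dh.proj_eqI[OF xD])
    fix z assume z: "z \<in> Dh"
    have "x \<bullet> z - snd y \<bullet> fst z = - ((r *\<^sub>R fst y) \<bullet> snd z)" using s z by (simp add: sol_def)
    moreover have "snd y \<bullet> fst z = - (fst y \<bullet> snd z)" using D_green z yG Dh(2) Gh(2) by blast
    ultimately have "x \<bullet> z = (1 + r) * (snd y \<bullet> fst z)" by (simp add: algebra_simps)
    then show "x \<bullet> z = (1 + r) *\<^sub>R (snd y, 0) \<bullet> z" by (simp only: inner_scaleR_left inner_K)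
  qed
  then show x: "x = (1 + r) *\<^sub>R proj Dh (snd y, 0)" using linear_scale[OF Dh.linear_proj] by metis
  show Kx: "proj (K Gh) x = (snd y, 0)"
  proof (rule Kh.proj_eqI)
    show "(snd y, 0) \<in> K Gh" using yG by (auto simp: K_def)
    fix k assume "k \<in> K Gh"
    then obtain w where w: "w \<in> Gh" "k = (snd w, 0)" by (auto simp: K_def)
    then show "(snd y, 0) \<bullet> k = x \<bullet> k" using s by (simp add: sol_def inner_fst_snd)
  qed
  have "S Dh Gh x = proj Dh (snd y, 0)" by (simp add: S_def Kx xD)
  then show "S Dh Gh x = (1 / (1 + r)) *\<^sub>R x" using l by (subst x) simp
qed

lemma sol_of_eigen:
  assumes e: "S Dh Gh x = \<nu> *\<^sub>R x" and n: "0 < \<nu>" and x0: "x \<noteq> 0"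
  shows "\<nu> < 1" "\<exists>y\<in>Gh. proj (K Gh) x = (snd y, 0) \<and> x = (1 / \<nu>) *\<^sub>R proj Dh (snd y, 0) \<and>
      sol Dh Gh ((1 / \<nu> - 1) *\<^sub>R fst y) x y"
proof -
  have "\<nu> *\<^sub>R x \<in> Dh" unfolding e[symmetric] by (simp add: S_def)
  then have "(1 / \<nu>) *\<^sub>R \<nu> *\<^sub>R x \<in> Dh" by (rule subspace_scale[OF Dh.sub])
  then have xD: "x \<in> Dh" using n by simp
  obtain y where y: "y \<in> Gh" "proj (K Gh) x = (snd y, 0)" using Kh.proj_in[of x] unfolding K_def by auto
  have nx: "\<nu> *\<^sub>R x = proj Dh (snd y, 0)" using e xD y by (simp add: S_def)
  then have "(1 / \<nu>) *\<^sub>R \<nu> *\<^sub>R x = (1 / \<nu>) *\<^sub>R proj Dh (snd y, 0)" by simp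
  then have x: "x = (1 / \<nu>) *\<^sub>R proj Dh (snd y, 0)" using n by simp
  have xz: "x \<bullet> z = (1 / \<nu>) * (snd y \<bullet> fst z)" if "z \<in> Dh" for z
    using Dh.proj_inner[OF that, of "(snd y, 0)"] by (subst x) (simp add: inner_K)
  have yw: "snd y \<bullet> snd w = fst x \<bullet> snd w" if "w \<in> Gh" for w
  proof -
    have "(snd w, 0) \<in> K Gh" using that by (auto simp: K_def)
    from Kh.proj_inner[OF this, of x] show ?thesis by (simp add: y inner_fst_snd)
  qed
  have "sol Dh Gh ((1 / \<nu> - 1) *\<^sub>R fst y) x y"
    unfolding sol_def
  proof (intro conjI ballI xD y(1))
    fix z assume z: "z \<in> Dh"
    then have "snd y \<bullet> fst z = - (fst y \<bullet> snd z)" using D_green y Dh(2) Gh(2) by blast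
    then have "x \<bullet> z - snd y \<bullet> fst z = (1 / \<nu>) * (- (fst y \<bullet> snd z)) - (- (fst y \<bullet> snd z))"
      unfolding xz[OF z] by simp
    then show "x \<bullet> z - snd y \<bullet> fst z = - ((1 / \<nu> - 1) *\<^sub>R fst y \<bullet> snd z)"
      by (simp add: algebra_simps)
  qed (rule yw)
  then show "\<exists>y\<in>Gh. proj (K Gh) x = (snd y, 0) \<and> x = (1 / \<nu>) *\<^sub>R proj Dh (snd y, 0) \<and>
      sol Dh Gh ((1 / \<nu> - 1) *\<^sub>R fst y) x y" using y x by blast
  show "\<nu> < 1"
  proof (rule ccontr)
    \<comment> \<open>An eigenvalue of at least 1 would force the flux to equal the gradient and its
      divergence to vanish. Green's formula then makes the gradient 0, so \<open>x = 0\<close>. This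
      excludes \<open>1 / \<nu> - 1 \<le> 0\<close>.\<close>
    assume "\<not> \<nu> < 1"
    then have n1: "1 \<le> \<nu>" by simp
    have gs: "snd y \<bullet> snd y = snd y \<bullet> fst x" using yw[OF y(1)] by (simp add: inner_commute)
    have a: "\<nu> * (x \<bullet> x) = snd y \<bullet> fst x" using xz[OF xD] n by simp
    have "x \<bullet> x \<le> \<nu> * (x \<bullet> x)" using n1 mult_right_mono[of 1 \<nu> "x \<bullet> x"] by simp
    then have b: "fst x \<bullet> fst x + snd x \<bullet> snd x \<le> snd y \<bullet> fst x" using a by (simp add: inner_fst_snd)
    have "(fst x - snd y) \<bullet> (fst x - snd y) = fst x \<bullet> fst x - snd y \<bullet> fst x"
      using gs by (simp add: inner_diff inner_commute)
    then have "(fst x - snd y) \<bullet> (fst x - snd y) + snd x \<bullet> snd x \<le> 0" using b by simp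
    then have "snd x = 0" "fst x = snd y"
      using inner_ge_zero[of "fst x - snd y"] inner_ge_zero[of "snd x"]
      by (smt (verit) inner_eq_zero_iff right_minus_eq)+
    then have "snd y \<bullet> snd y = 0" using D_green[of x y] xD y(1) Dh(2) Gh(2) by auto
    then show False using x0 \<open>snd x = 0\<close> \<open>fst x = snd y\<close> by (simp add: prod_eq_iff)
  qed
qed

lemma self_adjoint_S: "self_adjoint (S Dh Gh)"
  unfolding self_adjoint_def
proof (intro conjI allI)
  show "bounded_linear (S Dh Gh)" unfolding S_def
    by (intro bounded_linear_compose[OF Dh.bounded_linear_proj] bounded_linear_compose[OF Kh.bounded_linear_proj] Dh.bounded_linear_proj)
  show "S Dh Gh x \<bullet> y = x \<bullet> S Dh Gh y" for x y
    unfolding S_def using Dh.proj_selfadj Kh.proj_selfadj by metis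
qed

lemma S_in: "S Dh Gh x \<in> Dh" by (simp add: S_def)

end

section \<open>The continuous problem and the smoothing property of its operator\<close>

context fosls
begin

sublocale full: fosls_pair Ls Vs G cP D G
  by unfold_locales (simp_all add: closed_subspace.sub closed_subspace.clo closed_subspace_D G)

text \<open>By \<open>double_adjoint\<close> the residual pair
  \<open>(div \<sigma> + f, \<sigma> - \<nabla>u)\<close> lies in the gradient graph. Testing the
  second equation with it kills its gradient entry, and Poincare kills the other one.\<close>

lemma sol_full:
  assumes s: "sol D G f x y" and f: "f \<in> Ls"
  shows "x = (snd y, - f)"
proof -
  interpret L: closed_subspace Ls by (rule Ls)
  interpret V: closed_subspace Vs by (rule Vs)
  have x: "fst x \<in> Vs" "snd x \<in> Ls" using s by (auto simp: sol_def D_def)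
  have y: "snd y \<in> Vs" "y \<in> G" using s GLV by (auto simp: sol_def)
  let ?w = "(snd x + f, fst x - snd y)"
  have w: "?w \<in> G"
  proof (rule double_adjoint)
    show "snd x + f \<in> Ls" "fst x - snd y \<in> Vs"
      using x y f L.sub V.sub by (auto simp: subspace_add subspace_diff)
    fix z assume "z \<in> D"
    then have "x \<bullet> z - snd y \<bullet> fst z = - (f \<bullet> snd z)" using s by (simp add: sol_def)
    then show "(fst x - snd y) \<bullet> fst z + (snd x + f) \<bullet> snd z = 0"
      by (simp add: inner_fst_snd inner_diff inner_add)
  qed
  then have "snd y \<bullet> (fst x - snd y) = fst x \<bullet> (fst x - snd y)" using s by (auto simp: sol_def)
  then have "(fst x - snd y) \<bullet> (fst x - snd y) = 0" by (simp add: inner_diff_left)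
  then have q: "fst x = snd y" by simp
  then have "norm (snd x + f) \<le> 0" using poincare[OF w] by simp
  then have "snd x = - f" by (simp add: add_eq_0_iff2)
  then show ?thesis using q by (simp add: prod_eq_iff)
qed

text \<open>Expresses \<open>S D G x\<close> through Dirichlet problems: \<open>p\<close> solves one
  with data \<open>- d\<close>, and \<open>p + e\<close> one with data \<open>- fst e\<close>. The
  difference \<open>e\<close> therefore solves one too, so both the flux (the gradient of
  \<open>p + e\<close>) and its divergence (the function of \<open>e\<close>) will gain
  regularity.\<close>

lemma S_structure:
  obtains d p e where "d \<in> Ls" "p \<in> G" "e \<in> G" "proj (K G) (proj D x) = (snd p, 0)"
    "S D G x = (snd p + snd e, fst e)"
    "\<And>w. w \<in> G \<Longrightarrow> snd p \<bullet> snd w = - (d \<bullet> fst w)"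
    "\<And>w. w \<in> G \<Longrightarrow> snd (p + e) \<bullet> snd w = - (fst e \<bullet> fst w)"
proof -
  define y where "y = proj D x"
  have y: "y \<in> D" by (simp add: y_def)
  obtain p where p: "p \<in> G" "proj (K G) y = (snd p, 0)" using full.Kh.proj_in[of y] unfolding K_def by auto
  define z where "z = S D G x"
  have z: "z \<in> D" unfolding z_def by (rule full.S_in)
  have zp: "z = proj D (snd p, 0)" by (simp add: z_def S_def y_def[symmetric] p)
  interpret V: closed_subspace Vs by (rule Vs)
  have e: "(snd z, fst z - snd p) \<in> G"
  proof (rule double_adjoint)
    show "snd z \<in> Ls" using z by (simp add: D_def)
    show "fst z - snd p \<in> Vs" using z p GLV V.sub by (auto simp: D_def subspace_diff mem_Times_iff)
    fix w assume "w \<in> D"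
    from full.Dh.proj_inner[OF this, of "(snd p, 0)"]
    show "(fst z - snd p) \<bullet> fst w + snd z \<bullet> snd w = 0"
      unfolding zp[symmetric] by (simp add: inner_fst_snd inner_diff)
  qed
  show thesis
  proof (rule that[of "snd y" p "(snd z, fst z - snd p)"])
    show "snd y \<in> Ls" using y by (simp add: D_def)
    show "proj (K G) (proj D x) = (snd p, 0)" using p by (simp add: y_def)
    show "S D G x = (snd p + snd (snd z, fst z - snd p), fst (snd z, fst z - snd p))" by (simp add: z_def)
    fix w assume w: "w \<in> G"
    have "(snd w, 0) \<in> K G" using w by (auto simp: K_def)
    from full.Kh.proj_inner[OF this, of y] have "snd p \<bullet> snd w = fst y \<bullet> snd w" by (simp add: p inner_fst_snd)
    then show "snd p \<bullet> snd w = - (snd y \<bullet> fst w)" using D_green[OF y w] by (simp add: inner_commute)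
    show "snd (p + (snd z, fst z - snd p)) \<bullet> snd w = - (fst (snd z, fst z - snd p) \<bullet> fst w)"
      using D_green[OF z w] by (simp add: inner_commute)
  qed (use p e in auto)
qed

end

section \<open>Operator error and consistency error\<close>

context fosls_pair
begin

lemma K_mono: "K Gh \<subseteq> K G" using Gh(2) by (auto simp: K_def)

lemma proj_Dh_D: "proj Dh (proj D x) = proj Dh x"
proof (rule Dh.proj_eqI[symmetric])
  fix v assume v: "v \<in> Dh"
  then have "proj D x \<bullet> v = x \<bullet> v" using Dh(2) full.Dh.proj_inner by blast
  then show "proj Dh (proj D x) \<bullet> v = x \<bullet> v" using Dh.proj_inner[OF v] by metis
qed simp

lemma proj_Kh_K: "proj (K Gh) (proj (K G) x) = proj (K Gh) x"
proof (rule Kh.proj_eqI[symmetric])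
  fix v assume v: "v \<in> K Gh"
  then have "proj (K G) x \<bullet> v = x \<bullet> v" using K_mono full.Kh.proj_inner by blast
  then show "proj (K Gh) (proj (K G) x) \<bullet> v = x \<bullet> v" using Kh.proj_inner[OF v] by metis
qed simp

text \<open>With \<open>y = P_h x\<close> and \<open>w = x - y\<close>, the difference splits into
  \<open>(I - P_h) S x\<close>, \<open>P_h S w\<close> and \<open>P_h (Q - Q_h) y\<close>. The first
  is bounded through \<open>a\<close>, the third through \<open>b\<close>; the second is controlled
  by transposing the first, whence the factor 2.\<close>

lemma norm_diff_S_le:
  assumes a: "\<And>x. norm (S D G x - proj Dh (S D G x)) \<le> a * norm x"
    and b: "\<And>x. norm (proj (K G) (proj D x) - proj (K Gh) (proj D x)) \<le> b * norm x"
  shows "norm (S D G x - S Dh Gh x) \<le> (2 * \<bar>a\<bar> + \<bar>b\<bar>) * norm x"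
proof -
  have a': "norm (S D G x - proj Dh (S D G x)) \<le> \<bar>a\<bar> * norm x" for x
    by (rule order_trans[OF a]) (intro mult_right_mono abs_ge_self norm_ge_zero)
  have b': "norm (proj (K G) (proj D x) - proj (K Gh) (proj D x)) \<le> \<bar>b\<bar> * norm x" for x
    by (rule order_trans[OF b]) (intro mult_right_mono abs_ge_self norm_ge_zero)
  have symS: "S D G x \<bullet> y = x \<bullet> S D G y" for x y using full.self_adjoint_S unfolding self_adjoint_def by blast
  interpret Sl: bounded_linear "S D G" using full.self_adjoint_S by (simp add: self_adjoint_def)
  define y where "y = proj Dh x"
  define w where "w = x - y"
  have yD: "y \<in> D" using Dh(2) by (auto simp: y_def)
  \<comment> \<open>Duality: \<open>w\<close> is orthogonal to \<open>Dh\<close> and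
    \<open>S D G\<close> is symmetric, so pairing \<open>S D G w\<close> with itself sees only the
    part of \<open>?v\<close> that \<open>Dh\<close> misses.\<close>
  have t1: "norm (S D G w) \<le> \<bar>a\<bar> * norm x"
  proof (cases "S D G w = 0")
    case False
    let ?v = "S D G (S D G w)"
    have "w \<bullet> proj Dh ?v = 0" unfolding w_def y_def by (rule Dh.proj_orth) simp
    then have "S D G w \<bullet> S D G w = w \<bullet> (?v - proj Dh ?v)" using symS[of w "S D G w"] by (simp add: inner_diff)
    also have "\<dots> \<le> norm w * norm (?v - proj Dh ?v)" by (rule norm_cauchy_schwarz)
    also have "\<dots> \<le> norm x * (\<bar>a\<bar> * norm (S D G w))"
      unfolding w_def y_def by (intro mult_mono a' Dh.norm_compl_le) auto
    finally have "norm (S D G w) * norm (S D G w) \<le> (\<bar>a\<bar> * norm x) * norm (S D G w)"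
      by (simp add: dot_square_norm power2_eq_square mult_ac)
    then show ?thesis using False by simp
  qed simp
  have t2: "norm (proj Dh (S D G w)) \<le> \<bar>a\<bar> * norm x" using Dh.norm_proj_le t1 order_trans by blast
  have Sy: "proj Dh (S D G y) = proj Dh (proj (K G) y)"
    unfolding S_def proj_Dh_D using yD by simp
  have t3: "norm (proj Dh (proj (K G) y - proj (K Gh) y)) \<le> \<bar>b\<bar> * norm x"
  proof -
    have "norm (proj Dh (proj (K G) y - proj (K Gh) y)) \<le> norm (proj (K G) y - proj (K Gh) y)" by (rule Dh.norm_proj_le)
    also have "\<dots> \<le> \<bar>b\<bar> * norm y" using b'[of y] yD by simp
    also have "\<dots> \<le> \<bar>b\<bar> * norm x" unfolding y_def by (intro mult_left_mono Dh.norm_proj_le) auto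
    finally show ?thesis .
  qed
  have xw: "x = w + y" by (simp add: w_def)
  have "proj Dh (S D G x) = proj Dh (S D G w) + proj Dh (S D G y)"
    unfolding xw Sl.add by (rule linear_add[OF Dh.linear_proj])
  moreover have "S Dh Gh x = proj Dh (proj (K Gh) y)" by (simp add: S_def y_def)
  ultimately have eq: "S D G x - S Dh Gh x = (S D G x - proj Dh (S D G x)) + proj Dh (S D G w) + proj Dh (proj (K G) y - proj (K Gh) y)"
    by (simp add: Sy linear_diff[OF Dh.linear_proj])
  have "norm (S D G x - S Dh Gh x) \<le> norm (S D G x - proj Dh (S D G x)) + norm (proj Dh (S D G w)) + norm (proj Dh (proj (K G) y - proj (K Gh) y))"
    unfolding eq by (rule order_trans[OF norm_triangle_ineq add_right_mono[OF norm_triangle_ineq]])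
  also have "\<dots> \<le> \<bar>a\<bar> * norm x + \<bar>a\<bar> * norm x + \<bar>b\<bar> * norm x" by (intro add_mono a' t2 t3)
  finally show ?thesis by (simp add: algebra_simps)
qed

text \<open>For an eigenvector, \<open>S D G x\<close> is \<open>x\<close> times a factor of at most
  1, so its projection error is at most that of \<open>x\<close>, and arbitrary competitors
  \<open>z\<close> and \<open>w\<close> can be inserted. The second bound serves to pass from an
  approximation \<open>v\<close> of the flux to one of the gradient, by applying the discrete
  gradient projection to \<open>v\<close>.\<close>

lemma consistency_error:
  assumes x: "x \<in> D" and Sx: "S D G x = \<nu> *\<^sub>R x" and nu: "0 \<le> \<nu>" "\<nu> \<le> 1"
    and g: "proj (K G) x = (g, 0)" and z: "z \<in> Dh" and w: "w \<in> Gh"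
  shows "norm (S D G x - S Dh Gh x) \<le> 2 * norm (x - z) + norm (g - snd w)"
    "norm ((g, 0) - proj (K Gh) v) \<le> norm (x - v) + norm (g - snd w)"
proof -
  have wK: "(snd w, 0) \<in> K Gh" using w by (auto simp: K_def)
  have q: "norm (proj (K G) x - proj (K Gh) x) \<le> norm (g - snd w)"
  proof -
    have "norm (proj (K G) x - proj (K Gh) (proj (K G) x)) \<le> norm (proj (K G) x - (snd w, 0))"
      by (rule Kh.proj_best[OF wK])
    then show ?thesis unfolding proj_Kh_K by (simp add: g norm_Pair)
  qed
  let ?d = "x - proj Dh x"
  have d: "norm ?d \<le> norm (x - z)" by (rule Dh.proj_best[OF z])
  have SD: "proj Dh (S D G x) = proj Dh (proj (K G) x)" unfolding S_def proj_Dh_D using x by simp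
  have eq: "S D G x - S Dh Gh x = (S D G x - proj Dh (S D G x)) + proj Dh (proj (K G) x - proj (K Gh) x)
      + proj Dh (proj (K Gh) ?d)"
    unfolding SD by (simp add: S_def[of Dh] linear_diff[OF Dh.linear_proj] linear_diff[OF Kh.linear_proj])
  have "norm (S D G x - S Dh Gh x) \<le> norm (S D G x - proj Dh (S D G x))
      + norm (proj Dh (proj (K G) x - proj (K Gh) x)) + norm (proj Dh (proj (K Gh) ?d))"
    unfolding eq by (rule order_trans[OF norm_triangle_ineq add_right_mono[OF norm_triangle_ineq]])
  moreover have "norm (S D G x - proj Dh (S D G x)) \<le> norm ?d"
  proof -
    have "S D G x - proj Dh (S D G x) = \<nu> *\<^sub>R ?d"
      unfolding Sx by (simp add: linear_scale[OF Dh.linear_proj] algebra_simps)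
    then show ?thesis using nu mult_right_mono[of \<nu> 1 "norm ?d"] by simp
  qed
  moreover have "norm (proj Dh (proj (K G) x - proj (K Gh) x)) \<le> norm (g - snd w)"
    using Dh.norm_proj_le q order_trans by blast
  moreover have "norm (proj Dh (proj (K Gh) ?d)) \<le> norm ?d"
    using Dh.norm_proj_le Kh.norm_proj_le order_trans by blast
  ultimately show "norm (S D G x - S Dh Gh x) \<le> 2 * norm (x - z) + norm (g - snd w)" using d by linarith
  have "(g, 0) - proj (K Gh) v = (proj (K G) x - proj (K Gh) x) + proj (K Gh) (x - v)"
    by (simp add: g linear_diff[OF Kh.linear_proj])
  then have "norm ((g, 0) - proj (K Gh) v) \<le> norm (proj (K G) x - proj (K Gh) x) + norm (proj (K Gh) (x - v))"
    by (simp only: norm_triangle_ineq)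
  then show "norm ((g, 0) - proj (K Gh) v) \<le> norm (x - v) + norm (g - snd w)"
    using q Kh.norm_proj_le[of "x - v"] by linarith
qed

end

section \<open>Weak derivatives\<close>

definition grad :: "(real^'n::finite \<Rightarrow> real) \<Rightarrow> real^'n \<Rightarrow> real^'n" where
  "grad \<phi> = (\<lambda>x. \<chi> i. partial_deriv i \<phi> x)"

lemma L2_component:
  fixes F :: "'a::euclidean_space \<Rightarrow> real^'n::finite"
  assumes "F \<in> L2 \<Omega>" shows "(\<lambda>x. F x $ i) \<in> L2 \<Omega>"
proof (rule L2_bound[OF _ L2D(2)[OF assms]])
  have "(\<lambda>x. F x \<bullet> axis i 1) \<in> borel_measurable (lebesgue_on \<Omega>)"
    by (rule borel_measurable_inner[OF L2D(1)[OF assms] borel_measurable_const])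
  then show "(\<lambda>x. F x $ i) \<in> borel_measurable (lebesgue_on \<Omega>)" by (simp add: inner_axis)
  show "(norm (F x $ i))\<^sup>2 \<le> (norm (F x))\<^sup>2" for x
    by (intro power_mono) (simp_all add: component_le_norm_cart)
qed

lemma L2_axis:
  fixes f :: "'a::euclidean_space \<Rightarrow> real"
  assumes "f \<in> L2 \<Omega>" shows "(\<lambda>x. axis i (f x) :: real^'n::finite) \<in> L2 \<Omega>"
proof -
  have eq: "(\<lambda>x. axis i (f x)) = (\<lambda>x. f x *\<^sub>R axis i 1)"
    by (auto simp: axis_def vec_eq_iff)
  show ?thesis
  proof (rule L2_bound[OF _ L2D(2)[OF assms]])
    show "(\<lambda>x. axis i (f x) :: real^'n) \<in> borel_measurable (lebesgue_on \<Omega>)"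
      unfolding eq by (rule borel_measurable_scaleR[OF L2D(1)[OF assms] borel_measurable_const])
    have "axis i (f x) = f x *\<^sub>R (axis i 1 :: real^'n)" for x using fun_cong[OF eq] .
    then show "(norm (axis i (f x) :: real^'n))\<^sup>2 \<le> (norm (f x))\<^sup>2" for x by simp
  qed
qed

lemma L2_vector:
  fixes F :: "'a::euclidean_space \<Rightarrow> real^'n::finite"
  assumes "\<And>i. (\<lambda>x. F x $ i) \<in> L2 \<Omega>" shows "F \<in> L2 \<Omega>"
proof -
  have "(\<lambda>x. \<Sum>i\<in>UNIV. 1 *\<^sub>R (axis i (F x $ i) :: real^'n)) \<in> L2 \<Omega>"
    by (intro L2_sum L2_axis assms) simp
  moreover have "(\<lambda>x. \<Sum>i\<in>UNIV. 1 *\<^sub>R (axis i (F x $ i) :: real^'n)) = F"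
    by (auto simp: vec_eq_iff axis_def sum_component if_distrib[of "\<lambda>f. f _"] cong: if_cong)
  ultimately show ?thesis by simp
qed

lemma L2_inner_axis: "L2_inner \<Omega> F (\<lambda>x. axis i (f x)) = L2_inner \<Omega> (\<lambda>x. F x $ i) f"
  unfolding L2_inner_def by (simp add: inner_axis)

lemma test_function_grad_L2:
  assumes "\<phi> \<in> test_functions \<Omega>" "\<Omega> \<in> sets lebesgue" shows "grad \<phi> \<in> L2 \<Omega>"
  unfolding grad_def by (rule L2_vector) (simp add: test_functions_L2[OF test_functions_partial_deriv[OF assms(1)] assms(2)])

section \<open>Graphs of the weak gradient and the weak divergence\<close>

locale sobolev =
  fixes \<Omega> :: "(real^'n::finite) set" and R :: real
  assumes open_\<Omega>: "open \<Omega>" and bounded_\<Omega>: "\<And>x. x \<in> \<Omega> \<Longrightarrow> norm x \<le> R"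
begin

lemma meas [simp]: "\<Omega> \<in> sets lebesgue" using open_\<Omega> by simp

abbreviation cl :: "(real^'n \<Rightarrow> 'b::euclidean_space) \<Rightarrow> (real^'n, 'b) l2" where "cl \<equiv> cls \<Omega>"
abbreviation T where "T \<equiv> test_functions \<Omega>"

lemma test_L2 [simp]: "\<phi> \<in> T \<Longrightarrow> \<phi> \<in> L2 \<Omega>" by (rule test_functions_L2[OF _ meas])
lemma test_pd [simp]: "\<phi> \<in> T \<Longrightarrow> partial_deriv i \<phi> \<in> T" by (rule test_functions_partial_deriv)
lemma test_grad [simp]: "\<phi> \<in> T \<Longrightarrow> grad \<phi> \<in> L2 \<Omega>" by (rule test_function_grad_L2[OF _ meas])

lemma orthogonal_to_tests_imp_0:
  assumes "x \<in> L2_range \<Omega>" "\<And>\<phi>. \<phi> \<in> T \<Longrightarrow> x \<bullet> cl \<phi> = 0"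
  shows "x = (0 :: (real^'n, real) l2)"
proof -
  obtain g where g: "g \<in> L2 \<Omega>" "x = cl g" using assms(1) by (auto simp: L2_range_def)
  have "AE y in lebesgue_on \<Omega>. g y = 0"
    by (rule AE_zero_if_orthogonal_to_test_functions[OF open_\<Omega> g(1)])
       (use assms(2) g in \<open>simp add: cls_inner\<close>)
  then show ?thesis using g cls_eq_iff[OF meas g(1) L2_zero] by (simp add: cls_zero)
qed

lemma cl_in [simp]: "f \<in> L2 \<Omega> \<Longrightarrow> cl f \<in> L2_range \<Omega>" by (simp add: L2_range_def)

lemma has_weak_partial_iff:
  assumes "u \<in> L2 \<Omega>"
  shows "has_weak_partial \<Omega> i u g \<longleftrightarrow> g \<in> L2 \<Omega> \<and> (\<forall>\<phi>\<in>T. cl u \<bullet> cl (partial_deriv i \<phi>) = - (cl g \<bullet> cl \<phi>))"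
  using assms unfolding has_weak_partial_def by (auto simp: cls_inner)

definition wgrad :: "(real^'n \<Rightarrow> real) \<Rightarrow> (real^'n \<Rightarrow> real^'n) \<Rightarrow> bool" where
  "wgrad u F \<longleftrightarrow> u \<in> L2 \<Omega> \<and> F \<in> L2 \<Omega> \<and> (\<forall>i. has_weak_partial \<Omega> i u (\<lambda>x. F x $ i))"

text \<open>The graph of the weak gradient on H1. The defining integral identities are encoded as
  orthogonality to fixed vectors, which makes closedness automatic.\<close>

definition W :: "((real^'n, real) l2 \<times> (real^'n, real^'n) l2) set" where
  "W = (L2_range \<Omega> \<times> L2_range \<Omega>) \<inter>
     {z. \<forall>w\<in>{(cl (partial_deriv i \<phi>), cl (\<lambda>x. axis i (\<phi> x))) |i \<phi>. \<phi> \<in> T}. z \<bullet> w = 0}"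

lemma W_iff:
  assumes "u \<in> L2 \<Omega>" "F \<in> L2 \<Omega>"
  shows "(cl u, cl F) \<in> W \<longleftrightarrow> wgrad u F"
proof -
  have 1: "cl F \<bullet> cl (\<lambda>x. axis i (\<phi> x)) = cl (\<lambda>x. F x $ i) \<bullet> cl \<phi>" if "\<phi> \<in> T" for i \<phi>
    using that assms by (simp add: cls_inner L2_axis L2_component L2_inner_axis)
  have "(cl u, cl F) \<in> W \<longleftrightarrow> (\<forall>i. \<forall>\<phi>\<in>T. (cl u, cl F) \<bullet> (cl (partial_deriv i \<phi>), cl (\<lambda>x. axis i (\<phi> x))) = 0)"
    unfolding W_def using assms by auto
  also have "\<dots> \<longleftrightarrow> (\<forall>i. \<forall>\<phi>\<in>T. cl u \<bullet> cl (partial_deriv i \<phi>) = - (cl (\<lambda>x. F x $ i) \<bullet> cl \<phi>))"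
    by (simp add: 1 eq_neg_iff_add_eq_0)
  also have "\<dots> \<longleftrightarrow> wgrad u F"
    unfolding wgrad_def has_weak_partial_iff[OF assms(1)] using assms L2_component by blast
  finally show ?thesis .
qed

lemma W_unique:
  assumes "(x, y) \<in> W" "(x, y') \<in> W" shows "y = y'"
proof -
  obtain u where u: "u \<in> L2 \<Omega>" "x = cl u" using assms by (auto simp: W_def L2_range_def)
  obtain F where F: "F \<in> L2 \<Omega>" "y = cl F" using assms by (auto simp: W_def L2_range_def)
  obtain F' where F': "F' \<in> L2 \<Omega>" "y' = cl F'" using assms by (auto simp: W_def L2_range_def)
  have wg: "wgrad u F" "wgrad u F'" using assms u F F' W_iff by auto
  have "AE z in lebesgue_on \<Omega>. F z $ i = F' z $ i" for i
  proof -
    let ?d = "\<lambda>z. F z $ i - F' z $ i"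
    have d: "?d \<in> L2 \<Omega>" by (intro L2_diff L2_component F F')
    have "cl ?d = 0"
    proof (rule orthogonal_to_tests_imp_0)
      show "cl ?d \<in> L2_range \<Omega>" using d by simp
      fix \<phi> assume "\<phi> \<in> T"
      then have "cl (\<lambda>x. F x $ i) \<bullet> cl \<phi> = cl (\<lambda>x. F' x $ i) \<bullet> cl \<phi>"
        using wg has_weak_partial_iff[OF u(1)] unfolding wgrad_def by (metis minus_equation_iff)
      then show "cl ?d \<bullet> cl \<phi> = 0" by (simp add: cls_diff L2_component F F' inner_diff_left)
    qed
    then have "AE z in lebesgue_on \<Omega>. ?d z = 0"
      using cls_eq_iff[OF meas d L2_zero] by (simp add: cls_zero)
    then show ?thesis by eventually_elim simp
  qed
  then have "AE z in lebesgue_on \<Omega>. \<forall>i\<in>UNIV. F z $ i = F' z $ i" by (intro AE_finite_allI) auto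
  then have "AE z in lebesgue_on \<Omega>. F z = F' z" by eventually_elim (simp add: vec_eq_iff)
  then show ?thesis using F F' cls_eq_iff[OF meas F(1) F'(1)] by simp
qed

lemma closed_subspace_W: "closed_subspace W"
proof -
  have 1: "closed_subspace (L2_range \<Omega> \<times> L2_range \<Omega> :: ((real^'n, real) l2 \<times> (real^'n, real^'n) l2) set)"
    by (intro closed_subspace_Times closed_subspace_L2_range meas)
  note 2 = closed_subspace_orthogonal_complement[of "{(cl (partial_deriv i \<phi>), cl (\<lambda>x. axis i (\<phi> x) :: real^'n)) |i \<phi>. \<phi> \<in> T}"]
  show ?thesis unfolding W_def
    by unfold_locales (intro subspace_inter closed_Int closed_subspace.sub[OF 1] closed_subspace.sub[OF 2]
        closed_subspace.clo[OF 1] closed_subspace.clo[OF 2])+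
qed

lemma H1_wgrad: "u \<in> H1 \<Omega> \<longleftrightarrow> (\<exists>F. wgrad u F)"
proof
  assume u: "u \<in> H1 \<Omega>"
  then have "\<forall>i. \<exists>g. has_weak_partial \<Omega> i u g" by (simp add: H1_def)
  then obtain g where g: "\<And>i. has_weak_partial \<Omega> i u (g i)" by metis
  then have "(\<lambda>x. \<chi> i. g i x) \<in> L2 \<Omega>" by (intro L2_vector) (simp add: has_weak_partial_def)
  then show "\<exists>F. wgrad u F" using u g by (intro exI[of _ "\<lambda>x. \<chi> i. g i x"]) (simp add: wgrad_def H1_def)
next
  assume "\<exists>F. wgrad u F" then show "u \<in> H1 \<Omega>" by (auto simp: wgrad_def H1_def)
qed

lemma H1_weak_grad: "u \<in> H1 \<Omega> \<Longrightarrow> wgrad u (weak_grad \<Omega> u)"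
proof -
  assume u: "u \<in> H1 \<Omega>"
  have "\<exists>g. has_weak_partial \<Omega> i u g" for i using u by (simp add: H1_def)
  then have w: "has_weak_partial \<Omega> i u (weak_partial \<Omega> i u)" for i
    unfolding weak_partial_def by (rule someI_ex)
  then have "weak_grad \<Omega> u \<in> L2 \<Omega>" by (intro L2_vector) (simp add: weak_grad_def has_weak_partial_def)
  then show ?thesis using u w by (simp add: wgrad_def H1_def weak_grad_def)
qed

lemma wgrad_unique:
  assumes "wgrad u F" shows "u \<in> H1 \<Omega>" "cl (weak_grad \<Omega> u) = cl F" "weak_grad \<Omega> u \<in> L2 \<Omega>"
proof -
  show u: "u \<in> H1 \<Omega>" using assms H1_wgrad by blast
  have w: "wgrad u (weak_grad \<Omega> u)" by (rule H1_weak_grad[OF u])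
  then show "weak_grad \<Omega> u \<in> L2 \<Omega>" by (simp add: wgrad_def)
  show "cl (weak_grad \<Omega> u) = cl F"
    using W_unique[of "cl u"] w assms W_iff[of u] by (auto simp: wgrad_def)
qed

lemma wgrad_diff: "wgrad u F \<Longrightarrow> wgrad v H \<Longrightarrow> wgrad (\<lambda>x. u x - v x) (\<lambda>x. F x - H x)"
proof -
  assume a: "wgrad u F" "wgrad v H"
  then have L: "u \<in> L2 \<Omega>" "F \<in> L2 \<Omega>" "v \<in> L2 \<Omega>" "H \<in> L2 \<Omega>" by (auto simp: wgrad_def)
  interpret W: closed_subspace W by (rule closed_subspace_W)
  have "(cl u, cl F) - (cl v, cl H) \<in> W" using a L W_iff W.sub by (intro subspace_diff) auto
  then show ?thesis using L W_iff[OF L2_diff[OF L(1,3)] L2_diff[OF L(2,4)]] by (simp add: cls_diff)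
qed

lemma H1_norm_eq: "wgrad u F \<Longrightarrow> H1_norm \<Omega> u = norm (cl u, cl F)"
  using wgrad_unique[of u F] by (auto simp: H1_norm_def norm_Pair cls_norm[symmetric] wgrad_def)

lemma test_wgrad: "\<phi> \<in> T \<Longrightarrow> wgrad \<phi> (grad \<phi>)"
  unfolding wgrad_def by (auto simp: has_weak_partial_def grad_def test_function_integration_by_parts
    test_function_grad_L2[unfolded grad_def])

definition test_graph :: "((real^'n, real) l2 \<times> (real^'n, real^'n) l2) set" where
  "test_graph = (\<lambda>\<phi>. (cl \<phi>, cl (grad \<phi>))) ` T"

text \<open>As H10 consists of the H1 limits of test functions, this is the graph of the weak
  gradient on H10; \<open>H10_Gr\<close> and \<open>Gr_H10\<close> confirm it.\<close>

definition Gr :: "((real^'n, real) l2 \<times> (real^'n, real^'n) l2) set" where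
  "Gr = closure test_graph"

lemma subspace_test_graph: "subspace test_graph"
proof (rule subspaceI)
  have z: "grad (\<lambda>x::real^'n. 0) = (\<lambda>x. 0)"
  proof -
    have "partial_deriv i (\<lambda>x::real^'n. 0) x = 0" for i x by (rule partial_derivI[OF has_derivative_const])
    then show ?thesis by (simp add: grad_def fun_eq_iff vec_eq_iff)
  qed
  show "0 \<in> test_graph" unfolding test_graph_def
    by (rule image_eqI[OF _ test_functions_zero]) (simp add: z cls_zero zero_prod_def)
next
  fix x y assume "x \<in> test_graph" "y \<in> test_graph"
  then obtain \<phi> \<psi> where t: "\<phi> \<in> T" "x = (cl \<phi>, cl (grad \<phi>))" "\<psi> \<in> T" "y = (cl \<psi>, cl (grad \<psi>))"
    by (auto simp: test_graph_def)
  have "grad (\<lambda>x. \<phi> x + \<psi> x) = (\<lambda>x. grad \<phi> x + grad \<psi> x)"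
    unfolding grad_def partial_deriv_add[OF test_functions_differentiable[OF t(1)] test_functions_differentiable[OF t(3)]]
    by (auto simp: vec_eq_iff)
  then have "x + y = (cl (\<lambda>x. \<phi> x + \<psi> x), cl (grad (\<lambda>x. \<phi> x + \<psi> x)))" using t by (simp add: cls_add)
  then show "x + y \<in> test_graph" unfolding test_graph_def using test_functions_add[OF t(1,3)] by blast
next
  fix c :: real and x assume "x \<in> test_graph"
  then obtain \<phi> where t: "\<phi> \<in> T" "x = (cl \<phi>, cl (grad \<phi>))" by (auto simp: test_graph_def)
  have "grad (\<lambda>x. c * \<phi> x) = (\<lambda>x. c *\<^sub>R grad \<phi> x)"
  proof -
    have "(\<lambda>x::real^'n. c) differentiable_on UNIV" using C_k_const[of "Suc 0" c] by simp
    from partial_deriv_mult[OF this test_functions_differentiable[OF t(1)]]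
    have "partial_deriv i (\<lambda>x. c * \<phi> x) = (\<lambda>x. c * partial_deriv i \<phi> x)" for i
      using partial_derivI[OF has_derivative_const[of c]] by (auto simp: fun_eq_iff)
    then show ?thesis by (auto simp: grad_def vec_eq_iff)
  qed
  then have "c *\<^sub>R x = (cl (\<lambda>x. c * \<phi> x), cl (grad (\<lambda>x. c * \<phi> x)))"
    using t cls_scaleR[of \<Omega> \<phi> c] cls_scaleR[of \<Omega> "grad \<phi>" c] by simp
  then show "c *\<^sub>R x \<in> test_graph" unfolding test_graph_def using test_functions_mult[OF t(1) C_k_const] by blast
qed

lemma closed_subspace_Gr: "closed_subspace Gr"
proof
  show "closed Gr" by (simp add: Gr_def)
  show "subspace Gr"
  proof (rule subspaceI)
    show "0 \<in> Gr" unfolding Gr_def using closure_subset subspace_0[OF subspace_test_graph] by blast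
  next
    fix x y assume "x \<in> Gr" "y \<in> Gr"
    then obtain f g where f: "\<And>n. f n \<in> test_graph" "f \<longlonglongrightarrow> x" and g: "\<And>n. g n \<in> test_graph" "g \<longlonglongrightarrow> y"
      unfolding Gr_def closure_sequential by metis
    have "(\<lambda>n. f n + g n) \<longlonglongrightarrow> x + y" by (intro tendsto_add f g)
    moreover have "f n + g n \<in> test_graph" for n using f(1) g(1) subspace_test_graph by (rule_tac subspace_add)
    ultimately show "x + y \<in> Gr" unfolding Gr_def closure_sequential by (intro exI[of _ "\<lambda>n. f n + g n"]) simp
  next
    fix c :: real and x assume "x \<in> Gr"
    then obtain f where f: "\<And>n. f n \<in> test_graph" "f \<longlonglongrightarrow> x" unfolding Gr_def closure_sequential by metis
    have "(\<lambda>n. c *\<^sub>R f n) \<longlonglongrightarrow> c *\<^sub>R x" by (intro tendsto_scaleR f tendsto_const)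
    moreover have "c *\<^sub>R f n \<in> test_graph" for n using f(1) subspace_test_graph by (rule_tac subspace_scale)
    ultimately show "c *\<^sub>R x \<in> Gr" unfolding Gr_def closure_sequential by (intro exI[of _ "\<lambda>n. c *\<^sub>R f n"]) simp
  qed
qed

lemma Gr_W: "Gr \<subseteq> W"
  unfolding Gr_def
proof (rule closure_minimal)
  show "test_graph \<subseteq> W" using test_wgrad W_iff by (auto simp: test_graph_def)
  show "closed W" using closed_subspace_W by (simp add: closed_subspace_def)
qed

text \<open>Integrating \<open>\<partial>\<^sub>i (x\<^sub>i \<phi>\<^sup>2)\<close> gives \<open>\<parallel>\<phi>\<parallel>\<^sup>2 = - 2 (x\<^sub>i \<phi>, \<partial>\<^sub>i \<phi>)\<close>.\<close>

lemma poincare_test: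
  assumes \<phi>: "\<phi> \<in> T"
  shows "norm (cl \<phi>) \<le> (2 * \<bar>R\<bar>) * norm (cl (grad \<phi>))"
proof (cases "cl \<phi> = 0")
  case False
  \<comment> \<open>Any one coordinate direction will do.\<close>
  obtain i :: 'n where True by blast
  let ?p = "\<lambda>x::real^'n. x $ i"
  have xT: "(\<lambda>x. ?p x * \<phi> x) \<in> T" by (rule test_functions_mult[OF \<phi> C_k_coordinate])
  have pd: "partial_deriv i (\<lambda>x. ?p x * \<phi> x) = (\<lambda>x. ?p x * partial_deriv i \<phi> x + \<phi> x)"
  proof -
    have d: "((\<lambda>x::real^'n. x $ i) has_derivative (\<lambda>h. h $ i)) (at x)" for x
      by (rule bounded_linear.has_derivative[OF bounded_linear_vec_nth has_derivative_ident])
    have "partial_deriv i ?p = (\<lambda>x. 1)"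
      by (rule ext) (simp add: partial_derivI[OF d])
    moreover have "?p differentiable_on UNIV" using C_k_coordinate[of "Suc 0" i] by simp
    ultimately show ?thesis using partial_deriv_mult[OF _ test_functions_differentiable[OF \<phi>], of ?p i] by simp
  qed
  have xpT: "(\<lambda>x. ?p x * partial_deriv i \<phi> x) \<in> T" by (rule test_functions_mult[OF test_pd[OF \<phi>] C_k_coordinate])
  have "L2_inner \<Omega> (\<lambda>x. ?p x * \<phi> x) (partial_deriv i \<phi>) = - L2_inner \<Omega> (partial_deriv i (\<lambda>x. ?p x * \<phi> x)) \<phi>"
    by (rule test_function_integration_by_parts[OF xT \<phi> meas])
  then have "cl (\<lambda>x. ?p x * \<phi> x) \<bullet> cl (partial_deriv i \<phi>) = - (cl (partial_deriv i (\<lambda>x. ?p x * \<phi> x)) \<bullet> cl \<phi>)"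
    using \<phi> xT by (simp add: cls_inner)
  also have "cl (partial_deriv i (\<lambda>x. ?p x * \<phi> x)) = cl (\<lambda>x. ?p x * partial_deriv i \<phi> x) + cl \<phi>"
    unfolding pd using xpT \<phi> by (simp add: cls_add)
  \<comment> \<open>The term with the derivative reappears on the right, which produces the factor
    2.\<close>
  also have "cl (\<lambda>x. ?p x * partial_deriv i \<phi> x) \<bullet> cl \<phi> = cl (\<lambda>x. ?p x * \<phi> x) \<bullet> cl (partial_deriv i \<phi>)"
    using xpT xT \<phi> by (simp add: cls_inner) (simp add: L2_inner_def mult_ac)
  then have "- ((cl (\<lambda>x. ?p x * partial_deriv i \<phi> x) + cl \<phi>) \<bullet> cl \<phi>) =
      - (cl (\<lambda>x. ?p x * \<phi> x) \<bullet> cl (partial_deriv i \<phi>)) - cl \<phi> \<bullet> cl \<phi>" by (simp add: inner_add_left)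
  finally have "cl \<phi> \<bullet> cl \<phi> = - 2 * (cl (\<lambda>x. ?p x * \<phi> x) \<bullet> cl (partial_deriv i \<phi>))" by simp
  also have "\<dots> \<le> 2 * (norm (cl (\<lambda>x. ?p x * \<phi> x)) * norm (cl (partial_deriv i \<phi>)))"
    using Cauchy_Schwarz_ineq2[of "cl (\<lambda>x. ?p x * \<phi> x)" "cl (partial_deriv i \<phi>)"] by linarith
  also have "\<dots> \<le> 2 * ((\<bar>R\<bar> * norm (cl \<phi>)) * norm (cl (grad \<phi>)))"
  proof (intro mult_left_mono mult_mono)
    have "(norm (cl (\<lambda>x. ?p x * \<phi> x)))\<^sup>2 \<le> (\<bar>R\<bar> * norm (cl \<phi>))\<^sup>2"
    proof -
      have "L2_inner \<Omega> (\<lambda>x. ?p x * \<phi> x) (\<lambda>x. ?p x * \<phi> x) \<le> L2_inner \<Omega> (\<lambda>x. R *\<^sub>R \<phi> x) (\<lambda>x. R *\<^sub>R \<phi> x)"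
        unfolding L2_inner_def
      proof (rule integral_mono)
        show "integrable (lebesgue_on \<Omega>) (\<lambda>x. (?p x * \<phi> x) \<bullet> (?p x * \<phi> x))" using xT by (intro L2_inner_integrable) auto
        show "integrable (lebesgue_on \<Omega>) (\<lambda>x. R *\<^sub>R \<phi> x \<bullet> R *\<^sub>R \<phi> x)" using \<phi> by (intro L2_inner_integrable L2_scaleR) auto
        fix x assume "x \<in> space (lebesgue_on \<Omega>)"
        then have "x \<in> \<Omega>" by simp
        then have "\<bar>?p x\<bar> \<le> \<bar>R\<bar>" using bounded_\<Omega>[of x] component_le_norm_cart[of x i] by simp
        then have "(?p x)\<^sup>2 \<le> R\<^sup>2" by (simp add: abs_le_square_iff)
        then have "(?p x)\<^sup>2 * (\<phi> x)\<^sup>2 \<le> R\<^sup>2 * (\<phi> x)\<^sup>2" by (intro mult_right_mono) auto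
        then show "(?p x * \<phi> x) \<bullet> (?p x * \<phi> x) \<le> R *\<^sub>R \<phi> x \<bullet> R *\<^sub>R \<phi> x"
          by (simp add: power2_eq_square mult_ac)
      qed
      then have "(norm (cl (\<lambda>x. ?p x * \<phi> x)))\<^sup>2 \<le> (norm (cl (\<lambda>x. R *\<^sub>R \<phi> x)))\<^sup>2"
        using xT \<phi> unfolding power2_norm_eq_inner by (simp only: cls_inner meas test_L2 L2_scaleR)
      also have "cl (\<lambda>x. R *\<^sub>R \<phi> x) = R *\<^sub>R cl \<phi>" using \<phi> by (intro cls_scaleR) auto
      finally show ?thesis by simp
    qed
    then show "norm (cl (\<lambda>x. ?p x * \<phi> x)) \<le> \<bar>R\<bar> * norm (cl \<phi>)" by (rule power2_le_imp_le) simp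
    have "(norm (cl (partial_deriv i \<phi>)))\<^sup>2 \<le> (norm (cl (grad \<phi>)))\<^sup>2"
    proof -
      have "L2_inner \<Omega> (partial_deriv i \<phi>) (partial_deriv i \<phi>) \<le> L2_inner \<Omega> (grad \<phi>) (grad \<phi>)"
        unfolding L2_inner_def
      proof (rule integral_mono)
        show "integrable (lebesgue_on \<Omega>) (\<lambda>x. partial_deriv i \<phi> x \<bullet> partial_deriv i \<phi> x)" using \<phi> by (intro L2_inner_integrable) auto
        show "integrable (lebesgue_on \<Omega>) (\<lambda>x. grad \<phi> x \<bullet> grad \<phi> x)" using \<phi> by (intro L2_inner_integrable) auto
        fix x
        have "(norm (grad \<phi> x $ i))\<^sup>2 \<le> (norm (grad \<phi> x))\<^sup>2" by (intro power_mono) (simp_all add: component_le_norm_cart)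
        then show "partial_deriv i \<phi> x \<bullet> partial_deriv i \<phi> x \<le> grad \<phi> x \<bullet> grad \<phi> x"
          unfolding power2_norm_eq_inner by (simp add: grad_def)
      qed
      then show ?thesis using \<phi> unfolding power2_norm_eq_inner by (simp only: cls_inner meas test_L2 test_pd test_grad)
    qed
    then show "norm (cl (partial_deriv i \<phi>)) \<le> norm (cl (grad \<phi>))" by (rule power2_le_imp_le) simp
  qed auto
  finally have "norm (cl \<phi>) * norm (cl \<phi>) \<le> ((2 * \<bar>R\<bar>) * norm (cl (grad \<phi>))) * norm (cl \<phi>)"
    by (simp add: dot_square_norm power2_eq_square mult_ac)
  then show ?thesis using False by simp
qed simp

lemma poincare_Gr: "y \<in> Gr \<Longrightarrow> norm (fst y) \<le> (2 * \<bar>R\<bar>) * norm (snd y)"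
proof -
  have "Gr \<subseteq> {y. norm (fst y) \<le> (2 * \<bar>R\<bar>) * norm (snd y)}"
    unfolding Gr_def
  proof (rule closure_minimal)
    show "test_graph \<subseteq> {y. norm (fst y) \<le> (2 * \<bar>R\<bar>) * norm (snd y)}"
      using poincare_test by (auto simp: test_graph_def)
    show "closed {y :: (real^'n, real) l2 \<times> (real^'n, real^'n) l2. norm (fst y) \<le> (2 * \<bar>R\<bar>) * norm (snd y)}"
      by (intro closed_Collect_le continuous_intros)
  qed
  then show "y \<in> Gr \<Longrightarrow> norm (fst y) \<le> (2 * \<bar>R\<bar>) * norm (snd y)" by blast
qed

lemma H10_Gr: "u \<in> H10 \<Omega> \<Longrightarrow> (cl u, cl (weak_grad \<Omega> u)) \<in> Gr"
proof -
  assume u: "u \<in> H10 \<Omega>"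
  then have w: "wgrad u (weak_grad \<Omega> u)" by (intro H1_weak_grad) (simp add: H10_def)
  then have L: "u \<in> L2 \<Omega>" "weak_grad \<Omega> u \<in> L2 \<Omega>" by (auto simp: wgrad_def)
  show ?thesis unfolding Gr_def closure_approachable
  proof (intro allI impI)
    fix e :: real assume "e > 0"
    then obtain \<phi> where \<phi>: "\<phi> \<in> T" "H1_norm \<Omega> (\<lambda>x. u x - \<phi> x) < e" using u by (auto simp: H10_def)
    have "H1_norm \<Omega> (\<lambda>x. u x - \<phi> x) = norm ((cl u, cl (weak_grad \<Omega> u)) - (cl \<phi>, cl (grad \<phi>)))"
      using H1_norm_eq[OF wgrad_diff[OF w test_wgrad[OF \<phi>(1)]]] L \<phi> by (simp add: cls_diff)
    then have "dist (cl \<phi>, cl (grad \<phi>)) (cl u, cl (weak_grad \<Omega> u)) < e"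
      using \<phi>(2) by (subst dist_commute) (simp only: dist_norm)
    then show "\<exists>y\<in>test_graph. dist y (cl u, cl (weak_grad \<Omega> u)) < e"
      using \<phi>(1) unfolding test_graph_def by blast
  qed
qed

lemma Gr_H10:
  assumes "(cl u, y) \<in> Gr" "u \<in> L2 \<Omega>"
  shows "u \<in> H10 \<Omega>" "y = cl (weak_grad \<Omega> u)"
proof -
  obtain F where F: "F \<in> L2 \<Omega>" "y = cl F" using assms Gr_W by (auto simp: W_def L2_range_def)
  have w: "wgrad u F" using W_iff[OF assms(2) F(1)] assms(1) Gr_W F by auto
  show "y = cl (weak_grad \<Omega> u)" using wgrad_unique[OF w] F by simp
  show "u \<in> H10 \<Omega>" unfolding H10_def
  proof (intro CollectI conjI allI impI)
    show "u \<in> H1 \<Omega>" by (rule wgrad_unique[OF w])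
    fix e :: real assume "e > 0"
    then obtain \<phi> where \<phi>: "\<phi> \<in> T" "dist (cl \<phi>, cl (grad \<phi>)) (cl u, y) < e"
      using assms(1) unfolding Gr_def closure_approachable test_graph_def by auto
    have "H1_norm \<Omega> (\<lambda>x. u x - \<phi> x) = norm ((cl u, cl F) - (cl \<phi>, cl (grad \<phi>)))"
      using H1_norm_eq[OF wgrad_diff[OF w test_wgrad[OF \<phi>(1)]]] assms F \<phi> by (simp add: cls_diff)
    also have "\<dots> < e" using \<phi>(2) unfolding F(2) by (subst (asm) dist_commute) (simp only: dist_norm)
    finally show "\<exists>\<phi>\<in>T. H1_norm \<Omega> (\<lambda>x. u x - \<phi> x) < e" using \<phi>(1) by blast
  qed
qed

end

sublocale sobolev \<subseteq> fosls "L2_range \<Omega>" "L2_range \<Omega>" Gr "2 * \<bar>R\<bar>"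
proof (rule fosls.intro)
  show "Gr \<subseteq> L2_range \<Omega> \<times> L2_range \<Omega>" using Gr_W by (auto simp: W_def)
qed (rule closed_subspace_L2_range[OF meas] closed_subspace_Gr poincare_Gr; assumption?)+

context sobolev
begin

text \<open>The weak divergence is tested against test functions, \<open>D\<close> against all of
  \<open>Gr\<close>. The conditions agree because the identity is continuous in the graph norm and
  \<open>Gr\<close> is a closure.\<close>

lemma has_weak_div_iff:
  assumes "\<tau> \<in> L2 \<Omega>" "d \<in> L2 \<Omega>"
  shows "has_weak_div \<Omega> \<tau> d \<longleftrightarrow> (cl \<tau>, cl d) \<in> D"
proof -
  have "has_weak_div \<Omega> \<tau> d \<longleftrightarrow> (\<forall>\<phi>\<in>T. cl (grad \<phi>) \<bullet> cl \<tau> + cl \<phi> \<bullet> cl d = 0)"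
    unfolding has_weak_div_def grad_def[symmetric] using assms
    by (auto simp: cls_inner[symmetric] inner_commute eq_neg_iff_add_eq_0)
  also have "\<dots> \<longleftrightarrow> (\<forall>y\<in>test_graph. snd y \<bullet> cl \<tau> + fst y \<bullet> cl d = 0)" by (auto simp: test_graph_def)
  also have "\<dots> \<longleftrightarrow> (\<forall>y\<in>Gr. snd y \<bullet> cl \<tau> + fst y \<bullet> cl d = 0)"
  proof
    assume a: "\<forall>y\<in>test_graph. snd y \<bullet> cl \<tau> + fst y \<bullet> cl d = 0"
    have "Gr \<subseteq> {y. snd y \<bullet> cl \<tau> + fst y \<bullet> cl d = 0}"
      unfolding Gr_def by (rule closure_minimal) (use a in \<open>auto intro!: closed_Collect_eq continuous_intros\<close>)
    then show "\<forall>y\<in>Gr. snd y \<bullet> cl \<tau> + fst y \<bullet> cl d = 0" by blast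
  next
    assume "\<forall>y\<in>Gr. snd y \<bullet> cl \<tau> + fst y \<bullet> cl d = 0"
    then show "\<forall>y\<in>test_graph. snd y \<bullet> cl \<tau> + fst y \<bullet> cl d = 0"
      unfolding Gr_def using closure_subset by blast
  qed
  also have "\<dots> \<longleftrightarrow> (cl \<tau>, cl d) \<in> D" using assms by (simp add: D_def)
  finally show ?thesis .
qed

lemma D_single:
  assumes "(t, d) \<in> D" "(t, d') \<in> D" shows "d = d'"
proof -
  have "(t, d) - (t, d') \<in> D" using assms full.Dh.sub by (intro subspace_diff)
  then have dd: "(0, d - d') \<in> D" by simp
  have "d - d' = 0"
  proof (rule orthogonal_to_tests_imp_0)
    show "d - d' \<in> L2_range \<Omega>" using dd by (simp add: D_def)
    fix \<phi> assume "\<phi> \<in> T"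
    then have "(cl \<phi>, cl (grad \<phi>)) \<in> test_graph" by (simp add: test_graph_def)
    then have "(cl \<phi>, cl (grad \<phi>)) \<in> Gr" unfolding Gr_def using closure_subset by blast
    from D_green[OF dd this] show "(d - d') \<bullet> cl \<phi> = 0" by (simp add: inner_commute)
  qed
  then show ?thesis by simp
qed

lemma Hdiv_D: "\<tau> \<in> Hdiv \<Omega> \<Longrightarrow> (cl \<tau>, cl (weak_div \<Omega> \<tau>)) \<in> D"
  and Hdiv_L2: "\<tau> \<in> Hdiv \<Omega> \<Longrightarrow> \<tau> \<in> L2 \<Omega>" "\<tau> \<in> Hdiv \<Omega> \<Longrightarrow> weak_div \<Omega> \<tau> \<in> L2 \<Omega>"
proof -
  assume t: "\<tau> \<in> Hdiv \<Omega>"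
  then show L: "\<tau> \<in> L2 \<Omega>" by (simp add: Hdiv_def)
  have "\<exists>g. has_weak_div \<Omega> \<tau> g" using t by (simp add: Hdiv_def)
  then have w: "has_weak_div \<Omega> \<tau> (weak_div \<Omega> \<tau>)" unfolding weak_div_def by (rule someI_ex)
  then show L': "weak_div \<Omega> \<tau> \<in> L2 \<Omega>" by (simp add: has_weak_div_def)
  show "(cl \<tau>, cl (weak_div \<Omega> \<tau>)) \<in> D" using has_weak_div_iff[OF L L'] w by simp
qed

lemma D_Hdiv:
  assumes "(cl \<tau>, d) \<in> D" "\<tau> \<in> L2 \<Omega>"
  shows "\<tau> \<in> Hdiv \<Omega>" "d = cl (weak_div \<Omega> \<tau>)"
proof -
  have "d \<in> L2_range \<Omega>" using assms(1) by (simp add: D_def)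
  then obtain g where g: "g \<in> L2 \<Omega>" "d = cl g" by (auto simp: L2_range_def)
  then have "has_weak_div \<Omega> \<tau> g" using has_weak_div_iff assms by simp
  then show t: "\<tau> \<in> Hdiv \<Omega>" using assms by (auto simp: Hdiv_def)
  show "d = cl (weak_div \<Omega> \<tau>)" by (rule D_single[OF assms(1) Hdiv_D[OF t]])
qed

lemma Hdiv_norm_eq: "\<tau> \<in> Hdiv \<Omega> \<Longrightarrow> Hdiv_norm \<Omega> \<tau> = norm (cl \<tau>, cl (weak_div \<Omega> \<tau>))"
  by (simp add: Hdiv_norm_def norm_Pair cls_norm Hdiv_L2)

end

section \<open>The least-squares operator on function spaces\<close>

text \<open>Stated once for \<open>Dpair\<close> and \<open>Gpair\<close>. The generators span only
  modulo null sets, hence the hypothesis that \<open>p\<close> respects almost everywhere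
  equality.\<close>

lemma finite_dim_space_image:
  fixes p :: "('a::euclidean_space \<Rightarrow> 'b::euclidean_space) \<Rightarrow> 'c::real_vector"
  assumes fd: "finite_dim_space \<Omega> V"
    and add: "\<And>v w. v \<in> V \<Longrightarrow> w \<in> V \<Longrightarrow> p v + p w = p (\<lambda>x. v x + w x)"
    and scale: "\<And>v c. v \<in> V \<Longrightarrow> c *\<^sub>R p v = p (\<lambda>x. c *\<^sub>R v x)"
    and cong: "\<And>v w. v \<in> V \<Longrightarrow> w \<in> V \<Longrightarrow> AE x in lebesgue_on \<Omega>. v x = w x \<Longrightarrow> p v = p w"
  shows "subspace (p ` V)" "\<exists>B. finite B \<and> p ` V \<subseteq> span B"
proof -
  have V0: "(\<lambda>x. 0) \<in> V" and Vadd: "\<And>v w. v \<in> V \<Longrightarrow> w \<in> V \<Longrightarrow> (\<lambda>x. v x + w x) \<in> V"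
    and Vscale: "\<And>v c. v \<in> V \<Longrightarrow> (\<lambda>x. c *\<^sub>R v x) \<in> V"
    using fd by (simp_all add: finite_dim_space_def)
  have p0: "p (\<lambda>x. 0) = 0" using scale[OF V0, of 0] by simp
  show "subspace (p ` V)"
  proof (rule subspaceI)
    show "0 \<in> p ` V" using V0 p0 by (metis imageI)
    show "x + y \<in> p ` V" if "x \<in> p ` V" "y \<in> p ` V" for x y using that add Vadd by blast
    show "c *\<^sub>R x \<in> p ` V" if "x \<in> p ` V" for c x using that scale Vscale by blast
  qed
  have "\<exists>n b. (\<forall>k<n::nat. b k \<in> V) \<and>
        (\<forall>v\<in>V. \<exists>c::nat \<Rightarrow> real. AE x in lebesgue_on \<Omega>. v x = (\<Sum>k<n. c k *\<^sub>R b k x))"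
    using fd unfolding finite_dim_space_def by (elim conjE)
  then obtain n b where nb: "(\<forall>k<n::nat. b k \<in> V) \<and>
        (\<forall>v\<in>V. \<exists>c::nat \<Rightarrow> real. AE x in lebesgue_on \<Omega>. v x = (\<Sum>k<n. c k *\<^sub>R b k x))"
    by (elim exE)
  have b: "b k \<in> V" if "k < n" for k using nb that by blast
  have "p v \<in> span (p ` b ` {..<n})" if v: "v \<in> V" for v
  proof -
    obtain c :: "nat \<Rightarrow> real" where c: "AE x in lebesgue_on \<Omega>. v x = (\<Sum>k<n. c k *\<^sub>R b k x)"
      using bspec[OF conjunct2[OF nb] v] by blast
    \<comment> \<open>Membership in \<open>V\<close> is carried along because additivity of
      \<open>p\<close> is assumed on \<open>V\<close> only.\<close>
    have sum: "l \<le> n \<Longrightarrow> (\<lambda>x. \<Sum>k<l. c k *\<^sub>R b k x) \<in> V \<and>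
        p (\<lambda>x. \<Sum>k<l. c k *\<^sub>R b k x) = (\<Sum>k<l. c k *\<^sub>R p (b k))" for l
    proof (induct l)
      case 0 then show ?case using V0 p0 by simp
    next
      case (Suc l)
      then have IH: "(\<lambda>x. \<Sum>k<l. c k *\<^sub>R b k x) \<in> V"
          "p (\<lambda>x. \<Sum>k<l. c k *\<^sub>R b k x) = (\<Sum>k<l. c k *\<^sub>R p (b k))" and bl: "b l \<in> V"
        using b by simp_all
      show ?case
        using Vadd[OF IH(1) Vscale[OF bl, of "c l"]] add[OF IH(1) Vscale[OF bl, of "c l"]]
          scale[OF bl, of "c l"] IH(2) by simp
    qed
    have "p v = (\<Sum>k<n. c k *\<^sub>R p (b k))" using cong[OF v _ c] sum[of n] by simp
    also have "\<dots> \<in> span (p ` b ` {..<n})" by (intro span_sum span_scale span_base) auto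
    finally show ?thesis .
  qed
  then show "\<exists>B. finite B \<and> p ` V \<subseteq> span B" by (intro exI[of _ "p ` b ` {..<n}"]) auto
qed

lemma (in fosls_pair) sol_scale:
  assumes "sol Dh Gh f x y" shows "sol Dh Gh (c *\<^sub>R f) (c *\<^sub>R x) (c *\<^sub>R y)"
proof -
  have "c * (x \<bullet> z - snd y \<bullet> fst z) = c * - (f \<bullet> snd z)" if "z \<in> Dh" for z using assms that by (simp add: sol_def)
  then show ?thesis using assms Dh.sub Gh.sub by (simp add: sol_def subspace_scale algebra_simps)
qed

section \<open>Functions as elements of the graphs\<close>

context sobolev
begin

definition Dpair :: "(real^'n \<Rightarrow> real^'n) \<Rightarrow> (real^'n, real^'n) l2 \<times> (real^'n, real) l2" where
  "Dpair \<tau> = (cl \<tau>, cl (weak_div \<Omega> \<tau>))"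

definition Gpair :: "(real^'n \<Rightarrow> real) \<Rightarrow> (real^'n, real) l2 \<times> (real^'n, real^'n) l2" where
  "Gpair u = (cl u, cl (weak_grad \<Omega> u))"

lemma Dpair_simps [simp]: "fst (Dpair \<tau>) = cl \<tau>" "snd (Dpair \<tau>) = cl (weak_div \<Omega> \<tau>)"
  by (simp_all add: Dpair_def)

lemma Gpair_simps [simp]: "fst (Gpair u) = cl u" "snd (Gpair u) = cl (weak_grad \<Omega> u)"
  by (simp_all add: Gpair_def)

lemma H10_L2: "u \<in> H10 \<Omega> \<Longrightarrow> u \<in> L2 \<Omega>" "u \<in> H10 \<Omega> \<Longrightarrow> weak_grad \<Omega> u \<in> L2 \<Omega>" "u \<in> H10 \<Omega> \<Longrightarrow> wgrad u (weak_grad \<Omega> u)"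
  using H1_weak_grad[of u] by (auto simp: H10_def wgrad_def)

lemma Dpair_in: "\<tau> \<in> Hdiv \<Omega> \<Longrightarrow> Dpair \<tau> \<in> D" unfolding Dpair_def by (rule Hdiv_D)
lemma Gpair_in: "u \<in> H10 \<Omega> \<Longrightarrow> Gpair u \<in> Gr" unfolding Gpair_def by (rule H10_Gr)

text \<open>An element of the graph is determined by its first component, so identities between such
  pairs reduce to identities in L2.\<close>

lemma Dpair_eqI: "x \<in> D \<Longrightarrow> fst x = cl \<tau> \<Longrightarrow> \<tau> \<in> L2 \<Omega> \<Longrightarrow> \<tau> \<in> Hdiv \<Omega> \<and> x = Dpair \<tau>"
  using D_Hdiv[of \<tau> "snd x"] unfolding Dpair_def by (cases x) auto

lemma Gpair_eqI: "y \<in> Gr \<Longrightarrow> fst y = cl u \<Longrightarrow> u \<in> L2 \<Omega> \<Longrightarrow> u \<in> H10 \<Omega> \<and> y = Gpair u"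
  using Gr_H10[of u "snd y"] unfolding Gpair_def by (cases y) auto

lemma Gpair_sum:
  assumes "finite F" "\<And>k. k \<in> F \<Longrightarrow> b k \<in> H10 \<Omega>"
  shows "(\<lambda>x. \<Sum>k\<in>F. c k *\<^sub>R b k x) \<in> H10 \<Omega> \<and> (\<Sum>k\<in>F. c k *\<^sub>R Gpair (b k)) = Gpair (\<lambda>x. \<Sum>k\<in>F. c k *\<^sub>R b k x)"
proof (rule Gpair_eqI)
  show "(\<Sum>k\<in>F. c k *\<^sub>R Gpair (b k)) \<in> Gr"
    using closed_subspace.sub[OF closed_subspace_Gr] Gpair_in assms(2) by (intro subspace_sum subspace_scale) auto
  show "fst (\<Sum>k\<in>F. c k *\<^sub>R Gpair (b k)) = cl (\<lambda>x. \<Sum>k\<in>F. c k *\<^sub>R b k x)"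
    unfolding fst_sum fst_scaleR Gpair_simps
    by (rule cls_sum[OF meas assms(1), symmetric]) (use assms(2) H10_L2 in blast)
  show "(\<lambda>x. \<Sum>k\<in>F. c k *\<^sub>R b k x) \<in> L2 \<Omega>" using assms H10_L2 by (intro L2_sum) auto
qed

lemma Dpair_add:
  assumes "\<sigma> \<in> Hdiv \<Omega>" "\<tau> \<in> Hdiv \<Omega>"
  shows "Dpair \<sigma> + Dpair \<tau> = Dpair (\<lambda>x. \<sigma> x + \<tau> x)"
  by (rule Dpair_eqI[THEN conjunct2])
    (simp_all add: assms subspace_add[OF full.Dh.sub] Dpair_in cls_add Hdiv_L2 L2_add)

lemma Dpair_diff:
  assumes "\<sigma> \<in> Hdiv \<Omega>" "\<tau> \<in> Hdiv \<Omega>"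
  shows "(\<lambda>x. \<sigma> x - \<tau> x) \<in> Hdiv \<Omega> \<and> Dpair \<sigma> - Dpair \<tau> = Dpair (\<lambda>x. \<sigma> x - \<tau> x)"
  by (rule Dpair_eqI)
    (simp_all add: assms subspace_diff[OF full.Dh.sub] Dpair_in cls_diff Hdiv_L2 L2_diff)

lemma Dpair_scale:
  assumes "\<sigma> \<in> Hdiv \<Omega>" shows "c *\<^sub>R Dpair \<sigma> = Dpair (\<lambda>x. c *\<^sub>R \<sigma> x)"
  by (rule Dpair_eqI[THEN conjunct2])
    (simp_all add: assms subspace_scale[OF full.Dh.sub] Dpair_in cls_scaleR Hdiv_L2 L2_scaleR)

lemma Gpair_add:
  assumes "u \<in> H10 \<Omega>" "v \<in> H10 \<Omega>"
  shows "Gpair u + Gpair v = Gpair (\<lambda>x. u x + v x)"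
  by (rule Gpair_eqI[THEN conjunct2])
    (simp_all add: assms subspace_add[OF full.Gh.sub] Gpair_in cls_add H10_L2 L2_add)

lemma Gpair_diff:
  assumes "u \<in> H10 \<Omega>" "v \<in> H10 \<Omega>"
  shows "(\<lambda>x. u x - v x) \<in> H10 \<Omega> \<and> Gpair u - Gpair v = Gpair (\<lambda>x. u x - v x)"
  by (rule Gpair_eqI)
    (simp_all add: assms subspace_diff[OF full.Gh.sub] Gpair_in cls_diff H10_L2 L2_diff)

lemma Gpair_scale:
  assumes "u \<in> H10 \<Omega>" shows "c *\<^sub>R Gpair u = Gpair (\<lambda>x. c *\<^sub>R u x)"
proof (rule Gpair_eqI[THEN conjunct2])
  show "c *\<^sub>R Gpair u \<in> Gr" by (rule subspace_scale[OF full.Gh.sub Gpair_in[OF assms]])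
  show "fst (c *\<^sub>R Gpair u) = cl (\<lambda>x. c *\<^sub>R u x)"
    by (simp only: fst_scaleR Gpair_simps cls_scaleR[OF meas H10_L2(1)[OF assms]])
  show "(\<lambda>x. c *\<^sub>R u x) \<in> L2 \<Omega>" by (rule L2_scaleR[OF H10_L2(1)[OF assms]])
qed

lemma Hdiv_norm_diff: "\<sigma> \<in> Hdiv \<Omega> \<Longrightarrow> \<tau> \<in> Hdiv \<Omega> \<Longrightarrow> Hdiv_norm \<Omega> (\<lambda>x. \<sigma> x - \<tau> x) = norm (Dpair \<sigma> - Dpair \<tau>)"
  using Dpair_diff[of \<sigma> \<tau>] by (simp add: Hdiv_norm_eq Dpair_def[symmetric])

lemma H1_norm_diff: "u \<in> H10 \<Omega> \<Longrightarrow> v \<in> H10 \<Omega> \<Longrightarrow> H1_norm \<Omega> (\<lambda>x. u x - v x) = norm (Gpair u - Gpair v)"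
  using Gpair_diff[of u v] H1_norm_eq[OF H10_L2(3), of "\<lambda>x. u x - v x"] by (simp add: Gpair_def[symmetric])

lemma Dpair_image_D: "Dpair ` Hdiv \<Omega> = D"
proof
  show "Dpair ` Hdiv \<Omega> \<subseteq> D" using Dpair_in by blast
  show "D \<subseteq> Dpair ` Hdiv \<Omega>"
  proof
    fix x assume x: "x \<in> D"
    then have "fst x \<in> L2_range \<Omega>" by (simp add: D_def)
    then obtain \<tau> where "\<tau> \<in> L2 \<Omega>" "fst x = cl \<tau>" by (auto simp: L2_range_def)
    then show "x \<in> Dpair ` Hdiv \<Omega>" using Dpair_eqI[OF x] by blast
  qed
qed

lemma Gpair_image_Gr: "Gpair ` H10 \<Omega> = Gr"
proof
  show "Gpair ` H10 \<Omega> \<subseteq> Gr" using Gpair_in by blast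
  show "Gr \<subseteq> Gpair ` H10 \<Omega>"
  proof
    fix y assume y: "y \<in> Gr"
    then obtain u where "u \<in> L2 \<Omega>" "fst y = cl u" using GLV by (auto simp: L2_range_def mem_Times_iff)
    then show "y \<in> Gpair ` H10 \<Omega>" using Gpair_eqI[OF y] by blast
  qed
qed

lemma Dpair_cong_AE:
  assumes "\<sigma> \<in> Hdiv \<Omega>" "\<tau> \<in> Hdiv \<Omega>" "AE x in lebesgue_on \<Omega>. \<sigma> x = \<tau> x"
  shows "Dpair \<sigma> = Dpair \<tau>"
proof (rule Dpair_eqI[THEN conjunct2])
  show "fst (Dpair \<sigma>) = cl \<tau>"
    using cls_eq_iff[OF meas Hdiv_L2(1)[OF assms(1)] Hdiv_L2(1)[OF assms(2)]] assms(3) by simp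
qed (simp_all add: assms Dpair_in Hdiv_L2)

lemma Gpair_cong_AE:
  assumes "u \<in> H10 \<Omega>" "v \<in> H10 \<Omega>" "AE x in lebesgue_on \<Omega>. u x = v x"
  shows "Gpair u = Gpair v"
proof (rule Gpair_eqI[THEN conjunct2])
  show "fst (Gpair u) = cl v"
    using cls_eq_iff[OF meas H10_L2(1)[OF assms(1)] H10_L2(1)[OF assms(2)]] assms(3) by simp
qed (simp_all add: assms Gpair_in H10_L2)

lemma finite_dim_Dpair:
  assumes "finite_dim_space \<Omega> V" "V \<subseteq> Hdiv \<Omega>"
  shows "subspace (Dpair ` V)" "\<exists>B. finite B \<and> Dpair ` V \<subseteq> span B"
proof -
  show "subspace (Dpair ` V)"
    by (rule finite_dim_space_image(1)[OF assms(1)];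
        intro Dpair_add Dpair_scale Dpair_cong_AE subsetD[OF assms(2)])
  show "\<exists>B. finite B \<and> Dpair ` V \<subseteq> span B"
    by (rule finite_dim_space_image(2)[OF assms(1)];
        intro Dpair_add Dpair_scale Dpair_cong_AE subsetD[OF assms(2)])
qed

lemma finite_dim_Gpair:
  assumes "finite_dim_space \<Omega> V" "V \<subseteq> H10 \<Omega>"
  shows "subspace (Gpair ` V)" "\<exists>B. finite B \<and> Gpair ` V \<subseteq> span B"
proof -
  show "subspace (Gpair ` V)"
    by (rule finite_dim_space_image(1)[OF assms(1)];
        intro Gpair_add Gpair_scale Gpair_cong_AE subsetD[OF assms(2)])
  show "\<exists>B. finite B \<and> Gpair ` V \<subseteq> span B"
    by (rule finite_dim_space_image(2)[OF assms(1)];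
        intro Gpair_add Gpair_scale Gpair_cong_AE subsetD[OF assms(2)])
qed

text \<open>\<open>weak_partial\<close> is a choice from a predicate that depends on the class
  alone, so equivalent functions share literally the same chosen derivatives.\<close>

lemma H1s_cong:
  assumes "u \<in> H1s \<Omega> s" "v \<in> L2 \<Omega>" "cl v = cl u"
  shows "v \<in> H1s \<Omega> s"
proof -
  have u: "u \<in> L2 \<Omega>" using assms(1) by (auto simp: H1s_def H1_def)
  have eq: "has_weak_partial \<Omega> i v = has_weak_partial \<Omega> i u" for i
    by (rule ext) (simp add: has_weak_partial_iff[OF u] has_weak_partial_iff[OF assms(2)] assms(3))
  then have "weak_partial \<Omega> i v = weak_partial \<Omega> i u" for i by (simp add: weak_partial_def)
  then show ?thesis using assms(1,2) by (simp add: H1s_def H1_def eq)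
qed

lemma dirichlet_regular:
  assumes reg: "dirichlet_regularity \<Omega> s" and u: "u \<in> H10 \<Omega>" and f: "f \<in> L2_range \<Omega>"
    and weak: "\<And>w. w \<in> Gr \<Longrightarrow> snd (Gpair u) \<bullet> snd w = f \<bullet> fst w"
  shows "u \<in> H1s \<Omega> s"
proof -
  obtain g where g: "g \<in> L2 \<Omega>" "f = cl g" using f by (auto simp: L2_range_def)
  have "L2_inner \<Omega> (weak_grad \<Omega> u) (weak_grad \<Omega> v) = L2_inner \<Omega> g v" if "v \<in> H10 \<Omega>" for v
    using weak[OF Gpair_in[OF that]] u that g by (simp add: Gpair_def cls_inner H10_L2)
  then show ?thesis using reg g(1) u unfolding dirichlet_regularity_def by blast
qed

lemma S_regular:
  assumes reg: "dirichlet_regularity \<Omega> s"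
  obtains a \<xi> where "a \<in> H1s \<Omega> s \<inter> H10 \<Omega>" "proj (K Gr) (proj D x) = (snd (Gpair a), 0)"
    "\<xi> \<in> Hs_vec \<Omega> s" "\<xi> \<in> Hdiv \<Omega>" "weak_div \<Omega> \<xi> \<in> H1s \<Omega> s" "S D Gr x = Dpair \<xi>"
proof -
  obtain d p e where d: "d \<in> L2_range \<Omega>" and p: "p \<in> Gr" and e: "e \<in> Gr"
    and pr: "proj (K Gr) (proj D x) = (snd p, 0)" and Sx: "S D Gr x = (snd p + snd e, fst e)"
    and wp: "\<And>w. w \<in> Gr \<Longrightarrow> snd p \<bullet> snd w = - (d \<bullet> fst w)"
    and we: "\<And>w. w \<in> Gr \<Longrightarrow> snd (p + e) \<bullet> snd w = - (fst e \<bullet> fst w)"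
    by (rule S_structure[of x]) (rule that; blast)
  interpret L: closed_subspace "L2_range \<Omega> :: (real^'n, real) l2 set" by (rule closed_subspace_L2_range[OF meas])
  obtain a where a: "a \<in> H10 \<Omega>" "p = Gpair a" using p Gpair_image_Gr by blast
  obtain b where b: "b \<in> H10 \<Omega>" "e = Gpair b" using e Gpair_image_Gr by blast
  have "p + e \<in> Gr" using p e full.Gh.sub by (intro subspace_add)
  then obtain r where r: "r \<in> H10 \<Omega>" "p + e = Gpair r" using Gpair_image_Gr by blast
  have feL: "fst e \<in> L2_range \<Omega>" using e GLV by (auto simp: mem_Times_iff)
  have aS: "a \<in> H1s \<Omega> s"
    by (rule dirichlet_regular[OF reg a(1), of "- d"]) (use wp a d L.sub in \<open>auto simp: subspace_neg\<close>)
  have rS: "r \<in> H1s \<Omega> s"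
    by (rule dirichlet_regular[OF reg r(1), of "- fst e"]) (use we r feL L.sub in \<open>auto simp: subspace_neg\<close>)
  have bS: "b \<in> H1s \<Omega> s"
  proof (rule dirichlet_regular[OF reg b(1), of "d - fst e"])
    show "d - fst e \<in> L2_range \<Omega>" using d feL L.sub by (intro subspace_diff)
    fix w assume w: "w \<in> Gr"
    then show "snd (Gpair b) \<bullet> snd w = (d - fst e) \<bullet> fst w"
      using wp[OF w] we[OF w] b by (simp add: inner_add inner_diff)
  qed
  \<comment> \<open>The representative matters: the components of this one are the chosen partial
    derivatives of \<open>r\<close>, which membership of \<open>r\<close> in \<open>H1s\<close>
    places in \<open>Hs\<close>.\<close>
  let ?\<xi> = "weak_grad \<Omega> r"
  have \<xi>L: "?\<xi> \<in> L2 \<Omega>" using r H10_L2 by blast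
  have "snd p + snd e = cl ?\<xi>" using arg_cong[OF r(2), of snd] by (simp add: Gpair_def)
  then have fS: "fst (S D Gr x) = cl ?\<xi>" by (simp add: Sx)
  have \<xi>: "?\<xi> \<in> Hdiv \<Omega>" "S D Gr x = Dpair ?\<xi>" using Dpair_eqI[OF full.S_in fS \<xi>L] by auto
  have "cl (weak_div \<Omega> ?\<xi>) = cl b" using arg_cong[OF \<xi>(2), of snd] Sx b by (simp add: Dpair_def Gpair_def)
  then have "weak_div \<Omega> ?\<xi> \<in> H1s \<Omega> s" by (intro H1s_cong[OF bS] Hdiv_L2 \<xi>(1))
  moreover have "?\<xi> \<in> Hs_vec \<Omega> s" using rS by (simp add: Hs_vec_def weak_grad_def H1s_def)
  ultimately show thesis using that[of a ?\<xi>] aS a pr \<xi> by simp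
qed

end

text \<open>Closedness is assumed instead of finite dimension, so that the continuous problem is an
  instance as well and the correspondence of eigenvalues is proved once for both.\<close>

locale discretization = sobolev +
  fixes Sg and U
  assumes Sg: "Sg \<subseteq> Hdiv \<Omega>" and U: "U \<subseteq> H10 \<Omega>"
    and cSg: "closed_subspace (Dpair ` Sg)" and cU: "closed_subspace (Gpair ` U)"
begin

sublocale fosls_pair "L2_range \<Omega>" "L2_range \<Omega>" Gr "2 * \<bar>R\<bar>" "Dpair ` Sg" "Gpair ` U"
proof
  show "Dpair ` Sg \<subseteq> D" using Sg Dpair_in by blast
  show "Gpair ` U \<subseteq> Gr" using U Gpair_in by blast
qed (use cSg cU in \<open>auto simp: closed_subspace_def\<close>)

abbreviation Dg where "Dg \<equiv> Dpair ` Sg"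
abbreviation Gg where "Gg \<equiv> Gpair ` U"

lemma F1_solution_iff:
  assumes "f \<in> L2 \<Omega>" "\<sigma> \<in> Sg" "v \<in> U"
  shows "F1_solution \<Omega> Sg U f \<sigma> v \<longleftrightarrow> sol Dg Gg (cl f) (Dpair \<sigma>) (Gpair v)"
proof -
  have H: "\<sigma> \<in> Hdiv \<Omega>" "v \<in> H10 \<Omega>" using assms Sg U by auto
  have 1: "L2_inner \<Omega> \<sigma> \<tau> + L2_inner \<Omega> (weak_div \<Omega> \<sigma>) (weak_div \<Omega> \<tau>) - L2_inner \<Omega> (weak_grad \<Omega> v) \<tau>
      = Dpair \<sigma> \<bullet> Dpair \<tau> - snd (Gpair v) \<bullet> fst (Dpair \<tau>)"
    "L2_inner \<Omega> f (weak_div \<Omega> \<tau>) = cl f \<bullet> snd (Dpair \<tau>)" if "\<tau> \<in> Sg" for \<tau>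
    using that Sg H assms(1) by (auto simp: Dpair_def Gpair_def cls_inner Hdiv_L2 H10_L2 subset_iff)
  have 2: "(- L2_inner \<Omega> \<sigma> (weak_grad \<Omega> w) + L2_inner \<Omega> (weak_grad \<Omega> v) (weak_grad \<Omega> w) = 0)
      \<longleftrightarrow> snd (Gpair v) \<bullet> snd (Gpair w) = fst (Dpair \<sigma>) \<bullet> snd (Gpair w)" if "w \<in> U" for w
    using that U H by (auto simp: Dpair_def Gpair_def cls_inner Hdiv_L2 H10_L2 subset_iff)
  show ?thesis unfolding F1_solution_def sol_def using assms(2,3) 1 2 by auto
qed

lemma F1_operator_spec:
  assumes f: "f \<in> L2 \<Omega>"
  shows "F1_operator \<Omega> Sg U f \<in> U" "\<exists>x. sol Dg Gg (cl f) x (Gpair (F1_operator \<Omega> Sg U f))"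
proof -
  obtain x y where s: "sol Dg Gg (cl f) x y" using sol_exists by blast
  then obtain \<sigma> v where "\<sigma> \<in> Sg" "v \<in> U" "x = Dpair \<sigma>" "y = Gpair v" by (auto simp: sol_def)
  then have "\<exists>v \<sigma>. F1_solution \<Omega> Sg U f \<sigma> v" using F1_solution_iff[OF f] s by blast
  then have "\<exists>\<sigma>. F1_solution \<Omega> Sg U f \<sigma> (F1_operator \<Omega> Sg U f)" unfolding F1_operator_def by (rule someI_ex)
  then obtain \<sigma> where F: "F1_solution \<Omega> Sg U f \<sigma> (F1_operator \<Omega> Sg U f)" by blast
  then have "\<sigma> \<in> Sg" and 1: "F1_operator \<Omega> Sg U f \<in> U" by (auto simp: F1_solution_def)
  then show "F1_operator \<Omega> Sg U f \<in> U" "\<exists>x. sol Dg Gg (cl f) x (Gpair (F1_operator \<Omega> Sg U f))"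
    using F1_solution_iff[OF f, of \<sigma>] F by blast+
qed

text \<open>The flux of the k-th eigenpair by the formula of \<open>eigen_of_sol\<close>, so that no
  choice of a solution is involved.\<close>

definition eigvec :: "(nat \<Rightarrow> real) \<Rightarrow> (nat \<Rightarrow> real^'a \<Rightarrow> real) \<Rightarrow> nat \<Rightarrow> (real^'a, real^'a) l2 \<times> (real^'a, real) l2" where
  "eigvec lam u k = (1 + lam k) *\<^sub>R proj Dg (snd (Gpair (u k)), 0)"

text \<open>A priori \<open>u k\<close> is only in L2. Being almost everywhere \<open>lam k\<close>
  times a value of the operator, it inherits membership in H10, and scaling the solution for the
  data \<open>u k\<close> by \<open>lam k\<close> gives the eigenvalue equation.\<close>

lemma eigenfunction_sol:
  assumes en: "eigen_enumeration \<Omega> (F1_operator \<Omega> Sg U) I lam u" and k: "k \<in> I"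
  shows "0 < lam k" "u k \<in> H10 \<Omega>" "Gpair (u k) \<in> Gg" "\<exists>x. sol Dg Gg (lam k *\<^sub>R fst (Gpair (u k))) x (Gpair (u k))"
proof -
  from en k have e: "0 < lam k" "u k \<in> L2 \<Omega>" "AE x in lebesgue_on \<Omega>. F1_operator \<Omega> Sg U (u k) x = (1 / lam k) * u k x"
    unfolding eigen_enumeration_def by blast+
  then show l: "0 < lam k" by simp
  let ?v = "F1_operator \<Omega> Sg U (u k)"
  obtain x where v: "?v \<in> U" "sol Dg Gg (cl (u k)) x (Gpair ?v)" using F1_operator_spec[OF e(2)] by blast
  have vH: "?v \<in> H10 \<Omega>" using v U by blast
  have "AE x in lebesgue_on \<Omega>. ?v x = (1 / lam k) *\<^sub>R u k x" using e(3) by simp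
  then have "cl ?v = cl (\<lambda>x. (1 / lam k) *\<^sub>R u k x)"
    using cls_eq_iff[OF meas H10_L2(1)[OF vH] L2_scaleR[OF e(2)]] by blast
  then have c: "lam k *\<^sub>R cl ?v = cl (u k)" using l by (simp add: cls_scaleR[OF meas e(2), of "1 / lam k", simplified])
  have s: "sol Dg Gg (lam k *\<^sub>R cl (u k)) (lam k *\<^sub>R x) (lam k *\<^sub>R Gpair ?v)" by (rule sol_scale[OF v(2)])
  then have g: "lam k *\<^sub>R Gpair ?v \<in> Gg" by (simp add: sol_def)
  have p: "u k \<in> H10 \<Omega> \<and> lam k *\<^sub>R Gpair ?v = Gpair (u k)"
  proof (rule Gpair_eqI)
    show "lam k *\<^sub>R Gpair ?v \<in> Gr" using g Gh(2) by blast
    show "fst (lam k *\<^sub>R Gpair ?v) = cl (u k)" by (simp add: c)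
  qed (rule e(2))
  then show "u k \<in> H10 \<Omega>" "Gpair (u k) \<in> Gg" using g by auto
  have "sol Dg Gg (lam k *\<^sub>R cl (u k)) (lam k *\<^sub>R x) (Gpair (u k))" using s p by simp
  then show "\<exists>x. sol Dg Gg (lam k *\<^sub>R fst (Gpair (u k))) x (Gpair (u k))" unfolding Gpair_simps by blast
qed

lemma eigvec_props:
  assumes en: "eigen_enumeration \<Omega> (F1_operator \<Omega> Sg U) I lam u" and k: "k \<in> I"
  shows "sol Dg Gg (lam k *\<^sub>R fst (Gpair (u k))) (eigvec lam u k) (Gpair (u k))"
    "proj (K Gg) (eigvec lam u k) = (snd (Gpair (u k)), 0)"
    "S Dg Gg (eigvec lam u k) = (1 / (1 + lam k)) *\<^sub>R eigvec lam u k"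
proof -
  obtain x where x: "sol Dg Gg (lam k *\<^sub>R fst (Gpair (u k))) x (Gpair (u k))" using eigenfunction_sol[OF assms] by blast
  note e = eigen_of_sol[OF x eigenfunction_sol(1)[OF assms]]
  have "eigvec lam u k = x" unfolding eigvec_def using e(1) by simp
  then show "sol Dg Gg (lam k *\<^sub>R fst (Gpair (u k))) (eigvec lam u k) (Gpair (u k))"
    "proj (K Gg) (eigvec lam u k) = (snd (Gpair (u k)), 0)"
    "S Dg Gg (eigvec lam u k) = (1 / (1 + lam k)) *\<^sub>R eigvec lam u k" using x e by auto
qed

lemma eigen_system_S:
  assumes en: "eigen_enumeration \<Omega> (F1_operator \<Omega> Sg U) I lam u"
  shows "eigen_system (S Dg Gg) I (\<lambda>k. 1 / (1 + lam k)) (eigvec lam u)"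
proof -
  note l0 = eigenfunction_sol(1)[OF en]
  note uH = eigenfunction_sol(2)[OF en]
  have uL: "u k \<in> L2 \<Omega>" if "k \<in> I" for k using uH[OF that] H10_L2 by blast
  have "mono_on I lam" using en unfolding eigen_enumeration_def by (elim conjE)
  then have mono: "lam j \<le> lam k" if "j \<in> I" "k \<in> I" "j \<le> k" for j k
    using that by (auto dest: mono_onD)
  have indep: "\<forall>k\<in>F. c k = 0" if F: "finite F" "F \<subseteq> I" and z: "(\<Sum>k\<in>F. c k *\<^sub>R eigvec lam u k) = 0" for F c
  proof -
    \<comment> \<open>The projection takes fluxes to gradients. Poincare then transfers the relation
      to the eigenfunctions, whose independence is part of the enumeration.\<close>
    have "proj (K Gg) (\<Sum>k\<in>F. c k *\<^sub>R eigvec lam u k) = (\<Sum>k\<in>F. c k *\<^sub>R (snd (Gpair (u k)), 0))"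
      unfolding linear_sum[OF Kh.linear_proj] linear_scale[OF Kh.linear_proj]
      using F(2) by (intro sum.cong refl) (auto simp: eigvec_props(2)[OF en])
    then have "(\<Sum>k\<in>F. c k *\<^sub>R (snd (Gpair (u k)), 0 :: (real^'a, real) l2)) = 0" using z linear_0[OF Kh.linear_proj] by simp
    then have "fst (\<Sum>k\<in>F. c k *\<^sub>R (snd (Gpair (u k)), 0 :: (real^'a, real) l2)) = 0" by simp
    then have s0: "snd (\<Sum>k\<in>F. c k *\<^sub>R Gpair (u k)) = 0" by (simp add: fst_sum snd_sum)
    have H: "(\<lambda>x. \<Sum>k\<in>F. c k *\<^sub>R u k x) \<in> H10 \<Omega>" "(\<Sum>k\<in>F. c k *\<^sub>R Gpair (u k)) = Gpair (\<lambda>x. \<Sum>k\<in>F. c k *\<^sub>R u k x)"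
      using Gpair_sum[OF F(1), of u c] F(2) uH by auto
    have "norm (fst (Gpair (\<lambda>x. \<Sum>k\<in>F. c k *\<^sub>R u k x))) \<le> 0"
      using poincare_Gr[OF Gpair_in[OF H(1)]] s0 H(2) by simp
    then have "cl (\<lambda>x. \<Sum>k\<in>F. c k *\<^sub>R u k x) = cl (\<lambda>x. 0)" by (simp add: Gpair_def cls_zero)
    then have "AE x in lebesgue_on \<Omega>. (\<Sum>k\<in>F. c k *\<^sub>R u k x) = 0"
      using cls_eq_iff[OF meas H10_L2(1)[OF H(1)] L2_zero] by simp
    then have "AE x in lebesgue_on \<Omega>. (\<Sum>k\<in>F. c k * u k x) = 0" by simp
    then show ?thesis using en F unfolding eigen_enumeration_def by blast
  qed
  have compl: "y \<in> span (eigvec lam u ` {k\<in>I. 1 / (1 + lam k) = \<mu>})" if \<mu>: "0 < \<mu>" and y: "S Dg Gg y = \<mu> *\<^sub>R y" for \<mu> y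
  proof (cases "y = 0")
    case True then show ?thesis by (simp add: span_zero)
  next
    case False
    note se = sol_of_eigen[OF y \<mu> False]
    obtain y' where y': "y' \<in> Gg" "y = (1 / \<mu>) *\<^sub>R proj Dg (snd y', 0)" "sol Dg Gg ((1 / \<mu> - 1) *\<^sub>R fst y') y y'"
      using se(2) by blast
    obtain v where v: "v \<in> U" "y' = Gpair v" using y'(1) by blast
    have vH: "v \<in> H10 \<Omega>" using v U by blast
    then have vL: "v \<in> L2 \<Omega>" by (rule H10_L2)
    \<comment> \<open>The \<lambda> with \<open>\<mu> = 1 / (1 + \<lambda>)\<close>; it is positive
      because \<open>sol_of_eigen\<close> gives \<open>\<mu> < 1\<close>.\<close>
    define r where "r = 1 / \<mu> - 1"
    have r: "r > 0" using se(1) \<mu> by (simp add: r_def)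
    have "sol Dg Gg ((1 / r) *\<^sub>R r *\<^sub>R fst y') ((1 / r) *\<^sub>R y) ((1 / r) *\<^sub>R y')"
      using sol_scale[OF y'(3)] by (simp only: r_def)
    then have s1: "sol Dg Gg (cl v) ((1 / r) *\<^sub>R y) ((1 / r) *\<^sub>R y')" using r v by (simp add: Gpair_def)
    let ?t = "F1_operator \<Omega> Sg U v"
    obtain x where t: "?t \<in> U" "sol Dg Gg (cl v) x (Gpair ?t)" using F1_operator_spec[OF vL] by blast
    have tL: "?t \<in> L2 \<Omega>" using t U H10_L2 by blast
    have "Gpair ?t = (1 / r) *\<^sub>R y'" by (rule sol_unique(2)[OF t(2) s1])
    then have "cl ?t = cl (\<lambda>x. (1 / r) *\<^sub>R v x)" using v cls_scaleR[OF meas vL, of "1 / r"] by (simp add: Gpair_def)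
    then have "AE x in lebesgue_on \<Omega>. ?t x = (1 / r) * v x"
      using cls_eq_iff[OF meas tL L2_scaleR[OF vL, of "1 / r"]] by simp
    moreover have "1 / r \<noteq> 0" using r by simp
    moreover have "\<forall>\<mu> w. \<mu> \<noteq> 0 \<and> w \<in> L2 \<Omega> \<and> (AE x in lebesgue_on \<Omega>. F1_operator \<Omega> Sg U w x = \<mu> * w x)
        \<longrightarrow> (\<exists>w'\<in>lin_span u {k\<in>I. lam k = 1 / \<mu>}. AE x in lebesgue_on \<Omega>. w x = w' x)"
      using en unfolding eigen_enumeration_def by (elim conjE)
    ultimately obtain w' where w': "w' \<in> lin_span u {k\<in>I. lam k = 1 / (1 / r)}" "AE x in lebesgue_on \<Omega>. v x = w' x"
      using vL by blast
    then obtain c F where F: "finite F" "F \<subseteq> {k\<in>I. lam k = r}" "w' = (\<lambda>x. \<Sum>k\<in>F. c k * u k x)"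
      by (auto simp: lin_span_def)
    have H: "(\<lambda>x. \<Sum>k\<in>F. c k *\<^sub>R u k x) \<in> H10 \<Omega>" "(\<Sum>k\<in>F. c k *\<^sub>R Gpair (u k)) = Gpair (\<lambda>x. \<Sum>k\<in>F. c k *\<^sub>R u k x)"
      using Gpair_sum[OF F(1), of u c] F(2) uH by auto
    have "cl v = cl (\<lambda>x. \<Sum>k\<in>F. c k *\<^sub>R u k x)"
      using cls_eq_iff[OF meas vL H10_L2(1)[OF H(1)]] w'(2) F(3) by simp
    then have "Gpair v = Gpair (\<lambda>x. \<Sum>k\<in>F. c k *\<^sub>R u k x)"
      using Gpair_eqI[OF Gpair_in[OF H(1)], of v] vL by (simp add: Gpair_def)
    then have "y' = (\<Sum>k\<in>F. c k *\<^sub>R Gpair (u k))" unfolding v(2) H(2) .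
    then have "snd y' = (\<Sum>k\<in>F. c k *\<^sub>R snd (Gpair (u k)))" by (simp only: snd_sum snd_scaleR)
    then have E: "(snd y', 0 :: (real^'a, real) l2) = (\<Sum>k\<in>F. c k *\<^sub>R (snd (Gpair (u k)), 0))"
      by (simp add: prod_eq_iff fst_sum snd_sum)
    have "y = (\<Sum>k\<in>F. c k *\<^sub>R ((1 / \<mu>) *\<^sub>R proj Dg (snd (Gpair (u k)), 0)))"
      unfolding y'(2) E linear_sum[OF Dh.linear_proj] linear_scale[OF Dh.linear_proj] scaleR_sum_right
      by (intro sum.cong refl scaleR_left_commute)
    also have "\<dots> = (\<Sum>k\<in>F. c k *\<^sub>R eigvec lam u k)"
      using F(2) by (intro sum.cong refl) (auto simp: eigvec_def r_def)
    also have "\<dots> \<in> span (eigvec lam u ` {k\<in>I. 1 / (1 + lam k) = \<mu>})"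
      using F(2) \<mu> by (intro span_sum span_scale span_base imageI) (auto simp: r_def)
    finally show ?thesis .
  qed
  have anti: "1 / (1 + lam k) \<le> 1 / (1 + lam j)" if "j \<in> I" "k \<in> I" "j \<le> k" for j k
    using mono[OF that] l0[OF that(1)] by (intro divide_left_mono) auto
  have pos: "0 < 1 / (1 + lam k)" if "k \<in> I" for k using l0[OF that] by simp
  show ?thesis unfolding eigen_system_def
  proof (intro conjI ballI allI impI)
    fix F c assume "finite F \<and> F \<subseteq> I \<and> (\<Sum>k\<in>F. c k *\<^sub>R eigvec lam u k) = 0"
    then show "\<And>k. k \<in> F \<Longrightarrow> c k = 0" using indep by blast
  next
    fix \<mu> y assume "0 < \<mu> \<and> S Dg Gg y = \<mu> *\<^sub>R y"
    then show "y \<in> span (eigvec lam u ` {k \<in> I. 1 / (1 + lam k) = \<mu>})" using compl by blast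
  qed (use pos anti eigvec_props(3)[OF en] in auto)
qed

lemma INF_Hdiv_ge_proj:
  assumes x: "\<xi> \<in> Hdiv \<Omega>"
  shows "norm (Dpair \<xi> - proj Dg (Dpair \<xi>)) \<le> (INF \<tau>\<in>Sg. Hdiv_norm \<Omega> (\<lambda>x. \<xi> x - \<tau> x))"
proof (rule cINF_greatest)
  show "Sg \<noteq> {}" using subspace_0[OF Dh.sub] by auto
  fix \<tau> assume "\<tau> \<in> Sg"
  then show "norm (Dpair \<xi> - proj Dg (Dpair \<xi>)) \<le> Hdiv_norm \<Omega> (\<lambda>x. \<xi> x - \<tau> x)"
    using Dh.proj_best[of "Dpair \<tau>" "Dpair \<xi>"] Hdiv_norm_diff[OF x, of \<tau>] Sg by auto
qed

lemma INF_H1_ge_proj: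
  assumes a: "a \<in> H10 \<Omega>"
  shows "norm ((snd (Gpair a), 0) - proj (K Gg) (snd (Gpair a), 0)) \<le> (INF v\<in>U. H1_norm \<Omega> (\<lambda>x. a x - v x))"
proof (rule cINF_greatest)
  show "U \<noteq> {}" using subspace_0[OF Gh.sub] by auto
  fix v assume v: "v \<in> U"
  then have "(snd (Gpair v), 0) \<in> K Gg" unfolding K_def by blast
  then have "norm ((snd (Gpair a), 0) - proj (K Gg) (snd (Gpair a), 0)) \<le> norm ((snd (Gpair a), 0) - (snd (Gpair v), 0 :: (real^'a, real) l2))"
    by (rule Kh.proj_best)
  also have "\<dots> = norm (snd (Gpair a - Gpair v))" by (simp add: norm_Pair)
  also have "\<dots> \<le> norm (Gpair a - Gpair v)" by (rule norm_fst_snd_le)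
  also have "\<dots> = H1_norm \<Omega> (\<lambda>x. a x - v x)" using H1_norm_diff[OF a, of v] v U by auto
  finally show "norm ((snd (Gpair a), 0) - proj (K Gg) (snd (Gpair a), 0)) \<le> H1_norm \<Omega> (\<lambda>x. a x - v x)" .
qed

end

section \<open>Convergence of the discrete operators\<close>

lemma (in sobolev) discretization_full: "discretization \<Omega> R (Hdiv \<Omega>) (H10 \<Omega>)"
  by unfold_locales
    (simp_all add: Dpair_image_D Gpair_image_Gr full.Dh.sub full.Dh.clo full.Gh.sub full.Gh.clo)

lemma (in sobolev) discretization_finite_dim:
  assumes "finite_dim_space \<Omega> Sg" "Sg \<subseteq> Hdiv \<Omega>" "finite_dim_space \<Omega> U" "U \<subseteq> H10 \<Omega>"
  shows "discretization \<Omega> R Sg U"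
proof -
  obtain B where B: "finite B" "Dpair ` Sg \<subseteq> span B" using finite_dim_Dpair[OF assms(1,2)] by blast
  obtain C where C: "finite C" "Gpair ` U \<subseteq> span C" using finite_dim_Gpair[OF assms(3,4)] by blast
  have "closed_subspace (Dpair ` Sg)" "closed_subspace (Gpair ` U)"
    using closed_subspace_of_finite_dim(1)[OF finite_dim_Dpair(1)[OF assms(1,2)] B]
      closed_subspace_of_finite_dim(1)[OF finite_dim_Gpair(1)[OF assms(3,4)] C] by auto
  then show ?thesis using assms(2,4) sobolev_axioms
    by (intro discretization.intro discretization_axioms.intro)
qed

text \<open>
  The approximation hypotheses only give a rate for each fixed function; the uniform boundedness
  principle makes it uniform, so no a priori bound for the Dirichlet problem in fractional order
  spaces is needed.
\<close>

lemma (in sobolev) discrete_operators_converge: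
  assumes reg: "dirichlet_regularity \<Omega> s"
    and disc: "\<And>h. 0 < h \<Longrightarrow> discretization \<Omega> R (Sh h) (Uh h)"
    and aS: "Sigma_approximation \<Omega> s Sh" and aU: "U_approximation \<Omega> s Uh"
  shows "\<exists>C. \<forall>h>0. \<forall>x. norm (S D Gr x - S (Dpair ` Sh h) (Gpair ` Uh h) x) \<le> C * h powr s * norm x"
proof -
  \<comment> \<open>Dividing by \<open>h powr s\<close> turns the rate for each fixed
    \<open>x\<close> into pointwise boundedness of a family of operators.\<close>
  define A where "A h x = (1 / h powr s) *\<^sub>R (S D Gr x - proj (Dpair ` Sh h) (S D Gr x))" for h x
  define B where "B h x = (1 / h powr s) *\<^sub>R (proj (K Gr) (proj D x) - proj (K (Gpair ` Uh h)) (proj D x))" for h x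
  have hs: "h powr s > 0" if "h > 0" for h using that by simp
  have blS: "bounded_linear (S D Gr)" using full.self_adjoint_S by (simp add: self_adjoint_def)
  have "\<exists>C. \<forall>h\<in>{0<..}. \<forall>x. norm (A h x) \<le> C * norm x"
  proof (rule uniform_boundedness)
    fix h :: real assume "h \<in> {0<..}"
    then interpret d: discretization \<Omega> R "Sh h" "Uh h" using disc by simp
    show "bounded_linear (A h)" unfolding A_def
      by (intro bounded_linear_compose[OF bounded_linear_scaleR_right] bounded_linear_sub blS
          bounded_linear_compose[OF d.Dh.bounded_linear_proj blS])
  next
    fix x
    obtain a \<xi> where \<xi>: "\<xi> \<in> Hs_vec \<Omega> s" "\<xi> \<in> Hdiv \<Omega>" "weak_div \<Omega> \<xi> \<in> H1s \<Omega> s" "S D Gr x = Dpair \<xi>"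
      by (rule S_regular[OF reg, of x]) (rule that)
    obtain C where C: "\<forall>h>0. \<forall>\<xi>. \<xi> \<in> Hs_vec \<Omega> s \<and> \<xi> \<in> Hdiv \<Omega> \<and> weak_div \<Omega> \<xi> \<in> H1s \<Omega> s \<longrightarrow>
        (INF \<tau>\<in>Sh h. Hdiv_norm \<Omega> (\<lambda>x. \<xi> x - \<tau> x))
          \<le> C * h powr s * (Hs_vec_norm \<Omega> s \<xi> + H1s_norm \<Omega> s (weak_div \<Omega> \<xi>))"
      using aS unfolding Sigma_approximation_def by blast
    \<comment> \<open>Independent of \<open>h\<close>, because the regular function
      \<open>\<xi>\<close> is determined by \<open>x\<close> and the continuous operator.\<close>
    define M where "M = C * (Hs_vec_norm \<Omega> s \<xi> + H1s_norm \<Omega> s (weak_div \<Omega> \<xi>))"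
    have "norm (A h x) \<le> M" if h: "h > 0" for h
    proof -
      interpret d: discretization \<Omega> R "Sh h" "Uh h" using disc h by simp
      have "norm (Dpair \<xi> - proj (Dpair ` Sh h) (Dpair \<xi>)) \<le> C * h powr s * (Hs_vec_norm \<Omega> s \<xi> + H1s_norm \<Omega> s (weak_div \<Omega> \<xi>))"
        using d.INF_Hdiv_ge_proj[OF \<xi>(2)] C h \<xi>(1-3) order_trans by blast
      also have "\<dots> = M * h powr s" by (simp add: M_def)
      finally show ?thesis using hs[OF h] by (simp add: A_def \<xi>(4) pos_divide_le_eq)
    qed
    then show "\<exists>C. \<forall>h\<in>{0<..}. norm (A h x) \<le> C" by auto
  qed
  then obtain CA where CA: "\<And>h x. h > 0 \<Longrightarrow> norm (A h x) \<le> CA * norm x" by auto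
  have "\<exists>C. \<forall>h\<in>{0<..}. \<forall>x. norm (B h x) \<le> C * norm x"
  proof (rule uniform_boundedness)
    fix h :: real assume "h \<in> {0<..}"
    then interpret d: discretization \<Omega> R "Sh h" "Uh h" using disc by simp
    show "bounded_linear (B h)" unfolding B_def
      by (intro bounded_linear_compose[OF bounded_linear_scaleR_right] bounded_linear_sub
          bounded_linear_compose[OF d.Kh.bounded_linear_proj full.Dh.bounded_linear_proj]
          bounded_linear_compose[OF full.Kh.bounded_linear_proj full.Dh.bounded_linear_proj])
  next
    fix x
    obtain a \<xi> where a: "a \<in> H1s \<Omega> s \<inter> H10 \<Omega>" "proj (K Gr) (proj D x) = (snd (Gpair a), 0)"
      by (rule S_regular[OF reg, of x]) (rule that)
    obtain C where C: "\<forall>h>0. \<forall>p\<in>H1s \<Omega> s \<inter> H10 \<Omega>.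
        (INF v\<in>Uh h. H1_norm \<Omega> (\<lambda>x. p x - v x)) \<le> C * h powr s * H1s_norm \<Omega> s p"
      using aU unfolding U_approximation_def by blast
    define M where "M = C * H1s_norm \<Omega> s a"
    have "norm (B h x) \<le> M" if h: "h > 0" for h
    proof -
      interpret d: discretization \<Omega> R "Sh h" "Uh h" using disc h by simp
      have aH: "a \<in> H10 \<Omega>" using a(1) by simp
      have "norm ((snd (Gpair a), 0) - proj (K (Gpair ` Uh h)) (snd (Gpair a), 0)) \<le> C * h powr s * H1s_norm \<Omega> s a"
        using d.INF_H1_ge_proj[OF aH] C h a(1) order_trans by blast
      also have "\<dots> = M * h powr s" by (simp add: M_def)
      finally have "norm (proj (K Gr) (proj D x) - proj (K (Gpair ` Uh h)) (proj D x)) \<le> M * h powr s"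
        unfolding a(2)[symmetric] d.proj_Kh_K .
      then show ?thesis using hs[OF h] by (simp add: B_def pos_divide_le_eq)
    qed
    then show "\<exists>C. \<forall>h\<in>{0<..}. norm (B h x) \<le> C" by auto
  qed
  then obtain CB where CB: "\<And>h x. h > 0 \<Longrightarrow> norm (B h x) \<le> CB * norm x" by auto
  have "norm (S D Gr x - S (Dpair ` Sh h) (Gpair ` Uh h) x) \<le> (2 * \<bar>CA\<bar> + \<bar>CB\<bar>) * h powr s * norm x" if h: "h > 0" for h x
  proof -
    interpret d: discretization \<Omega> R "Sh h" "Uh h" using disc h by simp
    have "norm (S D Gr x - S (Dpair ` Sh h) (Gpair ` Uh h) x) \<le> (2 * \<bar>CA * h powr s\<bar> + \<bar>CB * h powr s\<bar>) * norm x"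
    proof (rule d.norm_diff_S_le)
      show "norm (S D Gr x - proj (Dpair ` Sh h) (S D Gr x)) \<le> CA * h powr s * norm x" for x
        using CA[OF h, of x] hs[OF h] by (simp add: A_def pos_divide_le_eq mult_ac)
      show "norm (proj (K Gr) (proj D x) - proj (K (Gpair ` Uh h)) (proj D x)) \<le> CB * h powr s * norm x" for x
        using CB[OF h, of x] hs[OF h] by (simp add: B_def pos_divide_le_eq mult_ac)
    qed
    also have "\<dots> = (2 * \<bar>CA\<bar> + \<bar>CB\<bar>) * h powr s * norm x"
      using hs[OF h] by (simp add: abs_mult algebra_simps)
    finally show ?thesis .
  qed
  then show ?thesis by blast
qed

text \<open>The flux of \<open>u j\<close> is approximated from the discrete cluster by
  \<open>near\<close>. Projecting onto discrete gradients turns the fluxes of the cluster into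
  gradients of the \<open>uh k\<close>, so the approximant \<open>w\<close> yields a function
  \<open>v\<close> in their span. The choice of \<open>v\<close> precedes that of the competitors,
  so the infimum can be taken at the end.\<close>

lemma (in sobolev) eigenspace_errors:
  assumes disc: "discretization \<Omega> R Sg U"
    and en: "eigen_enumeration \<Omega> (F1_operator \<Omega> (Hdiv \<Omega>) (H10 \<Omega>)) I lam u"
    and enh: "eigen_enumeration \<Omega> (F1_operator \<Omega> Sg U) Ih lamh uh"
    and J: "finite J" "J \<subseteq> Ih" and j: "j \<in> I"
    and eps: "0 < \<epsilon>"
    and near: "\<And>\<sigma>. S D Gr \<sigma> = (1 / (1 + lam j)) *\<^sub>R \<sigma> \<Longrightarrow>
      \<exists>w\<in>span (discretization.eigvec \<Omega> Sg lamh uh ` J). norm (\<sigma> - w) \<le> norm (S D Gr \<sigma> - S (Dpair ` Sg) (Gpair ` U) \<sigma>) / \<epsilon>"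
  shows "\<exists>w\<in>lin_span uh J. H1_norm \<Omega> (\<lambda>x. u j x - w x) \<le> (2 * \<bar>R\<bar> + 1) * (2 / \<epsilon> + 1) *
      (INF (\<tau>, v)\<in>Sg \<times> U. Hdiv_norm \<Omega> (\<lambda>x. weak_grad \<Omega> (u j) x - \<tau> x) + H1_norm \<Omega> (\<lambda>x. u j x - v x))"
proof -
  interpret d: discretization \<Omega> R Sg U by (rule disc)
  interpret f: discretization \<Omega> R "Hdiv \<Omega>" "H10 \<Omega>" by (rule discretization_full)
  have uj: "0 < lam j" "u j \<in> H10 \<Omega>" using f.eigenfunction_sol[OF en j] by auto
  define \<sigma> where "\<sigma> = f.eigvec lam u j"
  have \<sigma>: "sol D Gr (lam j *\<^sub>R fst (Gpair (u j))) \<sigma> (Gpair (u j))"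
    "proj (K Gr) \<sigma> = (snd (Gpair (u j)), 0)" "S D Gr \<sigma> = (1 / (1 + lam j)) *\<^sub>R \<sigma>"
    using f.eigvec_props[OF en j] by (simp_all add: \<sigma>_def Dpair_image_D Gpair_image_Gr)
  have \<sigma>D: "\<sigma> \<in> D" using \<sigma>(1) by (simp add: sol_def)
  have ujL: "fst (Gpair (u j)) \<in> L2_range \<Omega>" using uj H10_L2 by (simp add: Gpair_def)
  have "lam j *\<^sub>R fst (Gpair (u j)) \<in> L2_range \<Omega>"
    using ujL closed_subspace.sub[OF closed_subspace_L2_range[OF meas]] by (intro subspace_scale)
  from sol_full[OF \<sigma>(1) this] have "fst \<sigma> = cl (weak_grad \<Omega> (u j))" by (simp add: Gpair_def)
  then have gH: "weak_grad \<Omega> (u j) \<in> Hdiv \<Omega>" "\<sigma> = Dpair (weak_grad \<Omega> (u j))"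
    using Dpair_eqI[OF \<sigma>D] H10_L2(2)[OF uj(2)] by auto
  obtain w where w: "w \<in> span (d.eigvec lamh uh ` J)"
      "norm (\<sigma> - w) \<le> norm (S D Gr \<sigma> - S (Dpair ` Sg) (Gpair ` U) \<sigma>) / \<epsilon>"
    using near[OF \<sigma>(3)] by blast
  have esh: "eigen_system (S (Dpair ` Sg) (Gpair ` U)) Ih (\<lambda>k. 1 / (1 + lamh k)) (d.eigvec lamh uh)"
    by (rule d.eigen_system_S[OF enh])
  \<comment> \<open>Independence makes the eigenvectors distinct, so a combination over the image
    set can be indexed by \<open>J\<close>.\<close>
  have inj: "inj_on (d.eigvec lamh uh) J"
  proof (rule inj_onI, rule ccontr)
    fix a b assume ab: "a \<in> J" "b \<in> J" "d.eigvec lamh uh a = d.eigvec lamh uh b" "a \<noteq> b"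
    have "(\<Sum>k\<in>{a, b}. (if k = a then 1 else - 1) *\<^sub>R d.eigvec lamh uh k) = 0" using ab by simp
    from eigen_systemD(4)[OF esh _ _ this] show False using ab J by auto
  qed
  obtain c where c: "w = (\<Sum>k\<in>J. c k *\<^sub>R d.eigvec lamh uh k)"
  proof -
    obtain q where "w = (\<Sum>y\<in>d.eigvec lamh uh ` J. q y *\<^sub>R y)"
      using w(1) span_finite[of "d.eigvec lamh uh ` J"] J(1) by auto
    then have "w = (\<Sum>k\<in>J. q (d.eigvec lamh uh k) *\<^sub>R d.eigvec lamh uh k)" by (simp add: sum.reindex[OF inj])
    then show thesis by (rule that)
  qed
  define v where "v = (\<lambda>x. \<Sum>k\<in>J. c k *\<^sub>R uh k x)"
  have uhH: "uh k \<in> H10 \<Omega>" "Gpair (uh k) \<in> Gpair ` U" if "k \<in> J" for k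
    using d.eigenfunction_sol[OF enh, of k] that J by auto
  have v: "v \<in> H10 \<Omega>" "(\<Sum>k\<in>J. c k *\<^sub>R Gpair (uh k)) = Gpair v"
    using Gpair_sum[OF J(1), of uh c] uhH by (auto simp: v_def)
  have vspan: "v \<in> lin_span uh J"
    unfolding lin_span_def v_def using J(1) by (intro CollectI exI[of _ c] exI[of _ J]) simp
  have Kw: "proj (K (Gpair ` U)) w = (snd (Gpair v), 0)"
  proof -
    have "proj (K (Gpair ` U)) w = (\<Sum>k\<in>J. c k *\<^sub>R (snd (Gpair (uh k)), 0))"
      unfolding c linear_sum[OF d.Kh.linear_proj] linear_scale[OF d.Kh.linear_proj]
      using J(2) by (intro sum.cong refl) (auto simp: d.eigvec_props(2)[OF enh])
    also have "\<dots> = (snd (\<Sum>k\<in>J. c k *\<^sub>R Gpair (uh k)), 0)" by (simp add: prod_eq_iff fst_sum snd_sum)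
    finally show ?thesis by (simp add: v(2))
  qed
  \<comment> \<open>\<open>2 / \<epsilon>\<close> comes from the distance of the fluxes, the 1 added
    to it from the error of the gradient projection, and \<open>2 * \<bar>R\<bar> + 1\<close> from
    Poincare for the full H1 norm.\<close>
  define C0 where "C0 = (2 * \<bar>R\<bar> + 1) * (2 / \<epsilon> + 1)"
  have C0: "C0 > 0" using eps by (simp add: C0_def add_nonneg_pos)
  have bound: "H1_norm \<Omega> (\<lambda>x. u j x - v x) \<le> C0 * (Hdiv_norm \<Omega> (\<lambda>x. weak_grad \<Omega> (u j) x - \<tau> x) + H1_norm \<Omega> (\<lambda>x. u j x - z x))"
    if \<tau>: "\<tau> \<in> Sg" and z: "z \<in> U" for \<tau> z
  proof -
    define a b where "a = Hdiv_norm \<Omega> (\<lambda>x. weak_grad \<Omega> (u j) x - \<tau> x)" and "b = H1_norm \<Omega> (\<lambda>x. u j x - z x)"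
    have a: "a = norm (\<sigma> - Dpair \<tau>)" unfolding a_def gH(2) using \<tau> d.Sg by (intro Hdiv_norm_diff gH(1)) auto
    have b: "b = norm (Gpair (u j) - Gpair z)" unfolding b_def using z d.U by (intro H1_norm_diff uj(2)) auto
    have ab0: "0 \<le> a" "0 \<le> b" by (simp_all add: a b)
    have gz: "norm (snd (Gpair (u j)) - snd (Gpair z)) \<le> b"
      unfolding b using norm_fst_snd_le(2)[of "Gpair (u j) - Gpair z"] by simp
    have nu: "0 \<le> 1 / (1 + lam j)" "1 / (1 + lam j) \<le> 1" using uj(1) by auto
    note ce = d.consistency_error[OF \<sigma>D \<sigma>(3) nu \<sigma>(2), of "Dpair \<tau>" "Gpair z"]
    have "norm (S D Gr \<sigma> - S (Dpair ` Sg) (Gpair ` U) \<sigma>) \<le> 2 * a + b"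
      using ce(1) \<tau> z gz a by simp
    then have "norm (S D Gr \<sigma> - S (Dpair ` Sg) (Gpair ` U) \<sigma>) / \<epsilon> \<le> (2 * a + b) / \<epsilon>"
      using eps by (intro divide_right_mono) auto
    then have sw: "norm (\<sigma> - w) \<le> (2 * a + b) / \<epsilon>" using w(2) by linarith
    have "norm ((snd (Gpair (u j)), 0) - proj (K (Gpair ` U)) w) \<le> norm (\<sigma> - w) + norm (snd (Gpair (u j)) - snd (Gpair z))"
      using ce(2)[of w] \<tau> z by simp
    then have g: "norm (snd (Gpair (u j) - Gpair v)) \<le> (2 * a + b) / \<epsilon> + b"
      unfolding Kw using sw gz by (simp add: norm_Pair)
    have "(2 * a + b) / \<epsilon> + b \<le> (2 / \<epsilon> + 1) * (a + b)"
    proof -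
      have "(2 / \<epsilon> + 1) * (a + b) - ((2 * a + b) / \<epsilon> + b) = b / \<epsilon> + a"
        by (simp add: add_divide_distrib algebra_simps)
      moreover have "0 \<le> b / \<epsilon> + a" using ab0 eps by simp
      ultimately show ?thesis by linarith
    qed
    then have g': "norm (snd (Gpair (u j) - Gpair v)) \<le> (2 / \<epsilon> + 1) * (a + b)" using g by linarith
    have "Gpair (u j) - Gpair v \<in> Gr" using uj(2) v(1) Gpair_in full.Gh.sub by (intro subspace_diff) auto
    then have "norm (fst (Gpair (u j) - Gpair v)) \<le> 2 * \<bar>R\<bar> * norm (snd (Gpair (u j) - Gpair v))" by (rule poincare_Gr)
    then have "norm (Gpair (u j) - Gpair v) \<le> (2 * \<bar>R\<bar> + 1) * norm (snd (Gpair (u j) - Gpair v))"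
      using norm_pair_le[of "Gpair (u j) - Gpair v"] by (simp add: algebra_simps)
    also have "\<dots> \<le> (2 * \<bar>R\<bar> + 1) * ((2 / \<epsilon> + 1) * (a + b))" by (intro mult_left_mono g') auto
    finally show ?thesis
      using H1_norm_diff[OF uj(2) v(1)] by (simp add: C0_def a_def b_def mult.assoc)
  qed
  have "H1_norm \<Omega> (\<lambda>x. u j x - v x) / C0 \<le>
      (INF (\<tau>, z)\<in>Sg \<times> U. Hdiv_norm \<Omega> (\<lambda>x. weak_grad \<Omega> (u j) x - \<tau> x) + H1_norm \<Omega> (\<lambda>x. u j x - z x))"
  proof (rule cINF_greatest)
    show "Sg \<times> U \<noteq> {}" using subspace_0[OF d.Dh.sub] subspace_0[OF d.Gh.sub] by auto
    fix p assume "p \<in> Sg \<times> U"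
    then show "H1_norm \<Omega> (\<lambda>x. u j x - v x) / C0 \<le>
        (case p of (\<tau>, z) \<Rightarrow> Hdiv_norm \<Omega> (\<lambda>x. weak_grad \<Omega> (u j) x - \<tau> x) + H1_norm \<Omega> (\<lambda>x. u j x - z x))"
      using bound C0 by (auto simp: pos_divide_le_eq mult.commute)
  qed
  then show ?thesis using vspan C0 unfolding C0_def[symmetric]
    by (intro bexI[of _ v]) (simp_all add: pos_divide_le_eq mult.commute)
qed

text \<open>The supremum defining the best approximation error is over a bounded set, so it dominates the
  value at each eigenfunction; the bound comes from the competitor \<open>(0, 0)\<close>.\<close>

lemma (in sobolev) INF_le_best_approximation_error:
  assumes disc: "discretization \<Omega> R Sg U"
    and zero: "(\<lambda>x. 0) \<in> Sg" "(\<lambda>x. 0) \<in> U"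
    and en: "eigen_enumeration \<Omega> (F1_operator \<Omega> (Hdiv \<Omega>) (H10 \<Omega>)) I lam u"
    and J: "J \<subseteq> I" "\<And>k. k \<in> J \<Longrightarrow> lam k = l" and j: "j \<in> J"
  shows "(INF (\<tau>, v)\<in>Sg \<times> U. Hdiv_norm \<Omega> (\<lambda>x. weak_grad \<Omega> (u j) x - \<tau> x) + H1_norm \<Omega> (\<lambda>x. u j x - v x))
    \<le> best_approximation_error \<Omega> Sg U (lin_span u J)"
proof -
  interpret d: discretization \<Omega> R Sg U by (rule disc)
  interpret f: discretization \<Omega> R "Hdiv \<Omega>" "H10 \<Omega>" by (rule discretization_full)
  let ?e = "\<lambda>w. INF (\<tau>, v)\<in>Sg \<times> U. Hdiv_norm \<Omega> (\<lambda>x. weak_grad \<Omega> w x - \<tau> x) + H1_norm \<Omega> (\<lambda>x. w x - v x)"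
  have uH: "u k \<in> H10 \<Omega>" if "k \<in> J" for k using f.eigenfunction_sol(2)[OF en] that J by auto
  have norm1: "L2_norm \<Omega> (u j) = 1" using en j J unfolding eigen_enumeration_def by blast
  have in1: "u j \<in> {w \<in> lin_span u J. L2_norm \<Omega> w = 1}"
    using norm1 j by (auto simp: lin_span_def intro!: exI[of _ "\<lambda>_. 1"] exI[of _ "{j}"])
  have z0: "(\<lambda>x. 0) \<in> Hdiv \<Omega>" "(\<lambda>x. 0) \<in> H10 \<Omega>" using zero d.Sg d.U by auto
  have D0: "Dpair (\<lambda>x. 0) = 0" using Dpair_scale[OF z0(1), of 0] by simp
  have G0: "Gpair (\<lambda>x. 0) = 0" using Gpair_scale[OF z0(2), of 0] by simp
  \<comment> \<open>For normalized \<open>w\<close> in the eigenspace, the squared norm of the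
    gradient is \<open>l\<close> and the divergence of the gradient is \<open>- l\<close> times
    \<open>w\<close>. The two roots are thus the Hdiv norm of the gradient and the H1 norm of
    \<open>w\<close>.\<close>
  have ub: "?e w \<le> sqrt (l + l\<^sup>2) + sqrt (1 + l)" if w: "w \<in> {w \<in> lin_span u J. L2_norm \<Omega> w = 1}" for w
  proof -
    obtain c F where F: "finite F" "F \<subseteq> J" "w = (\<lambda>x. \<Sum>k\<in>F. c k * u k x)" using w by (auto simp: lin_span_def)
    have wH: "w \<in> H10 \<Omega>" and wG: "(\<Sum>k\<in>F. c k *\<^sub>R Gpair (u k)) = Gpair w"
      using Gpair_sum[OF F(1), of u c] F(2) uH by (auto simp: F(3))
    have nw: "norm (cl w) = 1" using w wH H10_L2 by (simp add: cls_norm)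
    define \<sigma> where "\<sigma> = (\<Sum>k\<in>F. c k *\<^sub>R f.eigvec lam u k)"
    have ek: "f.eigvec lam u k = (snd (Gpair (u k)), - (l *\<^sub>R fst (Gpair (u k))))" if "k \<in> F" for k
    proof -
      have k: "k \<in> I" "lam k = l" using that F J by auto
      have s: "sol D Gr (lam k *\<^sub>R fst (Gpair (u k))) (f.eigvec lam u k) (Gpair (u k))"
        using f.eigvec_props(1)[OF en k(1)] by (simp add: Dpair_image_D Gpair_image_Gr)
      have "fst (Gpair (u k)) \<in> L2_range \<Omega>" using uH[of k] that F H10_L2 by (auto simp: Gpair_def)
      then have "lam k *\<^sub>R fst (Gpair (u k)) \<in> L2_range \<Omega>"
        using closed_subspace.sub[OF closed_subspace_L2_range[OF meas]] by (intro subspace_scale)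
      from sol_full[OF s this] show ?thesis by (simp add: k)
    qed
    have "\<sigma> = (\<Sum>k\<in>F. c k *\<^sub>R (snd (Gpair (u k)), - (l *\<^sub>R fst (Gpair (u k)))))" unfolding \<sigma>_def by (simp add: ek)
    also have "\<dots> = (snd (\<Sum>k\<in>F. c k *\<^sub>R Gpair (u k)), - (l *\<^sub>R fst (\<Sum>k\<in>F. c k *\<^sub>R Gpair (u k))))"
      by (simp add: prod_eq_iff fst_sum snd_sum scaleR_sum_right sum_negf mult.commute)
    finally have \<sigma>: "\<sigma> = (cl (weak_grad \<Omega> w), - (l *\<^sub>R cl w))" unfolding wG by (simp add: Gpair_def)
    have \<sigma>D: "\<sigma> \<in> D" unfolding \<sigma>_def
    proof (intro subspace_sum subspace_scale full.Dh.sub)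
      fix k assume "k \<in> F"
      then have "k \<in> I" using F J by auto
      then show "f.eigvec lam u k \<in> D" using f.eigvec_props(1)[OF en] by (simp add: sol_def Dpair_image_D)
    qed
    have gH: "weak_grad \<Omega> w \<in> Hdiv \<Omega>" "\<sigma> = Dpair (weak_grad \<Omega> w)"
      using Dpair_eqI[OF \<sigma>D, of "weak_grad \<Omega> w"] H10_L2(2)[OF wH] \<sigma> by auto
    have "cl (weak_grad \<Omega> w) \<bullet> cl (weak_grad \<Omega> w) = l * (cl w \<bullet> cl w)"
      using D_green[OF \<sigma>D Gpair_in[OF wH]] by (simp add: \<sigma> Gpair_def)
    then have g2: "(norm (cl (weak_grad \<Omega> w)))\<^sup>2 = l" using nw by (simp add: dot_square_norm)
    have "Hdiv_norm \<Omega> (\<lambda>x. weak_grad \<Omega> w x - 0) = norm \<sigma>" using Hdiv_norm_diff[OF gH(1) z0(1)] gH(2) D0 by simp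
    also have "norm \<sigma> = sqrt (l + l\<^sup>2)" unfolding \<sigma> norm_Pair g2 by (simp add: nw)
    finally have 1: "Hdiv_norm \<Omega> (\<lambda>x. weak_grad \<Omega> w x - 0) = sqrt (l + l\<^sup>2)" .
    have "H1_norm \<Omega> (\<lambda>x. w x - 0) = norm (Gpair w)" using H1_norm_diff[OF wH z0(2)] G0 by simp
    also have "\<dots> = sqrt (1 + l)" unfolding Gpair_def norm_Pair g2 by (simp add: nw)
    finally have 2: "H1_norm \<Omega> (\<lambda>x. w x - 0) = sqrt (1 + l)" .
    have "?e w \<le> (case ((\<lambda>x. 0), (\<lambda>x. 0)) of (\<tau>, v) \<Rightarrow> Hdiv_norm \<Omega> (\<lambda>x. weak_grad \<Omega> w x - \<tau> x) + H1_norm \<Omega> (\<lambda>x. w x - v x))"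
    proof (rule cINF_lower)
      show "bdd_below ((\<lambda>(\<tau>, v). Hdiv_norm \<Omega> (\<lambda>x. weak_grad \<Omega> w x - \<tau> x) + H1_norm \<Omega> (\<lambda>x. w x - v x)) ` (Sg \<times> U))"
        by (rule bdd_belowI2[where m=0]) (auto simp: Hdiv_norm_def H1_norm_def intro!: add_nonneg_nonneg)
      show "((\<lambda>x. 0), (\<lambda>x. 0)) \<in> Sg \<times> U" using zero by simp
    qed
    then show ?thesis using 1 2 by simp
  qed
  show ?thesis unfolding best_approximation_error_def
    by (rule cSUP_upper[OF in1]) (rule bdd_aboveI2[OF ub])
qed

text \<open>The conclusion contains \<open>i + m - 1 \<le> N h\<close> because the enumeration
  constrains \<open>uh h k\<close> only for indices up to \<open>N h\<close>; without it the span on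
  the right could involve arbitrary functions.\<close>

theorem theorem12:
  fixes \<Omega> :: "(real^'n::finite) set"
    and s :: real
    and \<Sigma>h :: "real \<Rightarrow> (real^'n \<Rightarrow> real^'n) set"
    and Uh :: "real \<Rightarrow> (real^'n \<Rightarrow> real) set"
    and lam :: "nat \<Rightarrow> real"
    and u :: "nat \<Rightarrow> real^'n \<Rightarrow> real"
    and N :: "real \<Rightarrow> nat"
    and lamh :: "real \<Rightarrow> nat \<Rightarrow> real"
    and uh :: "real \<Rightarrow> nat \<Rightarrow> real^'n \<Rightarrow> real"
    and i m :: nat
  assumes "CARD('n) = 2 \<or> CARD('n) = 3"
    and "lipschitz_polytopal_domain \<Omega>"
    and "1 / 2 < s" "s \<le> 1"
    and "dirichlet_regularity \<Omega> s"
    and "\<And>h. 0 < h \<Longrightarrow> finite_dim_space \<Omega> (\<Sigma>h h) \<and> \<Sigma>h h \<subseteq> Hdiv \<Omega>"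
    and "\<And>h. 0 < h \<Longrightarrow> finite_dim_space \<Omega> (Uh h) \<and> Uh h \<subseteq> H10 \<Omega>"
    and "Sigma_approximation \<Omega> s \<Sigma>h"
    and "U_approximation \<Omega> s Uh"
    and "eigen_enumeration \<Omega> (T_F1 \<Omega>) {1..} lam u"
    and "\<And>h. 0 < h \<Longrightarrow>
           eigen_enumeration \<Omega> (T_F1h \<Omega> \<Sigma>h Uh h) {1..N h} (lamh h) (uh h) \<and>
           (\<forall>k\<in>{1..N h}. uh h k \<in> Uh h)"
    and "1 \<le> i" "1 \<le> m"
    and "\<And>k. 1 \<le> k \<Longrightarrow> lam k = lam i \<longleftrightarrow> k \<in> {i..<i + m}"
  shows "\<exists>C. \<exists>h0>0. \<forall>h. 0 < h \<and> h < h0 \<longrightarrow>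
           i + m - 1 \<le> N h \<and>
           (\<forall>j\<in>{i..<i + m}. \<exists>w\<in>lin_span (uh h) {i..<i + m}.
              H1_norm \<Omega> (\<lambda>x. u j x - w x)
                \<le> C * best_approximation_error \<Omega> (\<Sigma>h h) (Uh h) (lin_span u {i..<i + m}))"
proof -
  note dom = assms(2) and reg = assms(5) and fdS = assms(6) and fdU = assms(7)
    and en0 = assms(10) and enh0 = assms(11) and mult = assms(14)
  obtain F where F: "finite F" "\<And>P. P \<in> F \<Longrightarrow> polytope P" "closure \<Omega> = \<Union>F"
    using dom unfolding lipschitz_polytopal_domain_def by blast
  have "bounded (closure \<Omega>)"
    unfolding F(3) using F(1,2) polytope_imp_bounded by (intro bounded_Union) auto
  then have "bounded \<Omega>" using bounded_subset closure_subset by blast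
  then obtain R where R: "\<And>x. x \<in> \<Omega> \<Longrightarrow> norm x \<le> R" unfolding bounded_iff by blast
  interpret sobolev \<Omega> R
    by unfold_locales (use dom R in \<open>auto simp: lipschitz_polytopal_domain_def\<close>)
  interpret f: discretization \<Omega> R "Hdiv \<Omega>" "H10 \<Omega>" by (rule discretization_full)
  have disc: "discretization \<Omega> R (\<Sigma>h h) (Uh h)" if "0 < h" for h
    using fdS[OF that] fdU[OF that] by (intro discretization_finite_dim) auto
  have en: "eigen_enumeration \<Omega> (F1_operator \<Omega> (Hdiv \<Omega>) (H10 \<Omega>)) {1..} lam u"
    using en0 by (simp add: T_F1_def)
  have enh: "eigen_enumeration \<Omega> (F1_operator \<Omega> (\<Sigma>h h) (Uh h)) {1..N h} (lamh h) (uh h)" if "0 < h" for h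
    using enh0[OF that] by (simp add: T_F1h_def)
  let ?S = "S D Gr" and ?Sh = "\<lambda>h. S (Dpair ` \<Sigma>h h) (Gpair ` Uh h)"
  have es: "eigen_system ?S {1..} (\<lambda>k. 1 / (1 + lam k)) (f.eigvec lam u)"
    using f.eigen_system_S[OF en] by (simp add: Dpair_image_D Gpair_image_Gr)
  have saS: "self_adjoint ?S" by (rule full.self_adjoint_S)
  have saSh: "self_adjoint (?Sh h)" if "0 < h" for h
  proof -
    interpret d: discretization \<Omega> R "\<Sigma>h h" "Uh h" by (rule disc[OF that])
    show ?thesis by (rule d.self_adjoint_S)
  qed
  have fr: "\<exists>B. finite B \<and> range (?Sh h) \<subseteq> span B" if h: "0 < h" for h
  proof -
    interpret d: discretization \<Omega> R "\<Sigma>h h" "Uh h" by (rule disc[OF h])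
    obtain B where "finite B" "Dpair ` \<Sigma>h h \<subseteq> span B" using finite_dim_Dpair(2)[of "\<Sigma>h h"] fdS[OF h] by blast
    then show ?thesis using d.S_in by blast
  qed
  obtain C where C: "\<And>h x. 0 < h \<Longrightarrow> norm (?S x - ?Sh h x) \<le> C * h powr s * norm x"
    using discrete_operators_converge[OF reg disc assms(8,9)] by blast
  have small: "\<exists>h0>0. \<forall>h. 0 < h \<and> h < h0 \<longrightarrow> (\<forall>x. norm (?S x - ?Sh h x) \<le> e * norm x)" if e: "e > 0" for e
  proof -
    \<comment> \<open>A positive majorant of \<open>C\<close>, which may itself be 0 or negative, so
      that \<open>h0\<close> can solve \<open>M * h0 powr s = e\<close>.\<close>
    define M where "M = \<bar>C\<bar> + 1"
    have M: "M > 0" "C \<le> M" by (auto simp: M_def)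
    define h0 where "h0 = (e / M) powr (1 / s)"
    have "norm (?S x - ?Sh h x) \<le> e * norm x" if h: "0 < h" "h < h0" for h x
    proof -
      have "h powr s \<le> h0 powr s" using h assms(3) by (intro powr_mono2) auto
      also have "\<dots> = e / M" using e M assms(3) by (simp add: h0_def powr_powr)
      finally have "M * h powr s \<le> e" using M by (simp add: pos_le_divide_eq mult.commute)
      moreover have "C * h powr s \<le> M * h powr s" using M by (intro mult_right_mono) auto
      ultimately have "C * h powr s * norm x \<le> e * norm x" by (intro mult_right_mono) auto
      then show ?thesis using C[OF h(1), of x] by linarith
    qed
    moreover have "h0 > 0" using e M by (simp add: h0_def)
    ultimately show ?thesis by blast
  qed
  \<comment> \<open>For each tolerance, one discrete operator with small enough \<open>h\<close> is
    a finite-rank approximation.\<close>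
  have cpt: "compact_op ?S"
  proof (rule compact_op_limit)
    fix e :: real assume "e > 0"
    then obtain h0 where h0: "h0 > 0" "\<forall>h. 0 < h \<and> h < h0 \<longrightarrow> (\<forall>x. norm (?S x - ?Sh h x) \<le> e * norm x)"
      using small by blast
    define h where "h = h0 / 2"
    have h: "0 < h" "h < h0" using h0 by (auto simp: h_def)
    obtain B where B: "finite B" "range (?Sh h) \<subseteq> span B" using fr[OF h(1)] by blast
    have "compact_op (?Sh h)"
      by (rule compact_op_finite_rank[OF _ B]) (use saSh[OF h(1)] in \<open>simp add: self_adjoint_def\<close>)
    then show "\<exists>F. compact_op F \<and> (\<forall>x. norm (?S x - F x) \<le> e * norm x)" using h0 h by blast
  qed
  have lpos: "0 < lam k" if "1 \<le> k" for k using f.eigenfunction_sol(1)[OF en] that by simp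
  \<comment> \<open>The map from \<lambda> to \<open>1 / (1 + \<lambda>)\<close> is injective on
    positive numbers, so multiplicities carry over.\<close>
  have mult': "1 / (1 + lam k) = 1 / (1 + lam i) \<longleftrightarrow> k \<in> {i..<i + m}" if "1 \<le> k" for k
    using mult[OF that] lpos[OF that] lpos[OF assms(12)] by (auto simp: divide_simps)
  obtain \<epsilon> where \<epsilon>: "\<epsilon> > 0" and sp: "\<And>A n \<nu>' \<phi>' B. self_adjoint A \<and> finite B \<and> range A \<subseteq> span B \<and>
      eigen_system A {1..n} \<nu>' \<phi>' \<and> (\<forall>x. norm (?S x - A x) \<le> \<epsilon> * norm x) \<Longrightarrow>
      i + m - 1 \<le> n \<and>
      (\<forall>\<sigma>. ?S \<sigma> = (1 / (1 + lam i)) *\<^sub>R \<sigma> \<longrightarrow>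
         (\<exists>w\<in>span (\<phi>' ` {i..<i + m}). norm (\<sigma> - w) \<le> norm (?S \<sigma> - A \<sigma>) / \<epsilon>))"
    using eigenspace_approximation[OF saS cpt es assms(12,13) mult'] by blast
  obtain h0 where h0: "h0 > 0" "\<And>h x. 0 < h \<Longrightarrow> h < h0 \<Longrightarrow> norm (?S x - ?Sh h x) \<le> \<epsilon> * norm x"
    using small[OF \<epsilon>] by blast
  \<comment> \<open>Independent of \<open>h\<close> and \<open>j\<close>: \<open>\<epsilon>\<close>
    was fixed by the continuous operator and its eigenvalue alone.\<close>
  define C1 where "C1 = (2 * \<bar>R\<bar> + 1) * (2 / \<epsilon> + 1)"
  have C1: "C1 \<ge> 0" using \<epsilon> by (simp add: C1_def)
  have main: "i + m - 1 \<le> N h \<and>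
      (\<forall>j\<in>{i..<i + m}. \<exists>w\<in>lin_span (uh h) {i..<i + m}.
         H1_norm \<Omega> (\<lambda>x. u j x - w x)
           \<le> C1 * best_approximation_error \<Omega> (\<Sigma>h h) (Uh h) (lin_span u {i..<i + m}))"
    if h: "0 < h" "h < h0" for h
  proof -
    interpret d: discretization \<Omega> R "\<Sigma>h h" "Uh h" by (rule disc[OF h(1)])
    obtain B where B: "finite B" "range (?Sh h) \<subseteq> span B" using fr[OF h(1)] by blast
    have P: "i + m - 1 \<le> N h \<and>
      (\<forall>\<sigma>. ?S \<sigma> = (1 / (1 + lam i)) *\<^sub>R \<sigma> \<longrightarrow>
         (\<exists>w\<in>span (d.eigvec (lamh h) (uh h) ` {i..<i + m}). norm (\<sigma> - w) \<le> norm (?S \<sigma> - ?Sh h \<sigma>) / \<epsilon>))"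
      by (rule sp, intro conjI allI)
        (rule saSh[OF h(1)] B(1) B(2) d.eigen_system_S[OF enh[OF h(1)]] h0(2)[OF h])+
    have "\<exists>w\<in>lin_span (uh h) {i..<i + m}. H1_norm \<Omega> (\<lambda>x. u j x - w x)
           \<le> C1 * best_approximation_error \<Omega> (\<Sigma>h h) (Uh h) (lin_span u {i..<i + m})"
      if j: "j \<in> {i..<i + m}" for j
    proof -
      have j1: "j \<in> {1..}" using j assms(12) by auto
      have lj: "lam j = lam i" using mult[of j] j j1 by simp
      have sub: "{i..<i + m} \<subseteq> {1..N h}" using P assms(12,13) by auto
      obtain w where w: "w \<in> lin_span (uh h) {i..<i + m}" "H1_norm \<Omega> (\<lambda>x. u j x - w x) \<le> C1 *
        (INF (\<tau>, v)\<in>\<Sigma>h h \<times> Uh h. Hdiv_norm \<Omega> (\<lambda>x. weak_grad \<Omega> (u j) x - \<tau> x) + H1_norm \<Omega> (\<lambda>x. u j x - v x))"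
        using eigenspace_errors[OF disc[OF h(1)] en enh[OF h(1)] finite_atLeastLessThan sub j1 \<epsilon>] P
        unfolding lj C1_def by blast
      have z: "(\<lambda>x. 0) \<in> \<Sigma>h h" "(\<lambda>x. 0) \<in> Uh h"
        using fdS[OF h(1)] fdU[OF h(1)] by (auto simp: finite_dim_space_def)
      have "(INF (\<tau>, v)\<in>\<Sigma>h h \<times> Uh h. Hdiv_norm \<Omega> (\<lambda>x. weak_grad \<Omega> (u j) x - \<tau> x) + H1_norm \<Omega> (\<lambda>x. u j x - v x))
        \<le> best_approximation_error \<Omega> (\<Sigma>h h) (Uh h) (lin_span u {i..<i + m})"
        by (rule INF_le_best_approximation_error[OF disc[OF h(1)] z en _ _ j, where l="lam i"])
          (use mult assms(12) in auto)
      from mult_left_mono[OF this C1] show ?thesis using w by (intro bexI[of _ w]) auto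
    qed
    then show ?thesis using P by blast
  qed
  show ?thesis using main h0(1) by blast
qed

end
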